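(* Let $A$ be a symmetric positive definite $n\times n$ matrix, and let $\{u^{\varepsilon}\}_{\varepsilon>0}$ be a family of smooth solutions on $\mathbb{R}\times[0,T]$ of $$\partial_t u+\partial_x F(u)=G(u)+\varepsilon(Au_{xx}-u_{tt}),\qquad u\in\mathbb{R}^n,$$ emanating from smooth initial data. The family $\{u^{\varepsilon}\}$ is assumed to decay fast at infinity. Assume: (1) (Entropy) there are $\eta,q:\mathbb{R}^n\to\mathbb{R}$ and $\alpha,\beta>0$ with $\eta$ strictly convex, $\mathrm{D}\eta(u)\,\mathrm{D}F(u)=\mathrm{D}q(u)$, $\beta I\le \mathrm{D}^2\eta(u)\le\tfrac12\alpha I$ for all $u\in\mathbb{R}^n$, $\eta(u)\ge\eta(0)=0$ and $\mathrm{D}\eta(0)=0$; (2) (Subcharacteristic condition) for this $\alpha$ there is $\nu>0$ with $\tfrac12\big(A\,\mathrm{D}^2\eta(u)+\mathrm{D}^2\eta(u)A\big)-\alpha\,\mathrm{D}F(u)^{\top}\mathrm{D}F(u)\ge\nu I$ for all $u\in\mathbb{R}^n$; (3) (General source) for every compact set $\mathcal{A}$ there is $L_{\mathcal{A}}>0$ such that $|G(u)-G(\bar u)|\le L_{\mathcal{A}}|u-\bar u|$ for all $u\in\mathbb{R}^n$, $\bar u\in\mathcal{A}$; so that the following stability estimate holds for all $t\in[0,T]$: $$\varphi(t)\le C_1\,\varphi(0),\qquad \varphi(t)=\int_{\mathbb{R}}|u^{\varepsilon}|^2+\varepsilon^2|u^{\varepsilon}_x|^2+\varepsilon^2|u^{\varepsilon}_t|^2\,dx,$$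 with a constant $C_1=C_1(A,\alpha,\beta,T,L)>0$ independent of $\varepsilon$, where $L$ is a constant, provided by (3) and $G(0)=0$, with $|G(u)|\le L|u|$ for all $u\in\mathbb{R}^n$. Then, for entropy-entropy flux pairs $(\bar\eta,\bar q)$ (i.e. $\mathrm{D}\bar\eta\,\mathrm{D}F=\mathrm{D}\bar q$) satisfying, for some constant $C$, $$\|\bar\eta\|_{L^\infty},\ \|\bar q\|_{L^\infty},\ \|\mathrm{D}\bar\eta\|_{L^\infty},\ \|\mathrm{D}^2\bar\eta\|_{L^\infty}\le C,$$ the family $\{\partial_t\bar\eta(u^{\varepsilon})+\partial_x\bar q(u^{\varepsilon})\}_{\varepsilon}$ lies in a compact set of $H^{-1}_{loc}(\mathbb{R}\times[0,T])$.
   Context: The space dimension is one. $F,G:\mathbb{R}^n\to\mathbb{R}^n$ are column-vector valued, and $G$ is continuous with $G(0)=0$. $\mathrm{D}$ is the differential with respect to the state vector $u\in\mathbb{R}^n$, acting as a row operation; so $\mathrm{D}\eta$ is a row vector, $\mathrm{D}F$ is the Jacobian and $\mathrm{D}^2\eta$ the Hessian. $I$ is the $n\times n$ identity matrix, and matrix inequalities are in the sense of quadratic forms.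
   Formalization: For the compactness claim the initial data are assumed uniform in ε: φ(0) ≤ M(1+ε²) with M independent of ε (automatic for ε-independent data); with arbitrary ε-dependent smooth data, e.g. ever faster oscillating data, compactness fails. *)

theory Defs
  imports "HOL-Analysis.Analysis"
begin

section \<open>Differential calculus in the state variable\<close>

text \<open>Row vectors (such as the differential of a scalar function) are represented by
  their entries, and the product of a row vector with a matrix is the library's \<open>v*\<close>.\<close>

definition grad :: "(real^'n \<Rightarrow> real) \<Rightarrow> real^'n \<Rightarrow> real^'n" where
  "grad f u = (\<chi> i. frechet_derivative f (at u) (axis i 1))"

definition jac :: "(real^'n \<Rightarrow> real^'m) \<Rightarrow> real^'n \<Rightarrow> real^'n^'m" where
  "jac F u = jacobian F (at u)"

definition hess :: "(real^'n \<Rightarrow> real) \<Rightarrow> real^'n \<Rightarrow> real^'n^'n" where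
  "hess f u = jac (grad f) u"

definition C1_map :: "(real^'n \<Rightarrow> real^'m) \<Rightarrow> bool" where
  "C1_map F \<longleftrightarrow> (\<forall>u. F differentiable (at u)) \<and> continuous_on UNIV (jac F)"

definition C1_scalar :: "(real^'n \<Rightarrow> real) \<Rightarrow> bool" where
  "C1_scalar f \<longleftrightarrow> (\<forall>u. f differentiable (at u)) \<and> continuous_on UNIV (grad f)"

definition C2_scalar :: "(real^'n \<Rightarrow> real) \<Rightarrow> bool" where
  "C2_scalar f \<longleftrightarrow> C1_scalar f \<and> C1_map (grad f)"

definition strictly_convex :: "('a::real_vector \<Rightarrow> real) \<Rightarrow> bool" where
  "strictly_convex f \<longleftrightarrow>
     (\<forall>x y s. x \<noteq> y \<and> 0 < s \<and> s < 1 \<longrightarrow>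
        f ((1 - s) *\<^sub>R x + s *\<^sub>R y) < (1 - s) * f x + s * f y)"

text \<open>Matrix inequalities in the sense of quadratic forms.\<close>

definition quad_le :: "real^'n^'n \<Rightarrow> real^'n^'n \<Rightarrow> bool" where
  "quad_le M N \<longleftrightarrow> (\<forall>v. v \<bullet> (M *v v) \<le> v \<bullet> (N *v v))"

definition entropy_pair ::
    "(real^'n \<Rightarrow> real^'n) \<Rightarrow> (real^'n \<Rightarrow> real) \<Rightarrow> (real^'n \<Rightarrow> real) \<Rightarrow> bool" where
  "entropy_pair F \<eta> q \<longleftrightarrow>
     C2_scalar \<eta> \<and> C1_scalar q \<and> (\<forall>u. grad \<eta> u v* jac F u = grad q u)"


section \<open>Functions of \<open>(x, t)\<close>\<close>

definition pdx :: "(real \<times> real \<Rightarrow> 'a::real_normed_vector) \<Rightarrow> real \<times> real \<Rightarrow> 'a" where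
  "pdx f = (\<lambda>(x, t). vector_derivative (\<lambda>y. f (y, t)) (at x))"

text \<open>The time interval \<open>I\<close> is a parameter: for \<open>I = {0..T}\<close> the derivative at the end points
  is one-sided, and nothing is required of \<open>f\<close> outside the strip.\<close>

definition pdt :: "real set \<Rightarrow> (real \<times> real \<Rightarrow> 'a::real_normed_vector) \<Rightarrow> real \<times> real \<Rightarrow> 'a" where
  "pdt I f = (\<lambda>(x, t). vector_derivative (\<lambda>s. f (x, s)) (at t within I))"

text \<open>\<open>C\<^sup>\<infinity>\<close> on \<open>S\<close>: there is a family \<open>D i j\<close> (the derivatives of order \<open>i\<close> in \<open>x\<close> and
  \<open>j\<close> in \<open>t\<close>), all of whose members are Frechet differentiable on \<open>S\<close> with partial derivatives
  \<open>D (Suc i) j\<close> and \<open>D i (Suc j)\<close>; these are then continuous. For a closed strip this is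
  smoothness up to the boundary.\<close>

definition smooth_xt :: "(real \<times> real) set \<Rightarrow> (real \<times> real \<Rightarrow> 'a::real_normed_vector) \<Rightarrow> bool" where
  "smooth_xt S f \<longleftrightarrow>
     (\<exists>D. (\<forall>p\<in>S. D 0 0 p = f p) \<and>
        (\<forall>i j. \<forall>p\<in>S. (D i j has_derivative
            (\<lambda>h. fst h *\<^sub>R D (Suc i) j p + snd h *\<^sub>R D i (Suc j) p)) (at p within S)))"

definition strip :: "real \<Rightarrow> (real \<times> real) set" where
  "strip T = UNIV \<times> {0..T}"

definition open_strip :: "real \<Rightarrow> (real \<times> real) set" where
  "open_strip T = UNIV \<times> {0<..<T}"

definition rapidly_decaying :: "real \<Rightarrow> (real \<times> real \<Rightarrow> 'a::real_normed_vector) \<Rightarrow> bool" where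
  "rapidly_decaying T f \<longleftrightarrow>
     (\<forall>k. \<exists>C. \<forall>p\<in>strip T. (1 + \<bar>fst p\<bar>) ^ k * norm (f p) \<le> C)"


section \<open>The relaxation system\<close>

definition relaxation_solution ::
    "real^'n^'n \<Rightarrow> (real^'n \<Rightarrow> real^'n) \<Rightarrow> (real^'n \<Rightarrow> real^'n) \<Rightarrow> real \<Rightarrow> real
      \<Rightarrow> (real \<times> real \<Rightarrow> real^'n) \<Rightarrow> bool" where
  "relaxation_solution A F G T \<epsilon> u \<longleftrightarrow>
     smooth_xt (strip T) u \<and>
     (\<forall>p\<in>strip T.
        pdt {0..T} u p + pdx (\<lambda>p. F (u p)) p =
        G (u p) + \<epsilon> *\<^sub>R (A *v pdx (pdx u) p - pdt {0..T} (pdt {0..T} u) p))"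

text \<open>Decay at infinity of a solution and of its first-order derivatives. The
  constants may depend on the solution, hence on \<open>\<epsilon>\<close>.\<close>

definition decaying :: "real \<Rightarrow> (real \<times> real \<Rightarrow> real^'n) \<Rightarrow> bool" where
  "decaying T u \<longleftrightarrow>
     rapidly_decaying T u \<and> rapidly_decaying T (pdx u) \<and> rapidly_decaying T (pdt {0..T} u)"

definition energy :: "real \<Rightarrow> real \<Rightarrow> (real \<times> real \<Rightarrow> real^'n) \<Rightarrow> real \<Rightarrow> real" where
  "energy T \<epsilon> u t =
     (LINT x|lborel. (norm (u (x, t)))\<^sup>2 + \<epsilon>\<^sup>2 * (norm (pdx u (x, t)))\<^sup>2
        + \<epsilon>\<^sup>2 * (norm (pdt {0..T} u (x, t)))\<^sup>2)"

text \<open>Uniformity in \<open>\<epsilon>\<close> of the data at \<open>t = 0\<close>. It holds when \<open>u(\<cdot>,0)\<close> and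
  \<open>u\<^sub>t(\<cdot>,0)\<close> are fixed functions independent of \<open>\<epsilon>\<close> (the factor \<open>1 + \<epsilon>\<^sup>2\<close> is the
  growth of the energy of such data), and whenever the initial energies are bounded.\<close>

definition bounded_data :: "real \<Rightarrow> (real \<Rightarrow> real \<times> real \<Rightarrow> real^'n) \<Rightarrow> bool" where
  "bounded_data T U \<longleftrightarrow> (\<exists>M. \<forall>\<epsilon>>0. energy T \<epsilon> (U \<epsilon>) 0 \<le> M * (1 + \<epsilon>\<^sup>2))"


section \<open>The space \<open>H\<^sup>-\<^sup>1\<^sub>l\<^sub>o\<^sub>c\<close> on \<open>\<real> \<times> [0,T]\<close>\<close>

definition test_functions :: "(real \<times> real) set \<Rightarrow> (real \<times> real \<Rightarrow> real) set" where
  "test_functions \<Omega> =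
     {\<phi>. smooth_xt UNIV \<phi> \<and> compact (closure {p. \<phi> p \<noteq> 0}) \<and> closure {p. \<phi> p \<noteq> 0} \<subseteq> \<Omega>}"

definition H1_norm :: "(real \<times> real \<Rightarrow> real) \<Rightarrow> real" where
  "H1_norm \<phi> = sqrt (LINT p|lborel. (\<phi> p)\<^sup>2 + (pdx \<phi> p)\<^sup>2 + (pdt UNIV \<phi> p)\<^sup>2)"

text \<open>Dual norm of \<open>H\<^sup>-\<^sup>1(\<Omega>) = (H\<^sup>1\<^sub>0(\<Omega>))\<^sup>*\<close>. As the test functions are dense in \<open>H\<^sup>1\<^sub>0(\<Omega>)\<close>, an element
  of \<open>H\<^sup>-\<^sup>1(\<Omega>)\<close> is a linear functional on \<^term>\<open>test_functions \<Omega>\<close> that is bounded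
  for \<^const>\<open>H1_norm\<close>.\<close>

definition Hm1_norm :: "(real \<times> real) set \<Rightarrow> ((real \<times> real \<Rightarrow> real) \<Rightarrow> real) \<Rightarrow> real" where
  "Hm1_norm \<Omega> \<Lambda> = (SUP \<phi>\<in>{\<phi> \<in> test_functions \<Omega>. H1_norm \<phi> \<le> 1}. \<bar>\<Lambda> \<phi>\<bar>)"

text \<open>Bounded open subsets of \<open>\<real> \<times> (0,T)\<close>, i.e. those relatively compact in the closed strip:
  their closure may touch \<open>t = 0\<close> and \<open>t = T\<close>.\<close>

definition local_domain :: "real \<Rightarrow> (real \<times> real) set \<Rightarrow> bool" where
  "local_domain T \<Omega> \<longleftrightarrow> open \<Omega> \<and> bounded \<Omega> \<and> \<Omega> \<subseteq> open_strip T"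

definition Hm1_loc :: "real \<Rightarrow> ((real \<times> real \<Rightarrow> real) \<Rightarrow> real) set" where
  "Hm1_loc T =
     {\<Lambda> \<in> extensional (test_functions (open_strip T)).
        (\<forall>\<phi>\<in>test_functions (open_strip T). \<forall>\<psi>\<in>test_functions (open_strip T). \<forall>c.
            \<Lambda> (\<lambda>p. \<phi> p + \<psi> p) = \<Lambda> \<phi> + \<Lambda> \<psi> \<and> \<Lambda> (\<lambda>p. c * \<phi> p) = c * \<Lambda> \<phi>) \<and>
        (\<forall>\<Omega>. local_domain T \<Omega> \<longrightarrow>
            (\<exists>C. \<forall>\<phi>\<in>test_functions \<Omega>. \<bar>\<Lambda> \<phi>\<bar> \<le> C * H1_norm \<phi>))}"

text \<open>The locally convex topology given by the seminorms \<^term>\<open>Hm1_norm \<Omega>\<close>.\<close>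

definition Hm1_loc_topology :: "real \<Rightarrow> ((real \<times> real \<Rightarrow> real) \<Rightarrow> real) topology" where
  "Hm1_loc_topology T = topology_generated_by
     {{\<Lambda>' \<in> Hm1_loc T. Hm1_norm \<Omega> (\<lambda>\<phi>. \<Lambda>' \<phi> - \<Lambda> \<phi>) < r} | \<Lambda> \<Omega> r.
        \<Lambda> \<in> Hm1_loc T \<and> local_domain T \<Omega> \<and> 0 < r}"

text \<open>The (distributional) derivative \<open>\<partial>\<^sub>t f + \<partial>\<^sub>x g\<close> on \<open>\<real> \<times> (0,T)\<close>.\<close>

definition dist_dt_dx ::
    "real \<Rightarrow> (real \<times> real \<Rightarrow> real) \<Rightarrow> (real \<times> real \<Rightarrow> real) \<Rightarrow> (real \<times> real \<Rightarrow> real) \<Rightarrow> real" where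
  "dist_dt_dx T f g =
     restrict (\<lambda>\<phi>. - (LINT p:open_strip T|lborel. f p * pdt UNIV \<phi> p + g p * pdx \<phi> p))
       (test_functions (open_strip T))"

end

theory Submission
  imports Defs
begin

text \<open>Differentiating \<open>\<eta>(u) + \<epsilon> D\<eta>(u) u\<^sub>t + \<alpha> \<epsilon>\<^sup>2/2 (u\<^sub>x \<cdot> A u\<^sub>x + |u\<^sub>t|\<^sup>2)\<close> in time, the subcharacteristic
  condition makes the terms quadratic in the derivatives dissipative, and this energy is comparable to
  \<open>|u|\<^sup>2 + \<epsilon>\<^sup>2 |u\<^sub>x|\<^sup>2 + \<epsilon>\<^sup>2 |u\<^sub>t|\<^sup>2\<close> because \<open>|D\<eta>|\<^sup>2 \<le> \<alpha> \<eta>\<close>. Gronwall's inequality on \<open>[-R,R]\<close> and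
  \<open>R \<rightarrow> \<infinity>\<close> give the stability estimate, and also a bound of \<open>\<epsilon> \<integral>\<integral> |u\<^sub>x|\<^sup>2 + |u\<^sub>t|\<^sup>2\<close> for \<open>\<epsilon> \<le> 1\<close>.

  The entropy production \<open>\<Lambda>\<close> is bounded on \<open>W\<^sup>1\<^sup>,\<^sup>1\<close> (the entropy pair is bounded), while the equation
  yields \<open>|\<Lambda> \<psi>| \<le> C (\<parallel>\<psi>\<parallel> + \<surd>\<epsilon> \<parallel>D\<psi>\<parallel> + sup |\<psi>|)\<close> with \<open>L\<^sup>2\<close> norms. Splitting
  \<open>\<phi> = s arctan (\<phi>/s) + (\<phi> - s arctan (\<phi>/s))\<close> with \<open>s\<^sup>2 = \<parallel>\<phi>\<parallel>\<close> shows that \<open>\<Lambda> \<phi>\<close> is small,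
  uniformly in \<open>\<epsilon> \<le> \<epsilon>\<^sub>0\<close>, whenever \<open>\<phi>\<close> is bounded in \<open>H\<^sup>1\<close> and small in \<open>L\<^sup>2\<close>; for \<open>\<epsilon> \<ge> \<epsilon>\<^sub>0\<close> the
  functional is bounded on \<open>L\<^sup>2\<close>. By Rellich's theorem the \<open>H\<^sup>1\<close> unit ball is therefore totally bounded
  for the seminorm \<open>sup\<^sub>\<epsilon> |\<Lambda>\<^sub>\<epsilon> \<phi>|\<close>, and Tychonoff's theorem gives the compact set.\<close>

section \<open>Calculus in the state variable\<close>

text \<open>The term \<epsilon> (D^2 \<eta>'(u) u_x . A u_x - D^2 \<eta>'(u) u_t . u_t) of the
  entropy production is bounded in L^1 only, so it has to be tested with sup |\<psi>|, and in two
  variables H^1 does not embed in L^infinity. This is what the truncation at level s is for: s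
  arctan (\<phi>/s) is at most 2 s, while the gradient of the remainder is damped where |\<phi>| is
  small against s and is of order |\<phi>| |D\<phi>| / s, hence small in L^1. The choice of s makes
  both errors of order s. This dual estimate takes the place of Murat's lemma. The multiplier behind
  the energy is D\<eta>(u) + \<alpha> \<epsilon> u_t: the first summand alone leaves \<epsilon> D^2
  \<eta>(u) u_t . u_t with the wrong sign, the second supplies \<alpha> \<epsilon> |u_t|^2 to absorb
  it. The family runs over all \<epsilon> > 0 and the initial energy may grow like 1 + \<epsilon>^2.
  Away from \<epsilon> = 0 the stability estimate still bounds u_x and u_t in L^2, since (1 +
  \<epsilon>^2) / \<epsilon>^2 is bounded there.\<close>

lemma norm_matrix_vector_le:
  fixes M :: "real^'n^'m"
  shows "norm (M *v x) \<le> norm M * norm x"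
proof -
  have "norm (M *v x) \<le> L2_set (\<lambda>i. norm (M $ i) * norm x) UNIV"
    unfolding norm_vec_def [of "M *v x"]
    by (rule L2_set_mono) (auto simp: matrix_vector_mul_component Cauchy_Schwarz_ineq2)
  also have "\<dots> = norm M * norm x"
    by (simp add: norm_vec_def [of M] L2_set_right_distrib mult.commute)
  finally show ?thesis .
qed

lemma jac_has_derivative:
  assumes "C1_map F"
  shows "(F has_derivative (\<lambda>h. jac F u *v h)) (at u)"
  using assms jacobian_works[of F "at u"] by (simp add: C1_map_def jac_def)

lemma grad_has_derivative:
  assumes "C1_scalar f"
  shows "(f has_derivative (\<lambda>h. grad f u \<bullet> h)) (at u)"
proof -
  have d: "(f has_derivative frechet_derivative f (at u)) (at u)"
    using assms by (simp add: C1_scalar_def frechet_derivative_works)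
  then have l: "linear (frechet_derivative f (at u))"
    by (rule has_derivative_linear)
  have "frechet_derivative f (at u) = (\<lambda>h. grad f u \<bullet> h)"
  proof
    fix h
    have "frechet_derivative f (at u) h = frechet_derivative f (at u) (\<Sum>i\<in>UNIV. (h$i) *\<^sub>R axis i 1)"
      by (simp add: basis_expansion flip: scalar_mult_eq_scaleR)
    also have "\<dots> = (\<Sum>i\<in>UNIV. h$i * frechet_derivative f (at u) (axis i 1))"
      by (simp add: linear_sum[OF l] linear_scale[OF l])
    finally show "frechet_derivative f (at u) h = grad f u \<bullet> h"
      by (simp add: grad_def inner_vec_def mult.commute)
  qed
  with d show ?thesis by simp
qed

lemma hess_has_derivative:
  assumes "C2_scalar f"
  shows "(grad f has_derivative (\<lambda>h. hess f u *v h)) (at u)"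
  using assms jac_has_derivative[of "grad f"] by (simp add: C2_scalar_def hess_def)

lemma has_vector_derivative_chain_at:
  assumes "(f has_derivative f') (at (g t))" "(g has_vector_derivative g') (at t within S)"
  shows "((\<lambda>s. f (g s)) has_vector_derivative f' g') (at t within S)"
proof -
  have l: "linear f'" using assms(1) by (rule has_derivative_linear)
  show ?thesis
    using has_derivative_compose[OF assms(2)[unfolded has_vector_derivative_def] assms(1)]
    by (simp add: has_vector_derivative_def linear_scale[OF l])
qed

lemma continuous_on_jac: "C1_map F \<Longrightarrow> continuous_on S (jac F)"
  using continuous_on_subset unfolding C1_map_def by blast

lemma continuous_on_grad: "C1_scalar f \<Longrightarrow> continuous_on S (grad f)"
  using continuous_on_subset unfolding C1_scalar_def by blast

lemma continuous_on_hess: "C2_scalar f \<Longrightarrow> continuous_on S (hess f)"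
  using continuous_on_jac[of "grad f"] by (simp add: C2_scalar_def hess_def[abs_def])

lemma C2_scalar_imp_C1: "C2_scalar f \<Longrightarrow> C1_scalar f"
  by (simp add: C2_scalar_def)

lemma continuous_on_C1_scalar: "C1_scalar f \<Longrightarrow> continuous_on S f"
  by (meson C1_scalar_def differentiable_imp_continuous_within continuous_at_imp_continuous_on)

lemma continuous_on_matrix_vector_mult [continuous_intros]:
  fixes M :: "'a::topological_space \<Rightarrow> real^'n^'m"
  assumes "continuous_on S M" "continuous_on S v"
  shows "continuous_on S (\<lambda>x. M x *v v x)"
  unfolding matrix_vector_mult_def
  by (intro continuous_intros continuous_on_vec_lambda assms)

text \<open>The mean value theorem is applied twice: in direction v to the difference of
  \<open>f\<close> shifted by h w, then in direction w to \<open>grad f \<bullet> v\<close>. The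
  intermediate points depend on this order, so swapping v and w gives another pair.\<close>

lemma second_difference_mean_value:
  fixes f :: "real^'n \<Rightarrow> real"
  assumes "C2_scalar f" "0 < h"
  obtains a b where "0 < a" "a < h" "0 < b" "b < h"
    "f (u + h *\<^sub>R v + h *\<^sub>R w) - f (u + h *\<^sub>R v) - f (u + h *\<^sub>R w) + f u
      = h * h * ((hess f (u + a *\<^sub>R v + b *\<^sub>R w) *v w) \<bullet> v)"
proof -
  have d: "((\<lambda>s. f (u + s *\<^sub>R v + h *\<^sub>R w) - f (u + s *\<^sub>R v)) has_real_derivative
      (grad f (u + s *\<^sub>R v + h *\<^sub>R w) \<bullet> v - grad f (u + s *\<^sub>R v) \<bullet> v)) (at s)" for s
    unfolding has_real_derivative_iff_has_vector_derivative
    by (intro derivative_intros has_vector_derivative_chain_at[of f]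
      grad_has_derivative C2_scalar_imp_C1 assms)
      (auto intro!: derivative_eq_intros)
  obtain a where a: "0 < a" "a < h" 
    "(f (u + h *\<^sub>R v + h *\<^sub>R w) - f (u + h *\<^sub>R v)) - (f (u + 0 *\<^sub>R v + h *\<^sub>R w) - f (u + 0 *\<^sub>R v)) 
       = (h - 0) * (grad f (u + a *\<^sub>R v + h *\<^sub>R w) \<bullet> v - grad f (u + a *\<^sub>R v) \<bullet> v)"
    using MVT2[OF \<open>0 < h\<close> d] by blast
  have d': "((\<lambda>s. grad f (u + a *\<^sub>R v + s *\<^sub>R w) \<bullet> v) has_real_derivative
      ((hess f (u + a *\<^sub>R v + s *\<^sub>R w) *v w) \<bullet> v)) (at s)" for s
    unfolding has_real_derivative_iff_has_vector_derivative
    by (rule has_vector_derivative_chain_at[where f="\<lambda>x. grad f x \<bullet> v" and f'="\<lambda>y. (hess f (u + a *\<^sub>R v + s *\<^sub>R w) *v y) \<bullet> v"])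
      (auto intro!: derivative_eq_intros has_derivative_inner_left hess_has_derivative assms)
  obtain b where b: "0 < b" "b < h" 
    "grad f (u + a *\<^sub>R v + h *\<^sub>R w) \<bullet> v - grad f (u + a *\<^sub>R v + 0 *\<^sub>R w) \<bullet> v
       = (h - 0) * ((hess f (u + a *\<^sub>R v + b *\<^sub>R w) *v w) \<bullet> v)"
    using MVT2[OF \<open>0 < h\<close> d'] by blast
  show thesis
    by (rule that[OF a(1,2) b(1,2)]) (use a(3) b(3) in \<open>simp add: algebra_simps\<close>)
qed

text \<open>The second difference is symmetric in v and w. Dividing its two mean value
  representations by h^2 and letting h tend to 0 gives the two sides, by continuity of
  \<open>hess f\<close>.\<close>

lemma hess_symmetric:
  fixes f :: "real^'n \<Rightarrow> real"
  assumes "C2_scalar f"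
  shows "(hess f u *v w) \<bullet> v = (hess f u *v v) \<bullet> w"
proof -
  define h where "h n = inverse (real (Suc n))" for n
  have h: "0 < h n" for n by (simp add: h_def)
  have h0: "h \<longlonglongrightarrow> 0" unfolding h_def by (rule LIMSEQ_inverse_real_of_nat)
  have lim: "(\<lambda>n. (hess f (u + a n *\<^sub>R x + b n *\<^sub>R y) *v z) \<bullet> z') \<longlonglongrightarrow> (hess f u *v z) \<bullet> z'"
    if "\<And>n. 0 < a n \<and> a n < h n" "\<And>n. 0 < b n \<and> b n < h n" for a b x y z z'
  proof -
    have "a \<longlonglongrightarrow> 0" "b \<longlonglongrightarrow> 0"
      by (rule tendsto_sandwich[OF _ _ tendsto_const h0], use that in \<open>auto intro!: always_eventually less_imp_le\<close>)+
    then have "(\<lambda>n. u + a n *\<^sub>R x + b n *\<^sub>R y) \<longlonglongrightarrow> u + 0 *\<^sub>R x + 0 *\<^sub>R y"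
      by (intro tendsto_intros)
    moreover have "isCont (\<lambda>p. (hess f p *v z) \<bullet> z') u"
    proof -
      have "continuous_on UNIV (\<lambda>p. (hess f p *v z) \<bullet> z')"
        by (intro continuous_intros continuous_on_hess assms)
      then show ?thesis by (simp add: continuous_on_eq_continuous_at)
    qed
    ultimately show ?thesis
      by (auto intro: isCont_tendsto_compose)
  qed
  have "\<exists>a b. 0 < a \<and> a < h n \<and> 0 < b \<and> b < h n \<and>
    f (u + h n *\<^sub>R v + h n *\<^sub>R w) - f (u + h n *\<^sub>R v) - f (u + h n *\<^sub>R w) + f u
      = h n * h n * ((hess f (u + a *\<^sub>R v + b *\<^sub>R w) *v w) \<bullet> v)" for n
    using second_difference_mean_value[OF assms h[of n], of u v w] by metis
  then obtain a b where ab: "\<And>n. 0 < a n \<and> a n < h n" "\<And>n. 0 < b n \<and> b n < h n"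
    "\<And>n. f (u + h n *\<^sub>R v + h n *\<^sub>R w) - f (u + h n *\<^sub>R v) - f (u + h n *\<^sub>R w) + f u
      = h n * h n * ((hess f (u + a n *\<^sub>R v + b n *\<^sub>R w) *v w) \<bullet> v)"
    by metis
  have "\<exists>a b. 0 < a \<and> a < h n \<and> 0 < b \<and> b < h n \<and>
    f (u + h n *\<^sub>R w + h n *\<^sub>R v) - f (u + h n *\<^sub>R w) - f (u + h n *\<^sub>R v) + f u
      = h n * h n * ((hess f (u + a *\<^sub>R w + b *\<^sub>R v) *v v) \<bullet> w)" for n
    using second_difference_mean_value[OF assms h[of n], of u w v] by metis
  then obtain c d where cd: "\<And>n. 0 < c n \<and> c n < h n" "\<And>n. 0 < d n \<and> d n < h n"
    "\<And>n. f (u + h n *\<^sub>R w + h n *\<^sub>R v) - f (u + h n *\<^sub>R w) - f (u + h n *\<^sub>R v) + f u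
      = h n * h n * ((hess f (u + c n *\<^sub>R w + d n *\<^sub>R v) *v v) \<bullet> w)"
    by metis
  have "(hess f (u + a n *\<^sub>R v + b n *\<^sub>R w) *v w) \<bullet> v = (hess f (u + c n *\<^sub>R w + d n *\<^sub>R v) *v v) \<bullet> w" for n
  proof -
    have "u + h n *\<^sub>R w + h n *\<^sub>R v = u + h n *\<^sub>R v + h n *\<^sub>R w"
      by (simp add: algebra_simps)
    then have "h n * h n * ((hess f (u + a n *\<^sub>R v + b n *\<^sub>R w) *v w) \<bullet> v)
      = h n * h n * ((hess f (u + c n *\<^sub>R w + d n *\<^sub>R v) *v v) \<bullet> w)"
      using ab(3)[of n] cd(3)[of n] by (simp only:)
    then show ?thesis using h[of n] by simp
  qed
  then have "(\<lambda>n. (hess f (u + c n *\<^sub>R w + d n *\<^sub>R v) *v v) \<bullet> w) \<longlonglongrightarrow> (hess f u *v w) \<bullet> v"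
    using lim[OF ab(1,2), of v w w v] by simp
  then show ?thesis
    using lim[OF cd(1,2), of w v v w] by (rule LIMSEQ_unique)
qed

text \<open>Maclaurin's formula with Lagrange remainder for s -> f (u + s v), read at s = 1.\<close>

lemma taylor_hess:
  fixes f :: "real^'n \<Rightarrow> real"
  assumes "C2_scalar f"
  obtains \<xi> where "f (u + v) = f u + grad f u \<bullet> v + (v \<bullet> (hess f \<xi> *v v)) / 2"
proof -
  define df where "df m s = (if m = 0 then f (u + s *\<^sub>R v) else if m = 1 then grad f (u + s *\<^sub>R v) \<bullet> v
     else (hess f (u + s *\<^sub>R v) *v v) \<bullet> v)" for m :: nat and s :: real
  have d0: "((\<lambda>s. f (u + s *\<^sub>R v)) has_real_derivative grad f (u + s *\<^sub>R v) \<bullet> v) (at s)" for s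
    unfolding has_real_derivative_iff_has_vector_derivative
    by (intro has_vector_derivative_chain_at[of f] grad_has_derivative C2_scalar_imp_C1 assms)
      (auto intro!: derivative_eq_intros)
  have d1: "((\<lambda>s. grad f (u + s *\<^sub>R v) \<bullet> v) has_real_derivative
      ((hess f (u + s *\<^sub>R v) *v v) \<bullet> v)) (at s)" for s
    unfolding has_real_derivative_iff_has_vector_derivative
    by (rule has_vector_derivative_chain_at[where f="\<lambda>x. grad f x \<bullet> v" and f'="\<lambda>y. (hess f (u + s *\<^sub>R v) *v y) \<bullet> v"])
      (auto intro!: derivative_eq_intros has_derivative_inner_left hess_has_derivative assms)
  have "\<exists>t>0. t < 1 \<and> f (u + 1 *\<^sub>R v) = (\<Sum>m<2. df m 0 / fact m * 1 ^ m) + df 2 t / fact 2 * 1 ^ 2"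
  proof (rule Maclaurin)
    show "\<forall>m t. m < 2 \<and> 0 \<le> t \<and> t \<le> 1 \<longrightarrow> DERIV (df m) t :> df (Suc m) t"
      using d0 d1 by (auto simp: df_def[abs_def] less_2_cases_iff)
  qed (auto simp: df_def)
  then obtain t where "f (u + v) = (\<Sum>m<2. df m 0 / fact m) + df 2 t / fact 2"
    by auto
  then have "f (u + v) = f u + grad f u \<bullet> v + (v \<bullet> (hess f (u + t *\<^sub>R v) *v v)) / 2"
    by (simp add: df_def numeral_2_eq_2 inner_commute)
  with that show thesis by blast
qed

section \<open>Quadratic forms: bounds for the entropy and for A\<close>

lemma quad_le_scalar_left: "quad_le (c *\<^sub>R mat 1) M \<longleftrightarrow> (\<forall>v. c * (v \<bullet> v) \<le> v \<bullet> (M *v v))"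
  by (simp add: quad_le_def flip: scaleR_matrix_vector_assoc)

lemma quad_le_scalar_right: "quad_le M (c *\<^sub>R mat 1) \<longleftrightarrow> (\<forall>v. v \<bullet> (M *v v) \<le> c * (v \<bullet> v))"
  by (simp add: quad_le_def flip: scaleR_matrix_vector_assoc)

text \<open>The first two bounds are Taylor's formula at 0, where \<open>\<eta>\<close> and
  \<open>grad \<eta>\<close> vanish. The third is the usual gradient bound for a nonnegative
  function with bounded Hessian: its quadratic majorant at u has to stay nonnegative at its
  minimum.\<close>

lemma entropy_bounds:
  fixes \<eta> :: "real^'n \<Rightarrow> real"
  assumes C2: "C2_scalar \<eta>"
    and lo: "\<And>u v. \<beta> * (v \<bullet> v) \<le> v \<bullet> (hess \<eta> u *v v)"
    and hi: "\<And>u v. v \<bullet> (hess \<eta> u *v v) \<le> \<alpha> / 2 * (v \<bullet> v)"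
    and "0 < \<alpha>" and min: "\<And>u. 0 \<le> \<eta> u" and "\<eta> 0 = 0" "grad \<eta> 0 = 0"
  shows "\<beta> / 2 * (norm u)^2 \<le> \<eta> u" "\<eta> u \<le> \<alpha> / 4 * (norm u)^2" "(norm (grad \<eta> u))^2 \<le> \<alpha> * \<eta> u"
proof -
  obtain x where x: "\<eta> (0 + u) = \<eta> 0 + grad \<eta> 0 \<bullet> u + (u \<bullet> (hess \<eta> x *v u)) / 2"
    using taylor_hess[OF C2] by blast
  show "\<beta> / 2 * (norm u)^2 \<le> \<eta> u" "\<eta> u \<le> \<alpha> / 4 * (norm u)^2"
    using x lo[of u x] hi[of u x] assms(6,7) by (auto simp: power2_norm_eq_inner)
  \<comment> \<open>Minimiser of v -> \<open>\<eta> u + grad \<eta> u \<bullet> v + \<alpha> / 4 *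
    (v \<bullet> v)\<close>; the minimal value is
    \<open>\<eta> u - (norm (grad \<eta> u))^2 / \<alpha>\<close>.\<close>
  define v where "v = (- (2 / \<alpha>)) *\<^sub>R grad \<eta> u"
  obtain y where y: "\<eta> (u + v) = \<eta> u + grad \<eta> u \<bullet> v + (v \<bullet> (hess \<eta> y *v v)) / 2"
    using taylor_hess[OF C2] by blast
  have "0 \<le> \<eta> u + grad \<eta> u \<bullet> v + \<alpha> / 4 * (v \<bullet> v)"
    using y hi[of v y] min[of "u + v"] by simp
  also have "\<dots> = \<eta> u - (norm (grad \<eta> u))^2 / \<alpha>"
    using \<open>0 < \<alpha>\<close> by (simp add: v_def power2_norm_eq_inner field_simps)
  finally show "(norm (grad \<eta> u))^2 \<le> \<alpha> * \<eta> u"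
    using \<open>0 < \<alpha>\<close> by (simp add: field_simps)
qed

text \<open>The constant is the minimum of the form on the unit sphere, attained by compactness; the
  form is homogeneous of degree two.\<close>

lemma positive_definite_lower_bound:
  fixes A :: "real^'n^'n"
  assumes "\<forall>v. v \<noteq> 0 \<longrightarrow> 0 < v \<bullet> (A *v v)"
  obtains a where "0 < a" "\<And>v. a * (norm v)^2 \<le> v \<bullet> (A *v v)"
proof -
  have "continuous_on (sphere 0 1) (\<lambda>v. v \<bullet> (A *v v))"
    by (intro continuous_intros)
  moreover have "sphere (0::real^'n) 1 \<noteq> {}"
    by simp
  ultimately obtain w where w: "w \<in> sphere 0 1" "\<And>v. v \<in> sphere 0 1 \<Longrightarrow> w \<bullet> (A *v w) \<le> v \<bullet> (A *v v)"
    using continuous_attains_inf[OF compact_sphere, of 0 1 "\<lambda>v. v \<bullet> (A *v v)"] by blast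
  show thesis
  proof (rule that)
    have "w \<noteq> 0" using w(1) by auto
    with assms show "0 < w \<bullet> (A *v w)" by blast
    show "w \<bullet> (A *v w) * (norm v)^2 \<le> v \<bullet> (A *v v)" for v
    proof (cases "v = 0")
      case False
      have "w \<bullet> (A *v w) \<le> sgn v \<bullet> (A *v sgn v)"
        using False by (intro w) (simp add: norm_sgn)
      then have "(norm v)^2 * (w \<bullet> (A *v w)) \<le> (norm v)^2 * (sgn v \<bullet> (A *v sgn v))"
        by (simp add: mult_left_mono)
      also have "\<dots> = (norm v *\<^sub>R sgn v) \<bullet> (A *v (norm v *\<^sub>R sgn v))"
        by (simp add: matrix_vector_mult_scaleR power2_eq_square)
      also have "norm v *\<^sub>R sgn v = v" using False by (simp add: sgn_div_norm)
      finally show ?thesis by (simp add: mult.commute)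
    qed simp
  qed
qed

lemma symmetric_matrix_inner:
  fixes A :: "real^'n^'n"
  assumes "transpose A = A"
  shows "(A *v v) \<bullet> w = v \<bullet> (A *v w)"
  using dot_lmul_matrix[of v A w] vector_transpose_matrix[of v A] assms by simp

lemma row_times_matrix_inner: "(v v* (M :: real^'n^'m)) \<bullet> w = v \<bullet> (M *v w)"
  by (rule dot_lmul_matrix)

section \<open>Integrals over rectangles and total boundedness\<close>

text \<open>Derivatives are taken within X and Y, hence one-sided at the edges of a closed slab, and
  are passed as functions. Continuity of both partials is what Leibniz' rule, Fubini and integration
  by parts ask for.\<close>

definition has_partials ::
    "real set \<Rightarrow> real set \<Rightarrow> (real \<times> real \<Rightarrow> 'a::real_normed_vector) \<Rightarrow>
      (real \<times> real \<Rightarrow> 'a) \<Rightarrow> (real \<times> real \<Rightarrow> 'a) \<Rightarrow> bool" where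
  "has_partials X Y f fx ft \<longleftrightarrow>
     continuous_on (X \<times> Y) f \<and> continuous_on (X \<times> Y) fx \<and> continuous_on (X \<times> Y) ft \<and>
     (\<forall>x\<in>X. \<forall>t\<in>Y. ((\<lambda>y. f (y, t)) has_vector_derivative fx (x, t)) (at x within X) \<and>
       ((\<lambda>s. f (x, s)) has_vector_derivative ft (x, t)) (at t within Y))"

lemma has_partialsD:
  assumes "has_partials X Y f fx ft"
  shows "continuous_on (X \<times> Y) f" "continuous_on (X \<times> Y) fx" "continuous_on (X \<times> Y) ft"
    "x \<in> X \<Longrightarrow> t \<in> Y \<Longrightarrow> ((\<lambda>y. f (y, t)) has_vector_derivative fx (x, t)) (at x within X)"
    "x \<in> X \<Longrightarrow> t \<in> Y \<Longrightarrow> ((\<lambda>s. f (x, s)) has_vector_derivative ft (x, t)) (at t within Y)"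
  using assms by (auto simp: has_partials_def)

lemma has_partials_subset:
  assumes "has_partials X Y f fx ft" "X' \<subseteq> X" "Y' \<subseteq> Y"
  shows "has_partials X' Y' f fx ft"
  using assms unfolding has_partials_def
  by (meson Sigma_mono continuous_on_subset has_vector_derivative_within_subset subset_iff)

lemma has_partials_diff:
  assumes "has_partials X Y f fx ft" "has_partials X Y g gx gt"
  shows "has_partials X Y (\<lambda>p. f p - g p) (\<lambda>p. fx p - gx p) (\<lambda>p. ft p - gt p)"
  using assms unfolding has_partials_def
  by (auto intro!: continuous_intros has_vector_derivative_diff)

lemma continuous_on_slice_x: "continuous_on (X \<times> Y) f \<Longrightarrow> t \<in> Y \<Longrightarrow> continuous_on X (\<lambda>x. f (x, t))"
  by (rule continuous_on_compose2[where g=f]) (auto intro!: continuous_intros)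

lemma continuous_on_swap_args:
  "continuous_on (X \<times> Y) f \<Longrightarrow> continuous_on (Y \<times> X) (\<lambda>(t, x). f (x, t))"
  unfolding split_beta by (rule continuous_on_compose2[where g=f]) (auto intro!: continuous_intros)

lemma continuous_on_integral_x:
  fixes f :: "real \<times> real \<Rightarrow> 'a::banach"
  assumes "continuous_on ({a..b} \<times> Y) f"
  shows "continuous_on Y (\<lambda>t. integral {a..b} (\<lambda>x. f (x, t)))"
  using integral_continuous_on_param[of Y a b "\<lambda>t x. f (x, t)"] continuous_on_swap_args[OF assms]
  by simp

abbreviation rect :: "real \<Rightarrow> real \<Rightarrow> real \<Rightarrow> real \<Rightarrow> (real \<times> real) set" where
  "rect a b c d \<equiv> {a..b} \<times> {c..d}"

abbreviation slab :: "real \<Rightarrow> real \<Rightarrow> (real \<times> real) set" where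
  "slab R T \<equiv> {-R..R} \<times> {0..T}"

lemma rect_eq_cbox: "rect a b c d = cbox (a, c) (b, d)"
  by (simp add: cbox_Pair_eq)

lemma rect_integrable:
  fixes f :: "real \<times> real \<Rightarrow> real"
  shows "continuous_on (rect a b c d) f \<Longrightarrow> f integrable_on rect a b c d"
  unfolding rect_eq_cbox by (rule integrable_continuous)

lemma integral_rect_xt:
  fixes f :: "real \<times> real \<Rightarrow> real"
  assumes "continuous_on (rect a b c d) f"
  shows "integral (rect a b c d) f = integral {a..b} (\<lambda>x. integral {c..d} (\<lambda>t. f (x, t)))"
  using integral_prod_continuous[of a c b d f] assms by (simp add: rect_eq_cbox)

lemma integral_rect_tx:
  fixes f :: "real \<times> real \<Rightarrow> real"
  assumes "continuous_on (rect a b c d) f"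
  shows "integral (rect a b c d) f = integral {c..d} (\<lambda>t. integral {a..b} (\<lambda>x. f (x, t)))"
  using integral_swap_continuous[of a c b d "\<lambda>x t. f (x, t)"] integral_rect_xt[OF assms] assms
  by (simp add: rect_eq_cbox)

section \<open>Cauchy-Schwarz and Poincare inequalities on intervals and rectangles\<close>

lemma Cauchy_Schwarz_integral:
  fixes f g :: "'a::euclidean_space \<Rightarrow> real"
  assumes ff: "(\<lambda>x. (f x)^2) integrable_on S" and gg: "(\<lambda>x. (g x)^2) integrable_on S"
    and fg: "(\<lambda>x. f x * g x) integrable_on S"
  shows "(integral S (\<lambda>x. f x * g x))^2 \<le> integral S (\<lambda>x. (f x)^2) * integral S (\<lambda>x. (g x)^2)"
proof -
  define F G P where "F = integral S (\<lambda>x. (f x)^2)" and "G = integral S (\<lambda>x. (g x)^2)"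
    and "P = integral S (\<lambda>x. f x * g x)"
  have quad: "0 \<le> F - 2 * l * P + l^2 * G" for l
  proof -
    have "((\<lambda>x. (f x)^2 - (2 * l) * (f x * g x) + l^2 * (g x)^2) has_integral
        (F - (2 * l) * P + l^2 * G)) S"
      unfolding F_def G_def P_def
      by (intro has_integral_add has_integral_diff has_integral_mult_right integrable_integral assms)
    moreover have "0 \<le> (f x)^2 - (2 * l) * (f x * g x) + l^2 * (g x)^2" for x
      using zero_le_power2[of "f x - l * g x"] by (simp add: power2_eq_square algebra_simps)
    ultimately show ?thesis
      using has_integral_nonneg by (metis (no_types, lifting) mult.assoc)
  qed
  have "0 \<le> G" unfolding G_def by (intro integral_nonneg gg) simp
  have "P^2 \<le> F * G"
  proof (cases "G = 0")
    case True
    have "P = 0"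
    proof (rule ccontr)
      assume "P \<noteq> 0"
      \<comment> \<open>For G = 0 the quadratic in l is affine, and at this l it equals -1.\<close>
      then show False using quad[of "(F + 1) / (2 * P)"] True by simp
    qed
    with True show ?thesis by simp
  next
    case False
    with \<open>0 \<le> G\<close> have "0 < G" by simp
    then have "F - 2 * (P / G) * P + (P / G)^2 * G = (F * G - P^2) / G"
      by (simp add: field_simps power2_eq_square)
    with quad[of "P / G"] \<open>0 < G\<close> show ?thesis by (simp add: zero_le_divide_iff)
  qed
  then show ?thesis by (simp add: F_def G_def P_def)
qed

lemma rect_integral_mult_le:
  fixes f g :: "real \<times> real \<Rightarrow> real"
  assumes "continuous_on (rect a b c d) f" "continuous_on (rect a b c d) g"
  shows "integral (rect a b c d) (\<lambda>p. f p * g p)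
    \<le> sqrt (integral (rect a b c d) (\<lambda>p. (f p)^2)) * sqrt (integral (rect a b c d) (\<lambda>p. (g p)^2))"
  unfolding real_sqrt_mult[symmetric]
  by (intro real_le_rsqrt Cauchy_Schwarz_integral rect_integrable continuous_intros assms)

lemma integral_sq_le:
  fixes f :: "real \<Rightarrow> real"
  assumes "continuous_on {a..b} f" "a \<le> b"
  shows "(integral {a..b} f)^2 \<le> (b - a) * integral {a..b} (\<lambda>x. (f x)^2)"
  using Cauchy_Schwarz_integral[of f "{a..b}" "\<lambda>_. 1"] assms
  by (simp add: mult.commute integrable_continuous_interval continuous_intros)

text \<open>Any two values of f differ by at most sqrt ((b - a) E), where E is the integral of f'^2,
  by the fundamental theorem and Cauchy-Schwarz. Integrating (f x - f y)^2 in y and then in x gives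
  2 (b - a) J - 2 I^2 with I, J the integrals of f and f^2.\<close>

lemma poincare_interval:
  fixes f f' :: "real \<Rightarrow> real"
  assumes "a < b" and df: "\<And>x. x \<in> {a..b} \<Longrightarrow> (f has_vector_derivative f' x) (at x within {a..b})"
    and cont: "continuous_on {a..b} f'"
  shows "integral {a..b} (\<lambda>x. (f x)^2)
    \<le> (integral {a..b} f)^2 / (b - a) + (b - a)^2 * integral {a..b} (\<lambda>x. (f' x)^2)"
proof -
  define E where "E = integral {a..b} (\<lambda>x. (f' x)^2)"
  define I where "I = integral {a..b} f"
  define J where "J = integral {a..b} (\<lambda>x. (f x)^2)"
  have cf: "continuous_on {a..b} f"
    using df continuous_on_vector_derivative by blast
  have E0: "0 \<le> E" unfolding E_def
    by (intro integral_nonneg integrable_continuous_interval continuous_intros cont) simp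
  have le: "(f x - f y)^2 \<le> (b - a) * E" if "a \<le> y" "y \<le> x" "x \<le> b" for x y
  proof -
    have sub: "{y..x} \<subseteq> {a..b}" using that by auto
    have "(f' has_integral (f x - f y)) {y..x}"
      using that sub by (intro fundamental_theorem_of_calculus has_vector_derivative_within_subset[OF df sub]) auto
    then have "f x - f y = integral {y..x} f'" by (simp add: integral_unique)
    then have "(f x - f y)^2 \<le> (x - y) * integral {y..x} (\<lambda>x. (f' x)^2)"
      using integral_sq_le[OF continuous_on_subset[OF cont sub] \<open>y \<le> x\<close>] by simp
    also have "\<dots> \<le> (b - a) * E"
      unfolding E_def using that sub cont
      by (intro mult_mono integral_subset_le integral_nonneg integrable_continuous_interval continuous_intros)
        (auto intro: continuous_on_subset[OF cont])
    finally show ?thesis .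
  qed
  have le: "(f x - f y)^2 \<le> (b - a) * E" if "x \<in> {a..b}" "y \<in> {a..b}" for x y
  proof (cases "y \<le> x")
    case True then show ?thesis using le[of y x] that by simp
  next
    case False then show ?thesis using le[of x y] that by (simp add: power2_commute)
  qed
  have one: "(b - a) * (f x)^2 - 2 * I * f x + J \<le> (b - a) * ((b - a) * E)" if x: "x \<in> {a..b}" for x
  proof -
    have "((\<lambda>y. (f x)^2 - (2 * f x) * f y + (f y)^2) has_integral
        ((b - a) *\<^sub>R (f x)^2 - (2 * f x) * I + J)) {a..b}"
      unfolding I_def J_def using \<open>a < b\<close> 
      by (intro has_integral_add has_integral_diff has_integral_mult_right integrable_integral
        integrable_continuous_interval continuous_intros cf has_integral_const_real[of _ a b, THEN has_integral_eq_rhs]) auto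
    moreover have "((\<lambda>y. (b - a) * E) has_integral ((b - a) *\<^sub>R ((b - a) * E))) {a..b}"
      using has_integral_const_real[of "(b - a) * E" a b] \<open>a < b\<close> by simp
    ultimately have "(b - a) *\<^sub>R (f x)^2 - (2 * f x) * I + J \<le> (b - a) *\<^sub>R ((b - a) * E)"
      by (rule has_integral_le) (use le[OF x] in \<open>auto simp: power2_eq_square algebra_simps\<close>)
    then show ?thesis by (simp add: mult_ac)
  qed
  have "((\<lambda>x. (b - a) * (f x)^2 - (2 * I) * f x + J) has_integral
      ((b - a) * J - (2 * I) * I + (b - a) *\<^sub>R J)) {a..b}"
    unfolding I_def J_def using \<open>a < b\<close>
    by (intro has_integral_add has_integral_diff has_integral_mult_right integrable_integral
        integrable_continuous_interval continuous_intros cf has_integral_const_real[of _ a b, THEN has_integral_eq_rhs]) auto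
  moreover have "((\<lambda>y. (b - a) * ((b - a) * E)) has_integral ((b - a) *\<^sub>R ((b - a) * ((b - a) * E)))) {a..b}"
    using has_integral_const_real[of "(b - a) * ((b - a) * E)" a b] \<open>a < b\<close> by simp
  ultimately have "(b - a) * J - (2 * I) * I + (b - a) *\<^sub>R J \<le> (b - a) *\<^sub>R ((b - a) * ((b - a) * E))"
    by (rule has_integral_le) (use one in auto)
  then have "(b - a) * (2 * J) \<le> (b - a) * (2 * (I^2 / (b - a)) + (b - a)^2 * E)"
  proof -
    have "(b - a) * (2 * (I^2 / (b - a)) + (b - a)^2 * E) = 2 * I^2 + (b - a) * ((b - a)^2 * E)"
      using \<open>a < b\<close> by (simp add: distrib_left)
    with \<open>(b - a) * J - (2 * I) * I + (b - a) *\<^sub>R J \<le> _\<close> show ?thesis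
      by (simp add: power2_eq_square algebra_simps)
  qed
  then have "2 * J \<le> 2 * (I^2 / (b - a)) + (b - a)^2 * E"
    using \<open>a < b\<close> by simp
  \<comment> \<open>The argument yields the derivative term with the factor 1/2, which is given away
    for a simpler constant.\<close>
  moreover have "0 \<le> (b - a)^2 * E" using E0 by simp
  ultimately have "J \<le> I^2 / (b - a) + (b - a)^2 * E" by linarith
  then show ?thesis by (simp add: E_def I_def J_def)
qed

text \<open>The interval inequality in x on every slice leaves the slice integrals W t. The interval
  inequality in t is then applied to W, whose derivative is the integral of \<open>wt\<close> over
  the slice and is brought back to \<open>wt^2\<close> by Cauchy-Schwarz.\<close>

lemma poincare_rect:
  fixes w :: "real \<times> real \<Rightarrow> real"
  assumes "a < b" "c < d" and w: "has_partials {a..b} {c..d} w wx wt"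
  shows "integral (rect a b c d) (\<lambda>p. (w p)^2)
    \<le> (integral (rect a b c d) w)^2 / ((b - a) * (d - c))
      + (b - a)^2 * integral (rect a b c d) (\<lambda>p. (wx p)^2)
      + (d - c)^2 * integral (rect a b c d) (\<lambda>p. (wt p)^2)"
proof -
  note cw = has_partialsD(1-3)[OF w]
  have csq: "continuous_on (rect a b c d) (\<lambda>p. (w p)^2)"
    "continuous_on (rect a b c d) (\<lambda>p. (wx p)^2)"
    "continuous_on (rect a b c d) (\<lambda>p. (wt p)^2)"
    by (intro continuous_intros cw)+
  define W where "W t = integral {a..b} (\<lambda>x. w (x, t))" for t
  define W' where "W' t = integral {a..b} (\<lambda>x. wt (x, t))" for t
  have cW: "continuous_on {c..d} W" "continuous_on {c..d} W'"
    unfolding W_def W'_def by (intro continuous_on_integral_x cw)+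
  have dW: "(W has_vector_derivative W' t) (at t within {c..d})" if "t \<in> {c..d}" for t
    unfolding W_def W'_def
    using that continuous_on_swap_args[OF cw(3)]
    by (intro leibniz_rule_vector_derivative[where fx="\<lambda>t x. wt (x, t)", unfolded cbox_interval])
      (auto intro!: integrable_continuous_interval continuous_on_slice_x[OF cw(1)] has_partialsD(5)[OF w])
  have W'le: "(W' t)^2 \<le> (b - a) * integral {a..b} (\<lambda>x. (wt (x, t))^2)" if "t \<in> {c..d}" for t
    unfolding W'_def using \<open>a < b\<close> continuous_on_slice_x[OF cw(3) that]
    by (intro integral_sq_le) auto
  have "integral {c..d} (\<lambda>t. (W' t)^2) \<le> integral {c..d} (\<lambda>t. (b - a) * integral {a..b} (\<lambda>x. (wt (x, t))^2))"
    by (intro integral_le integrable_continuous_interval continuous_intros cW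
      continuous_on_integral_x[of a b "{c..d}" "\<lambda>p. (wt p)^2"] csq W'le)
  then have W'int: "integral {c..d} (\<lambda>t. (W' t)^2) \<le> (b - a) * integral (rect a b c d) (\<lambda>p. (wt p)^2)"
    by (simp add: integral_rect_tx[OF csq(3)])
  have slice: "integral {a..b} (\<lambda>x. (w (x, t))^2)
      \<le> 1 / (b - a) * (W t)^2 + (b - a)^2 * integral {a..b} (\<lambda>x. (wx (x, t))^2)" if "t \<in> {c..d}" for t
    using poincare_interval[OF \<open>a < b\<close> has_partialsD(4)[OF w _ that] continuous_on_slice_x[OF cw(2) that]]
    by (simp add: W_def)
  have "integral (rect a b c d) (\<lambda>p. (w p)^2) = integral {c..d} (\<lambda>t. integral {a..b} (\<lambda>x. (w (x, t))^2))"
    by (rule integral_rect_tx[OF csq(1)])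
  also have "\<dots> \<le> integral {c..d} (\<lambda>t. 1 / (b - a) * (W t)^2 + (b - a)^2 * integral {a..b} (\<lambda>x. (wx (x, t))^2))"
    by (intro integral_le integrable_continuous_interval continuous_intros cW slice
      continuous_on_integral_x[of a b "{c..d}" "\<lambda>p. (wx p)^2"] continuous_on_integral_x[of a b "{c..d}" "\<lambda>p. (w p)^2"] csq)
  also have "\<dots> = 1 / (b - a) * integral {c..d} (\<lambda>t. (W t)^2) + (b - a)^2 * integral (rect a b c d) (\<lambda>p. (wx p)^2)"
    by (subst integral_add) 
      (auto intro!: integrable_continuous_interval continuous_intros cW 
      continuous_on_integral_x[of a b "{c..d}" "\<lambda>p. (wx p)^2"] csq simp: integral_rect_tx[OF csq(2)] simp del: times_divide_eq_left)
  finally have 1: "integral (rect a b c d) (\<lambda>p. (w p)^2) \<le>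
      1 / (b - a) * integral {c..d} (\<lambda>t. (W t)^2) + (b - a)^2 * integral (rect a b c d) (\<lambda>p. (wx p)^2)" .
  have "integral {c..d} (\<lambda>t. (W t)^2) \<le> (integral {c..d} W)^2 / (d - c) + (d - c)^2 * integral {c..d} (\<lambda>t. (W' t)^2)"
    by (rule poincare_interval[OF \<open>c < d\<close> dW cW(2)])
  also have "\<dots> \<le> (integral {c..d} W)^2 / (d - c) + (d - c)^2 * ((b - a) * integral (rect a b c d) (\<lambda>p. (wt p)^2))"
    using W'int by (intro add_left_mono mult_left_mono) auto
  also have "integral {c..d} W = integral (rect a b c d) w"
    unfolding W_def by (rule integral_rect_tx[OF cw(1), symmetric])
  finally have "1 / (b - a) * integral {c..d} (\<lambda>t. (W t)^2) \<le> 1 / (b - a) *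
      ((integral (rect a b c d) w)^2 / (d - c) + (d - c)^2 * ((b - a) * integral (rect a b c d) (\<lambda>p. (wt p)^2)))"
    using \<open>a < b\<close> by (intro mult_left_mono) auto
  also have "\<dots> = (integral (rect a b c d) w)^2 / ((b - a) * (d - c))
      + (d - c)^2 * integral (rect a b c d) (\<lambda>p. (wt p)^2)"
  proof -
    have "1 / r * (X / s + s^2 * (r * Y)) = X / (r * s) + s^2 * Y" if "r \<noteq> 0" "s \<noteq> 0" for r s X Y :: real
      using that by (simp add: field_simps)
    then show ?thesis using assms(1,2) by simp
  qed
  finally show ?thesis using 1 by linarith
qed

section \<open>Subdivision of a rectangle into a grid of cells\<close>

lemma integral_grid_1d:
  fixes f :: "real \<Rightarrow> real"
  assumes "continuous_on {a..a + real N * h} f" "0 \<le> h"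
  shows "integral {a..a + real N * h} f = (\<Sum>i<N. integral {a + real i * h..a + real (Suc i) * h} f)"
  using assms
proof (induction N)
  case (Suc N)
  have le: "a \<le> a + real N * h" "a + real N * h \<le> a + real (Suc N) * h"
    using \<open>0 \<le> h\<close> by (auto simp: algebra_simps)
  have "integral {a..a + real N * h} f + integral {a + real N * h..a + real (Suc N) * h} f
      = integral {a..a + real (Suc N) * h} f"
    by (rule Henstock_Kurzweil_Integration.integral_combine[OF le integrable_continuous_interval[OF Suc.prems(1)]])
  moreover have "continuous_on {a..a + real N * h} f"
    using le by (intro continuous_on_subset[OF Suc.prems(1)]) auto
  ultimately show ?case using Suc by simp
qed simp

abbreviation cell :: "real \<Rightarrow> real \<Rightarrow> real \<Rightarrow> real \<Rightarrow> nat \<times> nat \<Rightarrow> (real \<times> real) set" where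
  "cell a h c k \<equiv> \<lambda>(i, j). {a + real i * h..a + real (Suc i) * h} \<times> {c + real j * k..c + real (Suc j) * k}"

lemma grid_interval_subset:
  assumes "0 \<le> h" "i < N"
  shows "{a + real i * h..a + real (Suc i) * h} \<subseteq> {a..a + real N * h}"
proof -
  have "real (Suc i) * h \<le> real N * h" "0 \<le> real i * h"
    using assms by (intro mult_right_mono mult_nonneg_nonneg; simp)+
  then show ?thesis by auto
qed

lemma cell_subset:
  assumes "0 \<le> h" "0 \<le> k" "z \<in> {..<N} \<times> {..<N}"
  shows "cell a h c k z \<subseteq> {a..a + real N * h} \<times> {c..c + real N * k}"
  using assms by (auto simp del: of_nat_Suc dest: subsetD[OF grid_interval_subset, rotated 2])

lemma integral_grid:
  fixes f :: "real \<times> real \<Rightarrow> real"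
  assumes f: "continuous_on ({a..a + real N * h} \<times> {c..c + real N * k}) f" and "0 \<le> h" "0 \<le> k"
  shows "integral ({a..a + real N * h} \<times> {c..c + real N * k}) f
    = (\<Sum>z\<in>{..<N} \<times> {..<N}. integral (cell a h c k z) f)"
proof -
  note sub = grid_interval_subset[OF \<open>0 \<le> h\<close>] grid_interval_subset[OF \<open>0 \<le> k\<close>]
  define I where "I i = {a + real i * h..a + real (Suc i) * h}" for i
  have fI: "continuous_on (I i \<times> {c..c + real N * k}) f" if "i < N" for i
    using sub(1)[OF that] by (intro continuous_on_subset[OF f]) (auto simp: I_def)
  have "integral ({a..a + real N * h} \<times> {c..c + real N * k}) f =
      integral {c..c + real N * k} (\<lambda>t. integral {a..a + real N * h} (\<lambda>x. f (x, t)))"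
    by (rule integral_rect_tx[OF f])
  also have "\<dots> = integral {c..c + real N * k} (\<lambda>t. \<Sum>i<N. integral (I i) (\<lambda>x. f (x, t)))"
    unfolding I_def by (intro integral_cong integral_grid_1d continuous_on_slice_x[OF f] \<open>0 \<le> h\<close>)
  also have "\<dots> = (\<Sum>i<N. integral {c..c + real N * k} (\<lambda>t. integral (I i) (\<lambda>x. f (x, t))))"
    by (intro integral_sum integrable_continuous_interval)
      (auto simp: I_def simp del: of_nat_Suc intro!: continuous_on_integral_x fI[unfolded I_def])
  also have "\<dots> = (\<Sum>i<N. \<Sum>j<N. integral {c + real j * k..c + real (Suc j) * k} (\<lambda>t. integral (I i) (\<lambda>x. f (x, t))))"
    by (intro sum.cong refl integral_grid_1d \<open>0 \<le> k\<close>)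
      (auto simp: I_def simp del: of_nat_Suc intro!: continuous_on_integral_x fI[unfolded I_def])
  also have "\<dots> = (\<Sum>i<N. \<Sum>j<N. integral (cell a h c k (i, j)) f)"
  proof (intro sum.cong refl)
    fix i j assume "i \<in> {..<N}" "j \<in> {..<N}"
    then have "continuous_on (I i \<times> {c + real j * k..c + real (Suc j) * k}) f"
      using sub(2)[of j N c] by (intro continuous_on_subset[OF fI[of i]]) auto
    then show "integral {c + real j * k..c + real (Suc j) * k} (\<lambda>t. integral (I i) (\<lambda>x. f (x, t)))
      = integral (cell a h c k (i, j)) f"
      unfolding I_def by (simp add: integral_rect_tx)
  qed
  also have "\<dots> = (\<Sum>z\<in>{..<N} \<times> {..<N}. integral (cell a h c k z) f)"
    by (subst sum.cartesian_product) (simp add: split_beta)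
  finally show ?thesis .
qed

text \<open>Summing over the cells turns the factors of the derivative terms into squared mesh
  sizes. On a fine grid a function with bounded derivatives is thus determined, up to a small L^2
  error, by finitely many numbers: its cell integrals.\<close>

lemma poincare_grid:
  fixes w :: "real \<times> real \<Rightarrow> real"
  assumes "0 < h" "0 < k" and w: "has_partials {a..a + real N * h} {c..c + real N * k} w wx wt"
  defines "Q \<equiv> {a..a + real N * h} \<times> {c..c + real N * k}"
  shows "integral Q (\<lambda>p. (w p)^2)
    \<le> (\<Sum>z\<in>{..<N} \<times> {..<N}. (integral (cell a h c k z) w)^2) / (h * k)
      + h^2 * integral Q (\<lambda>p. (wx p)^2) + k^2 * integral Q (\<lambda>p. (wt p)^2)"
proof -
  let ?Z = "{..<N} \<times> {..<N}"
  note cw = has_partialsD(1-3)[OF w]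
  have csq: "continuous_on Q (\<lambda>p. (w p)^2)"
    "continuous_on Q (\<lambda>p. (wx p)^2)"
    "continuous_on Q (\<lambda>p. (wt p)^2)"
    unfolding Q_def by (intro continuous_intros cw)+
  have grid: "integral Q f = (\<Sum>z\<in>?Z. integral (cell a h c k z) f)" if "continuous_on Q f" for f :: "_ \<Rightarrow> real"
    unfolding Q_def using that assms by (intro integral_grid) (auto simp: Q_def)
  have "integral (cell a h c k z) (\<lambda>p. (w p)^2) \<le> (integral (cell a h c k z) w)^2 / (h * k)
      + h^2 * integral (cell a h c k z) (\<lambda>p. (wx p)^2) + k^2 * integral (cell a h c k z) (\<lambda>p. (wt p)^2)"
    if z: "z \<in> ?Z" for z
  proof -
    obtain i j where ij: "z = (i, j)" "i < N" "j < N" using z by auto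
    have eq: "a + real (Suc i) * h - (a + real i * h) = h" "c + real (Suc j) * k - (c + real j * k) = k"
      by (simp_all add: algebra_simps)
    have "a + real i * h < a + real (Suc i) * h" "c + real j * k < c + real (Suc j) * k"
      using assms by (simp_all add: algebra_simps)
    from poincare_rect[OF this has_partials_subset[OF w grid_interval_subset grid_interval_subset]]
    show ?thesis using assms ij(2,3) unfolding eq ij(1) by simp
  qed
  then have "integral Q (\<lambda>p. (w p)^2) \<le> (\<Sum>z\<in>?Z. (integral (cell a h c k z) w)^2 / (h * k)
      + h^2 * integral (cell a h c k z) (\<lambda>p. (wx p)^2) + k^2 * integral (cell a h c k z) (\<lambda>p. (wt p)^2))"
    unfolding grid[OF csq(1)] by (rule sum_mono)
  then show ?thesis
    unfolding grid[OF csq(2)] grid[OF csq(3)]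
    by (simp add: sum.distrib sum_distrib_left sum_divide_distrib)
qed

lemma finite_image_representatives:
  assumes "finite (g ` B)"
  obtains B0 where "finite B0" "B0 \<subseteq> B" "\<And>w. w \<in> B \<Longrightarrow> \<exists>v\<in>B0. g w = g v"
  using finite_subset_image[OF assms subset_refl] by (metis image_iff image_eqI)

lemma rect_integral_abs_le:
  fixes f :: "real \<times> real \<Rightarrow> real"
  assumes f: "continuous_on (rect a b c d) f" and "a \<le> b" "c \<le> d"
  shows "\<bar>integral (rect a b c d) f\<bar>
    \<le> sqrt ((b - a) * (d - c)) * sqrt (integral (rect a b c d) (\<lambda>p. (f p)^2))"
proof -
  have "(integral (rect a b c d) (\<lambda>p. 1 * f p))^2 \<le>
      integral (rect a b c d) (\<lambda>p. 1^2) * integral (rect a b c d) (\<lambda>p. (f p)^2)"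
    by (intro Cauchy_Schwarz_integral rect_integrable continuous_intros f)
  also have "integral (rect a b c d) (\<lambda>p. 1^2) = (b - a) * (d - c)"
    using integral_Pair_const[of a c b d "1::real"] assms by (simp add: rect_eq_cbox content_Pair)
  finally show ?thesis
    unfolding real_sqrt_mult[symmetric] by (intro real_le_rsqrt) simp
qed

lemma rect_integral_diff_sq_le:
  fixes f g :: "real \<times> real \<Rightarrow> real"
  assumes f: "continuous_on (rect a b c d) f" "continuous_on (rect a b c d) g"
    "integral (rect a b c d) (\<lambda>p. (f p)^2) \<le> 1" "integral (rect a b c d) (\<lambda>p. (g p)^2) \<le> 1"
  shows "integral (rect a b c d) (\<lambda>p. (f p - g p)^2) \<le> 4"
proof -
  let ?Q = "rect a b c d"
  have "integral ?Q (\<lambda>p. (f p - g p)^2) \<le> integral ?Q (\<lambda>p. 2 * (f p)^2 + 2 * (g p)^2)"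
  proof (intro integral_le rect_integrable continuous_intros f)
    show "(f p - g p)^2 \<le> 2 * (f p)^2 + 2 * (g p)^2" for p
      using zero_le_power2[of "f p + g p"] by (simp add: power2_eq_square algebra_simps)
  qed
  also have "\<dots> = 2 * integral ?Q (\<lambda>p. (f p)^2) + 2 * integral ?Q (\<lambda>p. (g p)^2)"
    by (subst integral_add) (auto intro!: rect_integrable continuous_intros f)
  finally show ?thesis using f by simp
qed

text \<open>A function is recorded by its integrals
  over the cells of a fine grid, rounded to multiples of a small number.\<close>

lemma rellich_net:
  fixes B :: "(real \<times> real \<Rightarrow> real) set"
  assumes "a < b" "c < d" "0 < \<tau>"
    and B: "\<And>w. w \<in> B \<Longrightarrow> has_partials {a..b} {c..d} w (wx w) (wt w) \<and>
      integral (rect a b c d) (\<lambda>p. (w p)^2) \<le> 1 \<and>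
      integral (rect a b c d) (\<lambda>p. (wx w p)^2) \<le> 1 \<and>
      integral (rect a b c d) (\<lambda>p. (wt w p)^2) \<le> 1"
  obtains B0 where "finite B0" "B0 \<subseteq> B"
    "\<And>w. w \<in> B \<Longrightarrow> \<exists>v\<in>B0. integral (rect a b c d) (\<lambda>p. (w p - v p)^2) \<le> \<tau>"
proof -
  \<comment> \<open>The number N of cells per direction will satisfy N >= 8 s / \<tau>, so that 4
    (h^2 + k^2) = 4 s / N^2 <= 4 s / N <= \<tau> / 2. The 4 bounds the squared L^2 norms of the
    derivatives of a difference of two members of B.\<close>
  define s where "s = (b - a)^2 + (d - c)^2"
  obtain M :: nat where M: "8 * s / \<tau> < real M" using reals_Archimedean2 by blast
  define N where "N = Suc M"
  have N: "8 * s / \<tau> \<le> real N" "1 \<le> real N" using M by (auto simp: N_def)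
  define h where "h = (b - a) / real N"
  define k where "k = (d - c) / real N"
  have hk: "0 < h" "0 < k" "b = a + real N * h" "d = c + real N * k"
    using assms N by (auto simp: h_def k_def)
  have "4 * (h^2 + k^2) = 4 * s / (real N)^2"
    by (simp add: h_def k_def s_def power_divide add_divide_distrib)
  also have "\<dots> \<le> 4 * s / real N"
    using N by (intro divide_left_mono) (auto simp: s_def power2_eq_square)
  also have "\<dots> \<le> \<tau> / 2"
    using N \<open>0 < \<tau>\<close> by (simp add: field_simps)
  finally have hk4: "4 * (h^2 + k^2) \<le> \<tau> / 2" .
  \<comment> \<open>Rounding width: cell integrals that agree up to \<theta> on all N^2 cells
    contribute at most N^2 \<theta>^2 / (h k) = \<tau> / 2 to the Poincare bound.\<close>
  define \<theta> where "\<theta> = sqrt (\<tau> / 2 * (h * k)) / real N"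
  have \<theta>: "0 < \<theta>" "(real N)^2 * \<theta>^2 / (h * k) = \<tau> / 2"
    using hk(1,2) N \<open>0 < \<tau>\<close> by (auto simp: \<theta>_def power_divide)
  let ?Z = "{..<N} \<times> {..<N}"
  define g where "g w = (\<lambda>z\<in>?Z. \<lfloor>integral (cell a h c k z) w / \<theta>\<rfloor>)" for w :: "real \<times> real \<Rightarrow> real"
  \<comment> \<open>Cauchy-Schwarz on a cell of area h k bounds the cell integral by sqrt (h k), so
    the rounded values lie in a finite range.\<close>
  define m where "m = sqrt (h * k) / \<theta>"
  have bound: "\<bar>integral (cell a h c k z) w / \<theta>\<bar> \<le> m" if "w \<in> B" "z \<in> ?Z" for w z
  proof -
    obtain i j where ij: "z = (i, j)" "i < N" "j < N" using \<open>z \<in> ?Z\<close> by auto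
    have cw: "continuous_on (rect a b c d) w" using B[OF \<open>w \<in> B\<close>] has_partialsD(1) by blast
    have sub: "cell a h c k z \<subseteq> rect a b c d"
      using cell_subset[of h k z N a c] that(2) hk(1,2) unfolding hk(3,4) by simp
    have cw': "continuous_on (cell a h c k z) w"
      by (rule continuous_on_subset[OF cw sub])
    have eq: "a + real (Suc i) * h - (a + real i * h) = h" "c + real (Suc j) * k - (c + real j * k) = k"
      by (simp_all add: algebra_simps)
    have "\<bar>integral (cell a h c k z) w\<bar> \<le> sqrt (h * k) * sqrt (integral (cell a h c k z) (\<lambda>p. (w p)^2))"
      using rect_integral_abs_le[of "a + real i * h" "a + real (Suc i) * h" "c + real j * k" "c + real (Suc j) * k" w]
        cw' hk(1,2) unfolding ij(1) eq by (simp add: algebra_simps)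
    also have "integral (cell a h c k z) (\<lambda>p. (w p)^2) \<le> integral (rect a b c d) (\<lambda>p. (w p)^2)"
      using sub cw cw' unfolding ij(1)
      by (intro integral_subset_le) (auto intro!: rect_integrable continuous_intros)
    also have "\<dots> \<le> 1" using B[OF \<open>w \<in> B\<close>] by blast
    finally have "\<bar>integral (cell a h c k z) w\<bar> \<le> sqrt (h * k)"
      using hk(1,2) by (simp add: mult_left_le)
    then show ?thesis using \<theta>(1) by (simp add: m_def divide_right_mono)
  qed
  have "g ` B \<subseteq> ?Z \<rightarrow>\<^sub>E {\<lfloor>- m\<rfloor>..\<lfloor>m\<rfloor>}"
  proof (intro image_subsetI PiE_I)
    fix w z assume "w \<in> B" "z \<in> ?Z"
    then show "g w z \<in> {\<lfloor>- m\<rfloor>..\<lfloor>m\<rfloor>}"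
      using bound[of w z] unfolding g_def restrict_apply'[OF \<open>z \<in> ?Z\<close>] atLeastAtMost_iff
      by (intro conjI floor_mono; linarith)
  qed (auto simp: g_def)
  then have "finite (g ` B)"
    by (rule finite_subset) (intro finite_PiE; simp)
  then obtain B0 where B0: "finite B0" "B0 \<subseteq> B" "\<And>w. w \<in> B \<Longrightarrow> \<exists>v\<in>B0. g w = g v"
    using finite_image_representatives[of g B] by metis
  have close: "integral (rect a b c d) (\<lambda>p. (w p - v p)^2) \<le> \<tau>" if "w \<in> B" "v \<in> B" "g w = g v" for w v
  proof -
    let ?Q = "rect a b c d"
    have pw: "has_partials {a..b} {c..d} w (wx w) (wt w)" and pv: "has_partials {a..b} {c..d} v (wx v) (wt v)"
      and le1: "integral ?Q (\<lambda>p. (wx w p)^2) \<le> 1" "integral ?Q (\<lambda>p. (wx v p)^2) \<le> 1"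
        "integral ?Q (\<lambda>p. (wt w p)^2) \<le> 1" "integral ?Q (\<lambda>p. (wt v p)^2) \<le> 1"
      using B[OF that(1)] B[OF that(2)] by blast+
    have p: "has_partials {a..a + real N * h} {c..c + real N * k} (\<lambda>p. w p - v p) (\<lambda>p. wx w p - wx v p) (\<lambda>p. wt w p - wt v p)"
      using has_partials_diff[OF pw pv] unfolding hk(3,4) .
    have cell: "(integral (cell a h c k z) (\<lambda>p. w p - v p))^2 \<le> \<theta>^2" if z: "z \<in> ?Z" for z
    proof -
      obtain i j where ij: "z = (i, j)" "i < N" "j < N" using z by auto
      have sub: "cell a h c k z \<subseteq> ?Q"
        using cell_subset[of h k z N a c] z hk(1,2) unfolding hk(3,4) by simp
      have "integral (cell a h c k z) (\<lambda>p. w p - v p) = integral (cell a h c k z) w - integral (cell a h c k z) v"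
        using continuous_on_subset[OF has_partialsD(1)[OF pw] sub] continuous_on_subset[OF has_partialsD(1)[OF pv] sub]
        unfolding ij(1) prod.case by (intro integral_diff rect_integrable)
      moreover have "\<lfloor>integral (cell a h c k z) w / \<theta>\<rfloor> = \<lfloor>integral (cell a h c k z) v / \<theta>\<rfloor>"
        using fun_cong[OF \<open>g w = g v\<close>, of z] unfolding g_def restrict_apply'[OF z] .
      then have "\<bar>integral (cell a h c k z) w / \<theta> - integral (cell a h c k z) v / \<theta>\<bar> \<le> 1"
        by linarith
      then have "\<bar>integral (cell a h c k z) w - integral (cell a h c k z) v\<bar> \<le> \<theta>"
        using \<theta>(1) by (simp add: field_simps abs_le_iff)
      ultimately show ?thesis using \<theta>(1) by (intro abs_le_square_iff[THEN iffD1]) simp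
    qed
    have "integral ?Q (\<lambda>p. (w p - v p)^2) \<le> (\<Sum>z\<in>?Z. (integral (cell a h c k z) (\<lambda>p. w p - v p))^2) / (h * k)
      + h^2 * integral ?Q (\<lambda>p. (wx w p - wx v p)^2) + k^2 * integral ?Q (\<lambda>p. (wt w p - wt v p)^2)"
      using poincare_grid[OF hk(1,2) p] unfolding hk(3,4) .
    also have "\<dots> \<le> (\<Sum>z\<in>?Z. \<theta>^2) / (h * k) + h^2 * 4 + k^2 * 4"
      by (intro add_mono divide_right_mono mult_left_mono rect_integral_diff_sq_le sum_mono cell le1 
        has_partialsD(2,3)[OF pw] has_partialsD(2,3)[OF pv] zero_le_power2 less_imp_le mult_pos_pos hk(1,2))
    also have "\<dots> = \<tau> / 2 + 4 * (h^2 + k^2)"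
      using \<theta>(2) by (simp add: power2_eq_square)
    finally show ?thesis using hk4 by linarith
  qed
  show thesis
    by (rule that[OF B0(1,2)]) (use B0 close in blast)
qed

section \<open>Compactness in the local dual space\<close>

lemma smooth_xt_lincomb:
  fixes f g :: "real \<times> real \<Rightarrow> real"
  assumes "smooth_xt S f" "smooth_xt S g"
  shows "smooth_xt S (\<lambda>p. a * f p + b * g p)"
proof -
  obtain D where D: "\<forall>p\<in>S. D 0 0 p = f p"
    "\<And>i j p. p \<in> S \<Longrightarrow> (D i j has_derivative
            (\<lambda>h. fst h *\<^sub>R D (Suc i) j p + snd h *\<^sub>R D i (Suc j) p)) (at p within S)"
    using assms(1) unfolding smooth_xt_def by blast
  obtain E where E: "\<forall>p\<in>S. E 0 0 p = g p"
    "\<And>i j p. p \<in> S \<Longrightarrow> (E i j has_derivative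
            (\<lambda>h. fst h *\<^sub>R E (Suc i) j p + snd h *\<^sub>R E i (Suc j) p)) (at p within S)"
    using assms(2) unfolding smooth_xt_def by blast
  show ?thesis
    unfolding smooth_xt_def
  proof (intro exI[of _ "\<lambda>i j p. a * D i j p + b * E i j p"] conjI allI ballI)
    fix i j p assume "p \<in> S"
    then show "((\<lambda>p. a * D i j p + b * E i j p) has_derivative
        (\<lambda>h. fst h *\<^sub>R (a * D (Suc i) j p + b * E (Suc i) j p) +
          snd h *\<^sub>R (a * D i (Suc j) p + b * E i (Suc j) p))) (at p within S)"
      by (auto intro!: derivative_eq_intros D(2) E(2) simp: algebra_simps)
  qed (use D E in auto)
qed

lemma test_functions_lincomb:
  assumes "\<phi> \<in> test_functions \<Omega>" "\<psi> \<in> test_functions \<Omega>"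
  shows "(\<lambda>p. a * \<phi> p + b * \<psi> p) \<in> test_functions \<Omega>"
proof -
  have "closure {p. a * \<phi> p + b * \<psi> p \<noteq> 0} \<subseteq> closure ({p. \<phi> p \<noteq> 0} \<union> {p. \<psi> p \<noteq> 0})"
    by (rule closure_mono) auto
  then have sub: "closure {p. a * \<phi> p + b * \<psi> p \<noteq> 0} \<subseteq> closure {p. \<phi> p \<noteq> 0} \<union> closure {p. \<psi> p \<noteq> 0}"
    by (simp only: closure_Un)
  moreover have "compact (closure {p. \<phi> p \<noteq> 0} \<union> closure {p. \<psi> p \<noteq> 0})"
    using assms by (intro compact_Un) (auto simp: test_functions_def)
  ultimately have "compact (closure {p. a * \<phi> p + b * \<psi> p \<noteq> 0})"
    using compact_Int_closed[OF _ closed_closure, of "closure {p. \<phi> p \<noteq> 0} \<union> closure {p. \<psi> p \<noteq> 0}"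
        "{p. a * \<phi> p + b * \<psi> p \<noteq> 0}"]
    by (simp add: inf.absorb2)
  with sub show ?thesis
    using assms by (auto simp: test_functions_def intro!: smooth_xt_lincomb)
qed

lemma test_functions_diff:
  "\<phi> \<in> test_functions \<Omega> \<Longrightarrow> \<psi> \<in> test_functions \<Omega> \<Longrightarrow> (\<lambda>p. \<phi> p - \<psi> p) \<in> test_functions \<Omega>"
  using test_functions_lincomb[of \<phi> \<Omega> \<psi> 1 "-1"] by simp

lemma zero_test_function: "(\<lambda>p. 0) \<in> test_functions \<Omega>"
  unfolding test_functions_def smooth_xt_def by (auto intro!: exI[of _ "\<lambda>_ _ _. 0"])

lemma test_functions_mono: "\<Omega> \<subseteq> \<Omega>' \<Longrightarrow> test_functions \<Omega> \<subseteq> test_functions \<Omega>'"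
  unfolding test_functions_def by blast

lemma test_functions_local_domain:
  assumes "\<phi> \<in> test_functions (open_strip T)"
  obtains \<Omega> where "local_domain T \<Omega>" "\<phi> \<in> test_functions \<Omega>"
proof -
  let ?K = "closure {p. \<phi> p \<noteq> 0}"
  have K: "compact ?K" "?K \<subseteq> open_strip T" using assms by (auto simp: test_functions_def)
  then obtain r where r: "?K \<subseteq> ball 0 r"
    using bounded_subset_ballD[OF compact_imp_bounded] by blast
  show thesis
  proof (rule that)
    show "local_domain T (open_strip T \<inter> ball 0 r)"
      by (auto simp: local_domain_def open_strip_def intro!: open_Int open_Times)
    show "\<phi> \<in> test_functions (open_strip T \<inter> ball 0 r)"
      using assms r by (auto simp: test_functions_def)
  qed
qed

lemma zero_H1_norm: "H1_norm (\<lambda>p. 0) = 0"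
  by (simp add: H1_norm_def pdx_def pdt_def split_beta)

text \<open>The linearity clause of \<open>Hm1_loc\<close>, isolated because each of its equations
  involves finitely many values of \<Lambda> and so defines a closed set in the product
  topology.\<close>

definition linear_on_tests :: "real \<Rightarrow> ((real \<times> real \<Rightarrow> real) \<Rightarrow> real) \<Rightarrow> bool" where
  "linear_on_tests T \<Lambda> \<longleftrightarrow>
     (\<forall>\<phi>\<in>test_functions (open_strip T). \<forall>\<psi>\<in>test_functions (open_strip T). \<forall>c.
        \<Lambda> (\<lambda>p. \<phi> p + \<psi> p) = \<Lambda> \<phi> + \<Lambda> \<psi> \<and> \<Lambda> (\<lambda>p. c * \<phi> p) = c * \<Lambda> \<phi>)"

lemma linear_on_tests_diff:
  assumes "linear_on_tests T \<Lambda>" "\<phi> \<in> test_functions (open_strip T)" "\<psi> \<in> test_functions (open_strip T)"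
  shows "\<Lambda> (\<lambda>p. \<phi> p - \<psi> p) = \<Lambda> \<phi> - \<Lambda> \<psi>"
proof -
  let ?S = "test_functions (open_strip T)"
  have n: "(\<lambda>p. (-1) * \<psi> p) \<in> ?S"
    using test_functions_lincomb[OF assms(3,3), of "-1" 0] by simp
  have "\<Lambda> (\<lambda>p. \<phi> p + (-1) * \<psi> p) = \<Lambda> \<phi> + \<Lambda> (\<lambda>p. (-1) * \<psi> p)"
    by (rule assms(1)[unfolded linear_on_tests_def, rule_format, OF assms(2) n, THEN conjunct1])
  also have "\<Lambda> (\<lambda>p. (-1) * \<psi> p) = (-1) * \<Lambda> \<psi>"
    by (rule assms(1)[unfolded linear_on_tests_def, rule_format, OF assms(3,3), THEN conjunct2])
  finally show ?thesis by simp
qed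

lemma Hm1_loc_iff:
  "\<Lambda> \<in> Hm1_loc T \<longleftrightarrow> \<Lambda> \<in> extensional (test_functions (open_strip T)) \<and> linear_on_tests T \<Lambda> \<and>
     (\<forall>\<Omega>. local_domain T \<Omega> \<longrightarrow> (\<exists>C. \<forall>\<phi>\<in>test_functions \<Omega>. \<bar>\<Lambda> \<phi>\<bar> \<le> C * H1_norm \<phi>))"
  by (simp add: Hm1_loc_def linear_on_tests_def)

text \<open>A supremum of reals dominates the individual values only if these are bounded above;
  this is the side condition for using \<open>Hm1_norm\<close> as an upper bound.\<close>

lemma Hm1_norm_bdd:
  assumes "\<Lambda> \<in> Hm1_loc T" "\<Lambda>' \<in> Hm1_loc T" "local_domain T \<Omega>"
  shows "bdd_above ((\<lambda>\<phi>. \<bar>\<Lambda>' \<phi> - \<Lambda> \<phi>\<bar>) ` {\<phi> \<in> test_functions \<Omega>. H1_norm \<phi> \<le> 1})"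
proof -
  obtain C C' where C: "\<And>\<phi>. \<phi> \<in> test_functions \<Omega> \<Longrightarrow> \<bar>\<Lambda> \<phi>\<bar> \<le> C * H1_norm \<phi>"
    "\<And>\<phi>. \<phi> \<in> test_functions \<Omega> \<Longrightarrow> \<bar>\<Lambda>' \<phi>\<bar> \<le> C' * H1_norm \<phi>"
    using assms unfolding Hm1_loc_iff by metis
  show ?thesis
  proof (rule bdd_aboveI2)
    fix \<phi> assume \<phi>: "\<phi> \<in> {\<phi> \<in> test_functions \<Omega>. H1_norm \<phi> \<le> 1}"
    have "0 \<le> H1_norm \<phi>" by (simp add: H1_norm_def)
    with \<phi> have "C * H1_norm \<phi> \<le> \<bar>C\<bar> * 1" "C' * H1_norm \<phi> \<le> \<bar>C'\<bar> * 1"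
      by (intro mult_mono; simp)+
    with C[of \<phi>] \<phi> show "\<bar>\<Lambda>' \<phi> - \<Lambda> \<phi>\<bar> \<le> \<bar>C\<bar> + \<bar>C'\<bar>" by auto
  qed
qed

text \<open>Tychonoff's theorem. A functional is a point of the product over all functions on the
  plane: its coordinate at a test function ranges over a compact interval, and any other coordinate
  is pinned to \<open>undefined\<close> by extensionality. Linearity cuts out a closed
  subset.\<close>

lemma compact_linear_functionals:
  "compact {\<Lambda> \<in> extensional (test_functions (open_strip T)). linear_on_tests T \<Lambda> \<and>
     (\<forall>\<phi>\<in>test_functions (open_strip T). \<bar>\<Lambda> \<phi>\<bar> \<le> \<rho> \<phi>)}" (is "compact ?K")
proof -
  let ?S = "test_functions (open_strip T)"
  let ?X = "\<lambda>\<phi>. if \<phi> \<in> ?S then {- \<rho> \<phi>..\<rho> \<phi>} else {undefined}"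
  have "compactin (product_topology (\<lambda>_. euclideanreal) UNIV) (PiE UNIV ?X)"
    by (subst compactin_PiE) auto
  then have cX: "compact (PiE UNIV ?X)"
    by (simp add: euclidean_product_topology)
  have cl: "closed {\<Lambda>. linear_on_tests T \<Lambda>}"
    unfolding linear_on_tests_def Ball_def
    by (intro closed_Collect_all closed_Collect_imp open_Collect_const closed_Collect_conj closed_Collect_eq
        continuous_intros continuous_on_product_coordinates)
  have "?K = PiE UNIV ?X \<inter> {\<Lambda>. linear_on_tests T \<Lambda>}"
    by (auto simp: extensional_def PiE_iff abs_le_iff minus_le_iff split: if_splits)
  then show ?thesis
    using compact_Int_closed[OF cX cl] by simp
qed

text \<open>On a bounded set of functionals which is equicontinuous for a seminorm that makes the
  \<open>H\<^sup>1\<close> unit balls totally bounded, pointwise convergence implies convergence in \<open>H\<^sup>-\<^sup>1\<^sub>l\<^sub>o\<^sub>c\<close>;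
  so Tychonoff's theorem applies.\<close>

lemma compactin_Hm1_loc:
  assumes lin: "\<And>\<Lambda>. \<Lambda> \<in> F \<Longrightarrow> \<Lambda> \<in> extensional (test_functions (open_strip T)) \<and> linear_on_tests T \<Lambda>"
    and bd: "\<And>\<Omega>. local_domain T \<Omega> \<Longrightarrow> \<exists>C. \<forall>\<Lambda>\<in>F. \<forall>\<phi>\<in>test_functions \<Omega>. \<bar>\<Lambda> \<phi>\<bar> \<le> C * H1_norm \<phi>"
    and net: "\<And>\<Omega> \<delta>. local_domain T \<Omega> \<Longrightarrow> 0 < \<delta> \<Longrightarrow> \<exists>B0. finite B0 \<and> B0 \<subseteq> test_functions \<Omega> \<and>
       (\<forall>\<phi>\<in>test_functions \<Omega>. H1_norm \<phi> \<le> 1 \<longrightarrow> (\<exists>\<psi>\<in>B0. \<forall>\<Lambda>\<in>F. \<bar>\<Lambda> (\<lambda>p. \<phi> p - \<psi> p)\<bar> \<le> \<delta>))"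
  shows "\<exists>K. compactin (Hm1_loc_topology T) K \<and> F \<subseteq> K"
proof (cases "F = {}")
  case True
  then show ?thesis by (intro exI[of _ "{}"]) simp
next
  case False
  let ?S = "test_functions (open_strip T)"
  \<comment> \<open>The pointwise supremum over F. Any common bound for the members of F, be it the
    H^-1 bound or smallness on a difference of test functions, is a bound for \<open>\<rho>\<close>
    and so passes to all of K.\<close>
  define \<rho> where "\<rho> \<phi> = (SUP \<Lambda>\<in>F. \<bar>\<Lambda> \<phi>\<bar>)" for \<phi> :: "real \<times> real \<Rightarrow> real"
  define K where "K = {\<Lambda> \<in> extensional ?S. linear_on_tests T \<Lambda> \<and> (\<forall>\<phi>\<in>?S. \<bar>\<Lambda> \<phi>\<bar> \<le> \<rho> \<phi>)}"
  have \<rho>_le: "\<rho> \<phi> \<le> c" if "\<And>\<Lambda>. \<Lambda> \<in> F \<Longrightarrow> \<bar>\<Lambda> \<phi>\<bar> \<le> c" for \<phi> c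
    unfolding \<rho>_def using that False by (intro cSUP_least) auto
  have le_\<rho>: "\<bar>\<Lambda> \<phi>\<bar> \<le> \<rho> \<phi>" if \<Lambda>\<phi>: "\<Lambda> \<in> F" "\<phi> \<in> ?S" for \<Lambda> \<phi>
  proof -
    obtain \<Omega> where \<Omega>: "local_domain T \<Omega>" "\<phi> \<in> test_functions \<Omega>"
      using test_functions_local_domain[OF \<Lambda>\<phi>(2)] .
    obtain C where "\<forall>\<Lambda>\<in>F. \<forall>\<phi>\<in>test_functions \<Omega>. \<bar>\<Lambda> \<phi>\<bar> \<le> C * H1_norm \<phi>" using bd[OF \<Omega>(1)] by blast
    then show ?thesis
      unfolding \<rho>_def using \<Lambda>\<phi> \<Omega>(2) by (intro cSUP_upper bdd_aboveI2[of _ _ "C * H1_norm \<phi>"]) auto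
  qed
  have FK: "F \<subseteq> K" using lin le_\<rho> by (auto simp: K_def)
  have sub: "test_functions \<Omega> \<subseteq> ?S" if "local_domain T \<Omega>" for \<Omega>
    using that by (intro test_functions_mono) (auto simp: local_domain_def)
  have KH: "K \<subseteq> Hm1_loc T"
  proof
    fix \<Lambda> assume \<Lambda>: "\<Lambda> \<in> K"
    have "\<exists>C. \<forall>\<phi>\<in>test_functions \<Omega>. \<bar>\<Lambda> \<phi>\<bar> \<le> C * H1_norm \<phi>" if \<Omega>: "local_domain T \<Omega>" for \<Omega>
    proof -
      obtain C where C: "\<forall>\<Lambda>\<in>F. \<forall>\<phi>\<in>test_functions \<Omega>. \<bar>\<Lambda> \<phi>\<bar> \<le> C * H1_norm \<phi>" using bd[OF \<Omega>] by blast
      have "\<bar>\<Lambda> \<phi>\<bar> \<le> C * H1_norm \<phi>" if "\<phi> \<in> test_functions \<Omega>" for \<phi>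
      proof -
        have "\<bar>\<Lambda> \<phi>\<bar> \<le> \<rho> \<phi>" using \<Lambda> that sub[OF \<Omega>] by (auto simp: K_def)
        also have "\<dots> \<le> C * H1_norm \<phi>" using C that by (intro \<rho>_le) auto
        finally show ?thesis .
      qed
      then show ?thesis by blast
    qed
    with \<Lambda> show "\<Lambda> \<in> Hm1_loc T" by (auto simp: Hm1_loc_iff K_def)
  qed
  \<comment> \<open>K is compact for pointwise convergence, and the continuous identity carries this
    compactness over to the H^-1 topology.\<close>
  have "continuous_map (top_of_set K) (Hm1_loc_topology T) (\<lambda>\<Lambda>. \<Lambda>)"
    unfolding Hm1_loc_topology_def continuous_on_generated_topo_iff
  proof (intro conjI allI impI)
    fix V assume "V \<in> {{\<Lambda>' \<in> Hm1_loc T. Hm1_norm \<Omega> (\<lambda>\<phi>. \<Lambda>' \<phi> - \<Lambda> \<phi>) < r} | \<Lambda> \<Omega> r.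
        \<Lambda> \<in> Hm1_loc T \<and> local_domain T \<Omega> \<and> 0 < r}"
    then obtain \<Lambda>0 \<Omega> r where V: "V = {\<Lambda>' \<in> Hm1_loc T. Hm1_norm \<Omega> (\<lambda>\<phi>. \<Lambda>' \<phi> - \<Lambda>0 \<phi>) < r}"
      and \<Lambda>0: "\<Lambda>0 \<in> Hm1_loc T" and \<Omega>: "local_domain T \<Omega>" by blast
    let ?B = "{\<phi> \<in> test_functions \<Omega>. H1_norm \<phi> \<le> 1}"
    have B0: "(\<lambda>p. 0) \<in> ?B" by (simp add: zero_test_function zero_H1_norm)
    have "\<exists>W. open W \<and> \<Lambda>1 \<in> W \<and> K \<inter> W \<subseteq> V" if \<Lambda>1: "\<Lambda>1 \<in> K \<inter> V" for \<Lambda>1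
    proof -
      define r1 where "r1 = Hm1_norm \<Omega> (\<lambda>\<phi>. \<Lambda>1 \<phi> - \<Lambda>0 \<phi>)"
      have r1: "r1 < r" using \<Lambda>1 by (simp add: V r1_def)
      have r1_ge: "\<bar>\<Lambda>1 \<phi> - \<Lambda>0 \<phi>\<bar> \<le> r1" if "\<phi> \<in> ?B" for \<phi>
        unfolding r1_def Hm1_norm_def using that \<Lambda>1 KH
        by (intro cSUP_upper Hm1_norm_bdd[OF \<Lambda>0 _ \<Omega>]) auto
      define \<delta> where "\<delta> = (r - r1) / 4"
      have \<delta>: "0 < \<delta>" using r1 by (simp add: \<delta>_def)
      obtain B0 where B0: "finite B0" "B0 \<subseteq> test_functions \<Omega>"
        "\<And>\<phi>. \<phi> \<in> ?B \<Longrightarrow> \<exists>\<psi>\<in>B0. \<forall>\<Lambda>\<in>F. \<bar>\<Lambda> (\<lambda>p. \<phi> p - \<psi> p)\<bar> \<le> \<delta>"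
        using net[OF \<Omega> \<delta>] by blast
      define W where "W = {\<Lambda>. \<forall>\<psi>\<in>B0. \<bar>\<Lambda> \<psi> - \<Lambda>1 \<psi>\<bar> < \<delta>}"
      have "W = (\<Inter>\<psi>\<in>B0. {\<Lambda>. \<bar>\<Lambda> \<psi> - \<Lambda>1 \<psi>\<bar> < \<delta>})" by (auto simp: W_def)
      then have "open W"
        using B0(1) by (auto intro!: open_INT open_Collect_less continuous_intros continuous_on_product_coordinates)
      moreover have "\<Lambda>1 \<in> W" using \<delta> by (simp add: W_def)
      moreover have "K \<inter> W \<subseteq> V"
      proof
        fix \<Lambda> assume \<Lambda>: "\<Lambda> \<in> K \<inter> W"
        have small: "\<bar>\<Lambda>' \<phi> - \<Lambda>' \<psi>\<bar> \<le> \<delta>" if "\<Lambda>' \<in> K" "\<phi> \<in> ?S" "\<psi> \<in> ?S" 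
          "\<forall>\<Lambda>\<in>F. \<bar>\<Lambda> (\<lambda>p. \<phi> p - \<psi> p)\<bar> \<le> \<delta>" for \<Lambda>' \<phi> \<psi>
        proof -
          have "\<bar>\<Lambda>' \<phi> - \<Lambda>' \<psi>\<bar> = \<bar>\<Lambda>' (\<lambda>p. \<phi> p - \<psi> p)\<bar>"
            using that linear_on_tests_diff[of T \<Lambda>' \<phi> \<psi>] by (simp add: K_def)
          also have "\<dots> \<le> \<rho> (\<lambda>p. \<phi> p - \<psi> p)"
            using that test_functions_diff[of \<phi> _ \<psi>] by (auto simp: K_def)
          also have "\<dots> \<le> \<delta>" using that by (intro \<rho>_le) auto
          finally show ?thesis .
        qed
        have "\<bar>\<Lambda> \<phi> - \<Lambda>0 \<phi>\<bar> \<le> r1 + 3 * \<delta>" if \<phi>: "\<phi> \<in> ?B" for \<phi>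
        proof -
          obtain \<psi> where \<psi>: "\<psi> \<in> B0" "\<forall>\<Lambda>\<in>F. \<bar>\<Lambda> (\<lambda>p. \<phi> p - \<psi> p)\<bar> \<le> \<delta>" using B0(3)[OF \<phi>] by blast
          have S: "\<phi> \<in> ?S" "\<psi> \<in> ?S" using \<phi> \<psi>(1) B0(2) sub[OF \<Omega>] by auto
          have "\<bar>\<Lambda> \<phi> - \<Lambda> \<psi>\<bar> \<le> \<delta>" "\<bar>\<Lambda>1 \<phi> - \<Lambda>1 \<psi>\<bar> \<le> \<delta>"
            using small[of \<Lambda> \<phi> \<psi>] small[of \<Lambda>1 \<phi> \<psi>] \<Lambda> \<Lambda>1 S \<psi>(2) by blast+
          moreover have "\<bar>\<Lambda> \<psi> - \<Lambda>1 \<psi>\<bar> < \<delta>" using \<Lambda> \<psi>(1) by (auto simp: W_def)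
          ultimately show ?thesis using r1_ge[OF \<phi>] by linarith
        qed
        then have "Hm1_norm \<Omega> (\<lambda>\<phi>. \<Lambda> \<phi> - \<Lambda>0 \<phi>) \<le> r1 + 3 * \<delta>"
          unfolding Hm1_norm_def using \<open>(\<lambda>p. 0) \<in> ?B\<close> by (intro cSUP_least) auto
        also have "\<dots> < r" using r1 by (simp add: \<delta>_def field_simps)
        finally show "\<Lambda> \<in> V" using \<Lambda> KH by (auto simp: V)
      qed
      ultimately show ?thesis by blast
    qed
    then have "openin (top_of_set K) (K \<inter> V)"
    proof (subst openin_subopen, intro ballI)
      fix \<Lambda>1 assume "\<Lambda>1 \<in> K \<inter> V"
      then obtain W where "open W" "\<Lambda>1 \<in> W" "K \<inter> W \<subseteq> V"
        using \<open>\<And>\<Lambda>1. \<Lambda>1 \<in> K \<inter> V \<Longrightarrow> _\<close> by blast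
      with \<open>\<Lambda>1 \<in> K \<inter> V\<close> show "\<exists>X. openin (top_of_set K) X \<and> \<Lambda>1 \<in> X \<and> X \<subseteq> K \<inter> V"
        by (intro exI[of _ "K \<inter> W"]) auto
    qed
    then show "openin (top_of_set K) ((\<lambda>\<Lambda>. \<Lambda>) -` V \<inter> topspace (top_of_set K))"
      by (simp only: vimage_ident topspace_euclidean_subtopology Int_commute)
  next
    \<comment> \<open>The subbasic sets have to cover K. The empty set is always a local domain, so
      every \<Lambda> lies in its own ball for that seminorm.\<close>
    have "\<Lambda> \<in> {\<Lambda>' \<in> Hm1_loc T. Hm1_norm {} (\<lambda>\<phi>. \<Lambda>' \<phi> - \<Lambda> \<phi>) < 1}" if "\<Lambda> \<in> Hm1_loc T" for \<Lambda>
    proof -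
      have "{\<phi> \<in> test_functions {}. H1_norm \<phi> \<le> 1} \<noteq> {}"
        using zero_test_function zero_H1_norm by force
      then show ?thesis using that by (simp add: Hm1_norm_def)
    qed
    moreover have "local_domain T {}" by (simp add: local_domain_def)
    ultimately show "(\<lambda>\<Lambda>. \<Lambda>) ` topspace (top_of_set K) \<subseteq> \<Union> {{\<Lambda>' \<in> Hm1_loc T. Hm1_norm \<Omega> (\<lambda>\<phi>. \<Lambda>' \<phi> - \<Lambda> \<phi>) < r} | \<Lambda> \<Omega> r.
        \<Lambda> \<in> Hm1_loc T \<and> local_domain T \<Omega> \<and> 0 < r}"
      using KH by (simp only: image_ident topspace_euclidean_subtopology) (blast intro: zero_less_one)
  qed
  moreover have "compactin (top_of_set K) K"
    using compact_linear_functionals[of T \<rho>] by (simp add: compactin_subtopology K_def)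
  ultimately have "compactin (Hm1_loc_topology T) ((\<lambda>\<Lambda>. \<Lambda>) ` K)"
    by (rule image_compactin[rotated])
  with FK show ?thesis by auto
qed

section \<open>Functions on the strip\<close>

lemma has_partials_cong:
  assumes "has_partials X Y f fx ft"
    "\<And>p. p \<in> X \<times> Y \<Longrightarrow> f p = f' p" "\<And>p. p \<in> X \<times> Y \<Longrightarrow> fx p = fx' p" "\<And>p. p \<in> X \<times> Y \<Longrightarrow> ft p = ft' p"
  shows "has_partials X Y f' fx' ft'"
  unfolding has_partials_def
proof (intro conjI ballI)
  show "continuous_on (X \<times> Y) f'" "continuous_on (X \<times> Y) fx'" "continuous_on (X \<times> Y) ft'"
    using has_partialsD(1-3)[OF assms(1)] assms(2-4) by (auto cong: continuous_on_cong)
  fix x t assume xt: "x \<in> X" "t \<in> Y"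
  have "((\<lambda>y. f' (y, t)) has_vector_derivative fx (x, t)) (at x within X)"
    by (rule has_vector_derivative_transform[OF xt(1) _ has_partialsD(4)[OF assms(1) xt]])
      (use assms(2) xt in auto)
  then show "((\<lambda>y. f' (y, t)) has_vector_derivative fx' (x, t)) (at x within X)"
    using assms(3)[of "(x, t)"] xt by simp
  have "((\<lambda>s. f' (x, s)) has_vector_derivative ft (x, t)) (at t within Y)"
    by (rule has_vector_derivative_transform[OF xt(2) _ has_partialsD(5)[OF assms(1) xt]])
      (use assms(2) xt in auto)
  then show "((\<lambda>s. f' (x, s)) has_vector_derivative ft' (x, t)) (at t within Y)"
    using assms(4)[of "(x, t)"] xt by simp
qed

text \<open>The Frechet derivative is restricted to the lines t = const and x = const. All members
  of the family are differentiable, hence continuous, so the partials are continuous too.\<close>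

lemma has_partials_of_derivatives:
  assumes D: "\<And>i j p. p \<in> X \<times> Y \<Longrightarrow> (D i j has_derivative
      (\<lambda>h. fst h *\<^sub>R D (Suc i) j p + snd h *\<^sub>R D i (Suc j) p)) (at p within X \<times> Y)"
  shows "has_partials X Y (D i j) (D (Suc i) j) (D i (Suc j))"
proof -
  have cont: "continuous_on (X \<times> Y) (D i j)" for i j
    using D has_derivative_continuous continuous_on_eq_continuous_within by blast
  show ?thesis
    unfolding has_partials_def
  proof (intro conjI ballI cont)
    fix x t assume xt: "x \<in> X" "t \<in> Y"
    then have p: "(x, t) \<in> X \<times> Y" by simp
    have "(D i j has_derivative (\<lambda>h. fst h *\<^sub>R D (Suc i) j (x, t) + snd h *\<^sub>R D i (Suc j) (x, t)))
        (at (x, t) within (\<lambda>y. (y, t)) ` X)"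
      by (rule has_derivative_subset[OF D[OF p]]) (use xt in auto)
    moreover have "((\<lambda>y. (y, t)) has_derivative (\<lambda>h. (h, 0))) (at x within X)"
      by (auto intro!: derivative_eq_intros)
    ultimately show "((\<lambda>y. D i j (y, t)) has_vector_derivative D (Suc i) j (x, t)) (at x within X)"
      using has_derivative_in_compose by (fastforce simp: has_vector_derivative_def)
    have "(D i j has_derivative (\<lambda>h. fst h *\<^sub>R D (Suc i) j (x, t) + snd h *\<^sub>R D i (Suc j) (x, t)))
        (at (x, t) within (\<lambda>s. (x, s)) ` Y)"
      by (rule has_derivative_subset[OF D[OF p]]) (use xt in auto)
    moreover have "((\<lambda>s. (x, s)) has_derivative (\<lambda>h. (0, h))) (at t within Y)"
      by (auto intro!: derivative_eq_intros)
    ultimately show "((\<lambda>s. D i j (x, s)) has_vector_derivative D i (Suc j) (x, t)) (at t within Y)"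
      using has_derivative_in_compose by (fastforce simp: has_vector_derivative_def)
  qed
qed

lemma pdx_eq:
  assumes "has_partials UNIV Y f fx ft" "p \<in> UNIV \<times> Y"
  shows "pdx f p = fx p"
proof -
  obtain x t where p: "p = (x, t)" "t \<in> Y" using assms(2) by auto
  show ?thesis
    using vector_derivative_at[OF has_partialsD(4)[OF assms(1) UNIV_I p(2)]] by (simp add: p(1) pdx_def)
qed

text \<open>For \<open>a < b\<close> every point of the interval, end points included, is a limit
  point, so the derivative within the interval is unique and \<open>pdt\<close> returns it.\<close>

lemma pdt_eq:
  assumes "has_partials X {a..b} f fx ft" "a < b" "p \<in> X \<times> {a..b}"
  shows "pdt {a..b} f p = ft p"
proof -
  obtain x t where p: "p = (x, t)" "x \<in> X" "t \<in> {a..b}" using assms(3) by auto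
  show ?thesis
    using vector_derivative_within_cbox[OF assms(2), unfolded cbox_interval, OF _ has_partialsD(5)[OF assms(1) p(2,3)]] p(3)
    by (simp add: p(1) pdt_def)
qed

lemma pdt_UNIV_eq:
  assumes "has_partials X UNIV f fx ft" "p \<in> X \<times> UNIV"
  shows "pdt UNIV f p = ft p"
proof -
  obtain x t where p: "p = (x, t)" "x \<in> X" using assms(2) by auto
  show ?thesis
    using vector_derivative_at[OF has_partialsD(5)[OF assms(1) p(2) UNIV_I]] by (simp add: p(1) pdt_def)
qed

text \<open>The mixed derivative is the member of order (1, 1) of the family in
  \<open>smooth_xt\<close>. It serves at once as t-derivative of \<open>pdx u\<close> and as
  x-derivative of \<open>pdt {0..T} u\<close>, so no theorem on exchanging derivatives up to the
  boundary of the strip is called for. This is why \<open>uxt\<close> is obtained instead of being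
  written with the operators.\<close>

lemma smooth_strip_partials:
  fixes u :: "real \<times> real \<Rightarrow> 'a::real_normed_vector"
  assumes "smooth_xt (strip T) u" "0 < T"
  obtains uxt where "has_partials UNIV {0..T} u (pdx u) (pdt {0..T} u)"
    "has_partials UNIV {0..T} (pdx u) (pdx (pdx u)) uxt"
    "has_partials UNIV {0..T} (pdt {0..T} u) uxt (pdt {0..T} (pdt {0..T} u))"
proof -
  obtain D where D: "\<And>p. p \<in> UNIV \<times> {0..T} \<Longrightarrow> D 0 0 p = u p"
    "\<And>i j p. p \<in> UNIV \<times> {0..T} \<Longrightarrow> (D i j has_derivative
            (\<lambda>h. fst h *\<^sub>R D (Suc i) j p + snd h *\<^sub>R D i (Suc j) p)) (at p within UNIV \<times> {0..T})"
    using assms(1) unfolding smooth_xt_def strip_def by blast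
  note P = has_partials_of_derivatives[of UNIV "{0..T}" D, OF D(2)]
  have "has_partials UNIV {0..T} u (D (Suc 0) 0) (D 0 (Suc 0))"
    by (rule has_partials_cong[OF P[of 0 0]]) (use D(1) in auto)
  then have e: "\<And>p. p \<in> UNIV \<times> {0..T} \<Longrightarrow> D (Suc 0) 0 p = pdx u p"
      "\<And>p. p \<in> UNIV \<times> {0..T} \<Longrightarrow> D 0 (Suc 0) p = pdt {0..T} u p"
    by (simp_all only: pdx_eq pdt_eq[OF _ \<open>0 < T\<close>])
  have 1: "has_partials UNIV {0..T} u (pdx u) (pdt {0..T} u)"
    by (rule has_partials_cong[OF P[of 0 0]]) (use D(1) e in auto)
  have "has_partials UNIV {0..T} (pdx u) (D (Suc (Suc 0)) 0) (D (Suc 0) (Suc 0))"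
    by (rule has_partials_cong[OF P[of "Suc 0" 0]]) (use e in auto)
  then have e1: "\<And>p. p \<in> UNIV \<times> {0..T} \<Longrightarrow> D (Suc (Suc 0)) 0 p = pdx (pdx u) p"
    by (simp only: pdx_eq)
  have 2: "has_partials UNIV {0..T} (pdx u) (pdx (pdx u)) (D (Suc 0) (Suc 0))"
    by (rule has_partials_cong[OF P[of "Suc 0" 0]]) (use e e1 in auto)
  have "has_partials UNIV {0..T} (pdt {0..T} u) (D (Suc 0) (Suc 0)) (D 0 (Suc (Suc 0)))"
    by (rule has_partials_cong[OF P[of 0 "Suc 0"]]) (use e in auto)
  then have e2: "\<And>p. p \<in> UNIV \<times> {0..T} \<Longrightarrow> D 0 (Suc (Suc 0)) p = pdt {0..T} (pdt {0..T} u) p"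
    by (simp only: pdt_eq[OF _ \<open>0 < T\<close>])
  have 3: "has_partials UNIV {0..T} (pdt {0..T} u) (D (Suc 0) (Suc 0)) (pdt {0..T} (pdt {0..T} u))"
    by (rule has_partials_cong[OF P[of 0 "Suc 0"]]) (use e e2 in auto)
  from 1 2 3 show thesis by (rule that)
qed

section \<open>Gronwall's inequality and integrals over the real line\<close>

lemma gronwall_interval:
  fixes g g' :: "real \<Rightarrow> real"
  assumes d: "\<And>t. t \<in> {0..T} \<Longrightarrow> (g has_vector_derivative g' t) (at t within {0..T})"
    and le: "\<And>t. t \<in> {0..T} \<Longrightarrow> g' t \<le> C * g t + \<delta>" and "0 \<le> C" "0 \<le> \<delta>" and g0: "0 \<le> g 0" and t: "t \<in> {0..T}"
  shows "g t \<le> exp (C * T) * (g 0 + \<delta> * T)"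
proof -
  \<comment> \<open>\<open>h\<close> is nonincreasing: \<open>exp (- C * s) \<le> 1\<close> for s >=
    0, so the inhomogeneity is compensated by the subtracted \<delta> s.\<close>
  define h where "h s = exp (- C * s) * g s - \<delta> * s" for s
  have dh: "(h has_vector_derivative exp (- C * s) * (g' s - C * g s) - \<delta>) (at s within {0..t})" if s: "s \<in> {0..t}" for s
  proof -
    have "(g has_real_derivative g' s) (at s within {0..t})"
      using d[of s] s t has_vector_derivative_within_subset[of g "g' s" s "{0..T}" "{0..t}"]
      by (auto simp: has_real_derivative_iff_has_vector_derivative)
    then show ?thesis
      unfolding h_def has_real_derivative_iff_has_vector_derivative[symmetric]
      by (auto intro!: derivative_eq_intros simp: algebra_simps)
  qed
  have neg: "exp (- C * s) * (g' s - C * g s) - \<delta> \<le> 0" if s: "s \<in> {0..t}" for s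
  proof -
    have "exp (- C * s) * (g' s - C * g s) \<le> exp (- C * s) * \<delta>"
      using le[of s] s t by (intro mult_left_mono) auto
    also have "\<dots> \<le> 1 * \<delta>"
      using s assms(3,4) by (intro mult_right_mono) auto
    finally show ?thesis by simp
  qed
  have "((\<lambda>s. exp (- C * s) * (g' s - C * g s) - \<delta>) has_integral (h t - h 0)) {0..t}"
    using t by (intro fundamental_theorem_of_calculus dh) auto
  from has_integral_le[OF this has_integral_0] neg have "h t \<le> h 0" by auto
  then have "exp (- C * t) * g t \<le> g 0 + \<delta> * t" by (simp add: h_def)
  then have "exp (C * t) * (exp (- C * t) * g t) \<le> exp (C * t) * (g 0 + \<delta> * t)"
    by (intro mult_left_mono) auto
  also have "exp (C * t) * (exp (- C * t) * g t) = g t"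
    by (simp flip: mult.assoc exp_add)
  also have "exp (C * t) * (g 0 + \<delta> * t) \<le> exp (C * T) * (g 0 + \<delta> * T)"
    using t assms(3,4) g0 by (intro mult_mono add_left_mono mult_left_mono add_nonneg_nonneg) (auto intro: mult_left_mono)
  finally show ?thesis .
qed

text \<open>Monotone convergence along the intervals [-n, n]. It links the gauge integrals over
  intervals, in which the energy is estimated, with the Lebesgue integral of the statement, and
  supplies the integrability without which the latter would carry no information.\<close>

lemma real_line_integral:
  fixes f :: "real \<Rightarrow> real"
  assumes cont: "continuous_on UNIV f" and nonneg: "\<And>x. 0 \<le> f x"
    and le: "\<And>R. integral {-R..R} f \<le> M"
  shows "integrable lborel f" "(LINT x|lborel. f x) \<le> M" "\<And>R. integral {-R..R} f \<le> (LINT x|lborel. f x)"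
proof -
  have set: "set_integrable lborel {-R..R} f" for R
    unfolding set_integrable_def
    by (intro borel_integrable_compact continuous_on_subset[OF cont]) auto
  define g where "g n x = indicator {- real n..real n} x *\<^sub>R f x" for n :: nat and x
  have gi: "integrable lborel (g n)" for n
    using set[of "real n"] unfolding g_def set_integrable_def .
  have gint: "(LINT x|lborel. indicator {-R..R} x *\<^sub>R f x) = integral {-R..R} f" for R
    using set_borel_integral_eq_integral(2)[OF set] unfolding set_lebesgue_integral_def .
  have inc: "incseq (\<lambda>n. LINT x|lborel. g n x)"
  proof (rule incseq_SucI)
    show "(LINT x|lborel. g n x) \<le> (LINT x|lborel. g (Suc n) x)" for n
      by (intro integral_mono gi) (auto simp: g_def nonneg split: split_indicator)
  qed
  have bd: "(LINT x|lborel. g n x) \<le> M" for n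
    using gint[of "real n"] le by (simp add: g_def)
  obtain l where l: "(\<lambda>n. LINT x|lborel. g n x) \<longlonglongrightarrow> l" "l \<le> M"
  proof -
    obtain l where "(\<lambda>n. LINT x|lborel. g n x) \<longlonglongrightarrow> l"
      using incseq_convergent[OF inc] bd by blast
    moreover have "l \<le> M" by (rule LIMSEQ_le_const2[OF calculation]) (use bd in auto)
    ultimately show thesis by (rule that)
  qed
  have conv: "(\<lambda>n. g n x) \<longlonglongrightarrow> f x" for x
  proof (rule tendsto_eventually)
    show "\<forall>\<^sub>F n in sequentially. g n x = f x"
      using eventually_ge_at_top[of "nat \<lceil>\<bar>x\<bar>\<rceil>"]
      by eventually_elim (auto simp: g_def nat_le_iff ceiling_le_iff split: split_indicator)
  qed
  have mono: "AE x in lborel. mono (\<lambda>n. g n x)"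
    by (intro AE_I2 monoI) (auto simp: g_def nonneg split: split_indicator)
  have meas: "f \<in> borel_measurable lborel"
    using borel_measurable_continuous_onI[OF cont] by simp
  show int: "integrable lborel f"
    by (rule integrable_monotone_convergence[OF gi mono _ l(1) meas]) (use conv in auto)
  have "(LINT x|lborel. f x) = l"
    by (rule integral_monotone_convergence[OF gi mono _ l(1) meas]) (use conv in auto)
  with l(2) show "(LINT x|lborel. f x) \<le> M" by simp
  show "integral {-R..R} f \<le> (LINT x|lborel. f x)" for R
    unfolding gint[symmetric]
    using set[of R] int by (intro integral_mono) (auto simp: set_integrable_def nonneg split: split_indicator)
qed

section \<open>The energy estimate\<close>

text \<open>The rate of the Gronwall argument results from \<open>\<beta>|u|\<^sup>2 \<le> 2 \<eta>\<close>, \<open>|D\<eta>|\<^sup>2 \<le> \<alpha> \<eta>\<close> and the bounds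
  \<open>\<eta> \<le> 4 e\<close>, \<open>\<alpha> \<epsilon>\<^sup>2 |u\<^sub>t|\<^sup>2 \<le> 6 e\<close> by the energy density \<open>e\<close>; here \<open>A \<ge> a I\<close>.\<close>

definition growth_rate :: "real \<Rightarrow> real \<Rightarrow> real \<Rightarrow> real" where
  "growth_rate \<alpha> \<beta> L = 2 * L * (\<alpha> + 2 / \<beta>) + 3 * L + 4 * \<alpha> * L / \<beta>"

text \<open>The entries are the coefficients of |u|^2, \<epsilon>^2 |u_t|^2 and \<epsilon>^2 |u_x|^2
  in the lower bound for the energy density; \<beta>/8 comes from \<eta>/4 >= \<beta>/8
  |u|^2.\<close>

definition energy_lower :: "real \<Rightarrow> real \<Rightarrow> real \<Rightarrow> real" where
  "energy_lower \<alpha> \<beta> a = min (\<beta> / 8) (min (\<alpha> / 6) (\<alpha> * a / 2))"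

text \<open>Sum of the coefficients of |u|^2, \<epsilon>^2 |u_t|^2 and \<epsilon>^2 |u_x|^2 in the
  upper bound for the energy density, hence at least each of them; \<alpha>^2/8 and 1/2 result from
  the cross term.\<close>

definition energy_upper :: "real \<Rightarrow> real^'n^'n \<Rightarrow> real" where
  "energy_upper \<alpha> A = \<alpha> / 4 + \<alpha>^2 / 8 + 1 / 2 + \<alpha> / 2 * norm A + \<alpha> / 2"

lemma energy_upper_positive: "0 < \<alpha> \<Longrightarrow> 0 < energy_upper \<alpha> A"
proof -
  assume "0 < \<alpha>"
  moreover from this have "0 \<le> \<alpha> / 2 * norm A" "0 \<le> \<alpha>^2 / 8" by auto
  ultimately show ?thesis unfolding energy_upper_def by linarith
qed

lemma has_vector_derivative_inner:
  fixes f g :: "real \<Rightarrow> 'a::real_inner"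
  assumes "(f has_vector_derivative f') (at x within S)" "(g has_vector_derivative g') (at x within S)"
  shows "((\<lambda>x. f x \<bullet> g x) has_vector_derivative (f x \<bullet> g' + f' \<bullet> g x)) (at x within S)"
  by (rule bounded_bilinear.has_vector_derivative[OF bounded_bilinear_inner assms])

lemma has_vector_derivative_matrix:
  fixes M :: "real^'n^'m"
  assumes "(f has_vector_derivative f') (at x within S)"
  shows "((\<lambda>x. M *v f x) has_vector_derivative (M *v f')) (at x within S)"
  using bounded_linear.has_vector_derivative[OF matrix_vector_mul_bounded_linear assms] .

text \<open>All derivatives of u are parameters tied together by \<open>has_partials\<close>, so the
  estimates never handle \<open>pdx\<close> and \<open>pdt\<close>. The equation is stated after the
  chain rule for F(u)_x. Of the decay one power of 1 + |x| is kept: it makes the boundary flux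
  cancel in the limit and the energy density integrable.\<close>

locale relaxation =
  fixes A :: "real^'n^'n" and F G :: "real^'n \<Rightarrow> real^'n" and \<eta> q :: "real^'n \<Rightarrow> real"
    and \<alpha> \<beta> \<nu> L T \<epsilon> a :: real and u ux ut uxx uxt utt :: "real \<times> real \<Rightarrow> real^'n"
  assumes pos: "0 < T" "0 < \<epsilon>" "0 < \<alpha>" "0 < \<beta>" "0 < \<nu>" "0 < a" "0 \<le> L"
    and A_sym: "\<And>v w. (A *v v) \<bullet> w = v \<bullet> (A *v w)"
    and A_pos: "\<And>v. a * (norm v)^2 \<le> v \<bullet> (A *v v)"
    and F: "C1_map F" and G_cont: "continuous_on UNIV G" and G_le: "\<And>w. norm (G w) \<le> L * norm w"
    and pair: "entropy_pair F \<eta> q"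
    and hess_lo: "\<And>w v. \<beta> * (v \<bullet> v) \<le> v \<bullet> (hess \<eta> w *v v)"
    and hess_hi: "\<And>w v. v \<bullet> (hess \<eta> w *v v) \<le> \<alpha> / 2 * (v \<bullet> v)"
    and \<eta>_nonneg: "\<And>w. 0 \<le> \<eta> w" and \<eta>_0: "\<eta> 0 = 0" and grad_0: "grad \<eta> 0 = 0"
    and subchar: "\<And>w v. \<nu> * (norm v)^2 + \<alpha> * (norm (jac F w *v v))^2 \<le> (A *v v) \<bullet> (hess \<eta> w *v v)"
    and u: "has_partials UNIV {0..T} u ux ut" and ux: "has_partials UNIV {0..T} ux uxx uxt"
    and ut: "has_partials UNIV {0..T} ut uxt utt"
    and eqn: "\<And>p. p \<in> UNIV \<times> {0..T} \<Longrightarrow>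
      ut p + jac F (u p) *v ux p = G (u p) + \<epsilon> *\<^sub>R (A *v uxx p - utt p)"
    and decay: "\<exists>K. \<forall>p\<in>UNIV \<times> {0..T}. (1 + \<bar>fst p\<bar>) * (norm (u p) + norm (ux p) + norm (ut p)) \<le> K"
begin

abbreviation "rate \<equiv> growth_rate \<alpha> \<beta> L"
abbreviation "lower \<equiv> energy_lower \<alpha> \<beta> a"
abbreviation "upper \<equiv> energy_upper \<alpha> A"

lemma C2: "C2_scalar \<eta>" and C1q: "C1_scalar q"
  and flux_eq: "grad \<eta> w \<bullet> (jac F w *v v) = grad q w \<bullet> v"
  using pair by (auto simp: entropy_pair_def row_times_matrix_inner[symmetric])

lemmas \<eta>_bounds = entropy_bounds[OF C2 hess_lo hess_hi pos(3) \<eta>_nonneg \<eta>_0 grad_0]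

lemmas cont_u = has_partialsD(1)[OF u] has_partialsD(1)[OF ux] has_partialsD(1)[OF ut]
  has_partialsD(2)[OF ux] has_partialsD(3)[OF ux] has_partialsD(3)[OF ut]

lemma continuous_on_of_u:
  "continuous_on UNIV f \<Longrightarrow> continuous_on (UNIV \<times> {0..T}) (\<lambda>p. f (u p))"
  by (rule continuous_on_compose2[OF _ cont_u(1)]) auto

lemmas cont_of_u = continuous_on_of_u[OF continuous_on_C1_scalar] continuous_on_of_u[OF continuous_on_grad]
  continuous_on_of_u[OF continuous_on_hess] continuous_on_of_u[OF continuous_on_jac]

lemmas entropy_C = C2 C2_scalar_imp_C1[OF C2] C1q F

text \<open>\<open>e\<close> and \<open>flux\<close> come from pairing the equation with D\<eta>(u)
  + \<alpha> \<epsilon> u_t. The sign of \<open>flux\<close> is such that \<open>et - fluxx\<close>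
  is source minus dissipation.\<close>

definition "e p = \<eta> (u p) + \<epsilon> * (grad \<eta> (u p) \<bullet> ut p)
  + \<alpha> * \<epsilon>^2 / 2 * (ux p \<bullet> (A *v ux p)) + \<alpha> * \<epsilon>^2 / 2 * (ut p \<bullet> ut p)"

definition "et p = grad \<eta> (u p) \<bullet> ut p + \<epsilon> * (grad \<eta> (u p) \<bullet> utt p + (hess \<eta> (u p) *v ut p) \<bullet> ut p)
  + \<alpha> * \<epsilon>^2 * (uxt p \<bullet> (A *v ux p)) + \<alpha> * \<epsilon>^2 * (ut p \<bullet> utt p)"

definition "flux p = - q (u p) + \<epsilon> * (grad \<eta> (u p) \<bullet> (A *v ux p)) + \<alpha> * \<epsilon>^2 * (ut p \<bullet> (A *v ux p))"

definition "fluxx p = - (grad q (u p) \<bullet> ux p)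
  + \<epsilon> * (grad \<eta> (u p) \<bullet> (A *v uxx p) + (hess \<eta> (u p) *v ux p) \<bullet> (A *v ux p))
  + \<alpha> * \<epsilon>^2 * (ut p \<bullet> (A *v uxx p) + uxt p \<bullet> (A *v ux p))"

definition "dens p = (norm (u p))^2 + \<epsilon>^2 * (norm (ux p))^2 + \<epsilon>^2 * (norm (ut p))^2"

definition "diss p = \<alpha> / 4 * (norm (ut p))^2 + \<nu> * (norm (ux p))^2"

abbreviation "E0 \<equiv> LINT x|lborel. dens (x, 0)"

lemma cont_energy: "continuous_on (UNIV \<times> {0..T}) e" "continuous_on (UNIV \<times> {0..T}) et"
  "continuous_on (UNIV \<times> {0..T}) fluxx" "continuous_on (UNIV \<times> {0..T}) dens"
  "continuous_on (UNIV \<times> {0..T}) diss"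
  unfolding e_def[abs_def] et_def[abs_def] fluxx_def[abs_def] dens_def[abs_def] diss_def[abs_def]
  by (intro continuous_intros cont_u cont_of_u entropy_C)+

lemma energy_dt:
  assumes "t \<in> {0..T}"
  shows "((\<lambda>s. e (x, s)) has_vector_derivative et (x, t)) (at t within {0..T})"
proof -
  note du = has_partialsD(5)[OF u UNIV_I assms, of x] 
  note d = du has_partialsD(5)[OF ux UNIV_I assms, of x] has_partialsD(5)[OF ut UNIV_I assms, of x]
  note dc = has_vector_derivative_chain_at[OF grad_has_derivative[OF entropy_C(2)] du]
    has_vector_derivative_chain_at[OF hess_has_derivative[OF C2] du]
  have "((\<lambda>s. e (x, s)) has_vector_derivative
    grad \<eta> (u (x, t)) \<bullet> ut (x, t)
    + \<epsilon> * (grad \<eta> (u (x, t)) \<bullet> utt (x, t) + (hess \<eta> (u (x, t)) *v ut (x, t)) \<bullet> ut (x, t))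
    + \<alpha> * \<epsilon>^2 / 2 * (ux (x, t) \<bullet> (A *v uxt (x, t)) + uxt (x, t) \<bullet> (A *v ux (x, t)))
    + \<alpha> * \<epsilon>^2 / 2 * (ut (x, t) \<bullet> utt (x, t) + utt (x, t) \<bullet> ut (x, t))) (at t within {0..T})"
    unfolding e_def
    by (intro has_vector_derivative_add has_vector_derivative_mult_right has_vector_derivative_inner
      has_vector_derivative_matrix d dc)
  also have "ux (x, t) \<bullet> (A *v uxt (x, t)) = uxt (x, t) \<bullet> (A *v ux (x, t))"
    using A_sym by (simp add: inner_commute)
  finally show ?thesis
    by (simp add: et_def mult.assoc inner_commute[of "utt (x, t)"])
qed

lemma flux_dx:
  assumes "t \<in> {0..T}"
  shows "((\<lambda>y. flux (y, t)) has_vector_derivative fluxx (x, t)) (at x within X)"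
proof -
  note du = has_partialsD(4)[OF u UNIV_I assms, of x, THEN has_vector_derivative_at_within, of X]
  note d = du has_partialsD(4)[OF ux UNIV_I assms, of x, THEN has_vector_derivative_at_within, of X]
    has_partialsD(4)[OF ut UNIV_I assms, of x, THEN has_vector_derivative_at_within, of X]
  note dc = has_vector_derivative_chain_at[OF grad_has_derivative[OF entropy_C(3)] du]
    has_vector_derivative_chain_at[OF hess_has_derivative[OF C2] du]
  show ?thesis
    unfolding flux_def fluxx_def
    by (intro has_vector_derivative_add has_vector_derivative_mult_right has_vector_derivative_inner
      has_vector_derivative_matrix has_vector_derivative_minus d dc)
qed

text \<open>The equation is solved for G(u) and substituted. The terms u_xt . A u_x occur in both
  \<open>et\<close> and \<open>fluxx\<close> and cancel, the compatibility relation exchanges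
  \<open>grad q\<close> for \<open>grad \<eta>\<close> times \<open>jac F\<close>, and all remaining
  second derivatives are absorbed by G(u).\<close>

lemma energy_identity:
  assumes "p \<in> UNIV \<times> {0..T}"
  shows "et p - fluxx p = (grad \<eta> (u p) + (\<alpha> * \<epsilon>) *\<^sub>R ut p) \<bullet> G (u p)
    - \<epsilon> * (\<alpha> * (norm (ut p))^2 + \<alpha> * (ut p \<bullet> (jac F (u p) *v ux p))
        - (hess \<eta> (u p) *v ut p) \<bullet> ut p + (hess \<eta> (u p) *v ux p) \<bullet> (A *v ux p))"
proof -
  have eq: "G (u p) = ut p + jac F (u p) *v ux p - \<epsilon> *\<^sub>R (A *v uxx p - utt p)"
    using eqn[OF assms] by simp
  show ?thesis
    unfolding eq et_def fluxx_def flux_eq[symmetric] power2_norm_eq_inner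
    by (simp add: algebra_simps inner_add_left inner_add_right inner_diff_right power2_eq_square)
qed

text \<open>Only the cross term \<epsilon> D\<eta> . u_t has no sign. As |D\<eta>|^2 <= \<alpha>
  \<eta>, Young's inequality lets it consume 3/4 of \<eta> and \<alpha>/3 out of the \<alpha>/2 in
  front of \<epsilon>^2 |u_t|^2.\<close>

lemma energy_pointwise:
  assumes "p \<in> UNIV \<times> {0..T}"
  shows "\<eta> (u p) / 4 + \<alpha> / 6 * (\<epsilon>^2 * (norm (ut p))^2) + \<alpha> * a / 2 * (\<epsilon>^2 * (norm (ux p))^2) \<le> e p"
    and "lower * dens p \<le> e p" and "e p \<le> upper * dens p"
proof -
  define X N Y Z E where "X = norm (grad \<eta> (u p))" and "N = norm (u p)" and "Y = \<epsilon> * norm (ut p)"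
    and "Z = \<epsilon> * norm (ux p)" and "E = \<eta> (u p)"
  have Y2: "Y^2 = \<epsilon>^2 * (norm (ut p))^2" and Z2: "Z^2 = \<epsilon>^2 * (norm (ux p))^2"
    by (simp_all add: Y_def Z_def power_mult_distrib)
  have b: "\<beta> / 2 * N^2 \<le> E" "E \<le> \<alpha> / 4 * N^2" "X^2 \<le> \<alpha> * E"
    using \<eta>_bounds[of "u p"] by (simp_all add: N_def E_def X_def)
  have cs: "\<bar>\<epsilon> * (grad \<eta> (u p) \<bullet> ut p)\<bar> \<le> X * Y"
    using Cauchy_Schwarz_ineq2[of "grad \<eta> (u p)" "ut p"] pos(2)
    by (simp add: X_def Y_def abs_mult mult.left_commute mult_left_mono)
  have A1: "a * (norm (ux p))^2 \<le> ux p \<bullet> (A *v ux p)" by (rule A_pos)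
  have "ux p \<bullet> (A *v ux p) \<le> norm (ux p) * (norm A * norm (ux p))"
    using norm_cauchy_schwarz[of "ux p" "A *v ux p"] norm_matrix_vector_le[of A "ux p"]
    by (meson mult_left_mono norm_ge_zero order_trans)
  then have A2: "ux p \<bullet> (A *v ux p) \<le> norm A * (norm (ux p))^2"
    by (simp add: power2_eq_square mult_ac)
  have "\<alpha> * a / 2 * Z^2 = \<alpha> * \<epsilon>^2 / 2 * (a * (norm (ux p))^2)" by (simp add: Z2)
  also have "\<dots> \<le> \<alpha> * \<epsilon>^2 / 2 * (ux p \<bullet> (A *v ux p))"
    using A1 pos by (intro mult_left_mono) auto
  finally have lo: "\<alpha> * a / 2 * Z^2 \<le> \<alpha> * \<epsilon>^2 / 2 * (ux p \<bullet> (A *v ux p))" .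
  have "\<alpha> * \<epsilon>^2 / 2 * (ux p \<bullet> (A *v ux p)) \<le> \<alpha> * \<epsilon>^2 / 2 * (norm A * (norm (ux p))^2)"
    using A2 pos by (intro mult_left_mono) auto
  also have "\<dots> = \<alpha> / 2 * norm A * Z^2" by (simp add: Z2)
  finally have hi: "\<alpha> * \<epsilon>^2 / 2 * (ux p \<bullet> (A *v ux p)) \<le> \<alpha> / 2 * norm A * Z^2" .
  have ep: "e p = E + \<epsilon> * (grad \<eta> (u p) \<bullet> ut p) + \<alpha> * \<epsilon>^2 / 2 * (ux p \<bullet> (A *v ux p)) + \<alpha> / 2 * Y^2"
    by (simp add: e_def E_def Y2 power2_norm_eq_inner)
  \<comment> \<open>The weights 3 and 2 \<alpha> are such that, after X^2 <= \<alpha> E, division by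
    12 \<alpha> gives exactly the shares 3/4 and \<alpha>/3.\<close>
  have "12 * \<alpha> * (X * Y) \<le> 9 * X^2 + 4 * \<alpha>^2 * Y^2"
    using zero_le_power2[of "3 * X - 2 * \<alpha> * Y"] by (simp add: power2_eq_square algebra_simps)
  also have "\<dots> \<le> 12 * \<alpha> * (3 / 4 * E + \<alpha> / 3 * Y^2)"
    using b(3) by (simp add: power2_eq_square algebra_simps)
  finally have XY: "X * Y \<le> 3 / 4 * E + \<alpha> / 3 * Y^2" using pos(3) by simp
  have low: "E / 4 + \<alpha> / 6 * Y^2 + \<alpha> * a / 2 * Z^2 \<le> e p"
    using XY lo cs unfolding ep by (simp add: algebra_simps abs_le_iff)
  then show "\<eta> (u p) / 4 + \<alpha> / 6 * (\<epsilon>^2 * (norm (ut p))^2) + \<alpha> * a / 2 * (\<epsilon>^2 * (norm (ux p))^2) \<le> e p"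
    by (simp add: E_def Y2 Z2)
  have "lower * N^2 \<le> \<beta> / 8 * N^2" "lower * Y^2 \<le> \<alpha> / 6 * Y^2"
    "lower * Z^2 \<le> \<alpha> * a / 2 * Z^2"
    by (intro mult_right_mono; simp add: energy_lower_def)+
  moreover have "lower * dens p = lower * N^2 + lower * Y^2 + lower * Z^2"
    by (simp add: dens_def N_def Y2 Z2 algebra_simps)
  ultimately show "lower * dens p \<le> e p" using low b(1) by linarith
  have "X * Y \<le> X^2 / 2 + Y^2 / 2"
    using zero_le_power2[of "X - Y"] by (simp add: power2_eq_square algebra_simps)
  moreover have "\<alpha> * E \<le> \<alpha>^2 / 4 * N^2"
    using mult_left_mono[OF b(2), of \<alpha>] pos(3) by (simp add: power2_eq_square)
  ultimately have "e p \<le> (\<alpha> / 4 + \<alpha>^2 / 8) * N^2 + \<alpha> / 2 * norm A * Z^2 + (1 / 2 + \<alpha> / 2) * Y^2"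
    using b(2,3) cs hi unfolding ep by (simp add: algebra_simps abs_le_iff)
  also have "\<dots> \<le> upper * N^2 + upper * Z^2 + upper * Y^2"
  proof -
    have "0 \<le> \<alpha> / 2 * norm A" "0 \<le> \<alpha>^2 / 8" using pos(3) by auto
    then have "\<alpha> / 4 + \<alpha>^2 / 8 \<le> upper" "\<alpha> / 2 * norm A \<le> upper"
      "1 / 2 + \<alpha> / 2 \<le> upper"
      using pos(3) unfolding energy_upper_def by linarith+
    then show ?thesis by (intro add_mono mult_right_mono) auto
  qed
  also have "\<dots> = upper * dens p"
    by (simp add: dens_def N_def Y2 Z2 algebra_simps)
  finally show "e p \<le> upper * dens p" .
qed

text \<open>The source goes into \<open>rate * e p\<close>. In the quadratic part the Hessian takes
  at most \<alpha>/2 of \<alpha> |u_t|^2, the mixed term another \<alpha>/4, and the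
  subcharacteristic condition pays for \<alpha> |DF u_x|^2; what survives is
  \<open>diss\<close>.\<close>

lemma dissipation_le:
  assumes "p \<in> UNIV \<times> {0..T}"
  shows "et p - fluxx p \<le> rate * e p - \<epsilon> * diss p"
proof -
  define X N Y E where "X = norm (grad \<eta> (u p))" and "N = norm (u p)" and "Y = \<epsilon> * norm (ut p)"
    and "E = \<eta> (u p)"
  have Y2: "Y^2 = \<epsilon>^2 * (norm (ut p))^2" by (simp add: Y_def power_mult_distrib)
  have b: "\<beta> / 2 * N^2 \<le> E" "E \<le> \<alpha> / 4 * N^2" "X^2 \<le> \<alpha> * E" "0 \<le> E"
    using \<eta>_bounds[of "u p"] \<eta>_nonneg[of "u p"] by (simp_all add: N_def E_def X_def)
  have "0 \<le> \<alpha> * a / 2 * (\<epsilon>^2 * (norm (ux p))^2)" using pos by simp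
  then have low: "E / 4 + \<alpha> / 6 * Y^2 \<le> e p"
    using energy_pointwise(1)[OF assms] by (simp add: E_def Y2)
  have "(grad \<eta> (u p) + (\<alpha> * \<epsilon>) *\<^sub>R ut p) \<bullet> G (u p) \<le> norm (grad \<eta> (u p) + (\<alpha> * \<epsilon>) *\<^sub>R ut p) * norm (G (u p))"
    by (rule norm_cauchy_schwarz)
  also have "\<dots> \<le> (X + \<alpha> * Y) * (L * N)"
    using norm_triangle_ineq[of "grad \<eta> (u p)" "(\<alpha> * \<epsilon>) *\<^sub>R ut p"] G_le[of "u p"] pos
    by (intro mult_mono) (auto simp: X_def Y_def N_def mult.assoc)
  also have "\<dots> = L * (X * N + \<alpha> * (Y * N))" by (simp add: algebra_simps)
  also have "\<dots> \<le> L * ((X^2 + N^2) / 2 + \<alpha> * ((Y^2 + N^2) / 2))"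
    using zero_le_power2[of "X - N"] zero_le_power2[of "Y - N"] pos
    by (intro mult_left_mono add_mono) (auto simp: power2_eq_square algebra_simps)
  also have "\<dots> \<le> L * ((\<alpha> * (4 * e p) + 2 / \<beta> * (4 * e p)) / 2 + \<alpha> * ((6 / \<alpha> * e p + 2 / \<beta> * (4 * e p)) / 2))"
  proof -
    have "0 \<le> \<alpha> / 6 * Y^2" using pos(3) by simp
    then have "E \<le> 4 * e p" "\<alpha> / 6 * Y^2 \<le> e p"
      using low b(4) by linarith+
    moreover have "Y^2 \<le> 6 / \<alpha> * e p"
      using calculation(2) pos(3) by (simp add: field_simps)
    moreover have "N^2 \<le> 2 / \<beta> * E" using b(1) pos(4) by (simp add: field_simps)
    moreover have "\<alpha> * E \<le> \<alpha> * (4 * e p)" "2 / \<beta> * E \<le> 2 / \<beta> * (4 * e p)"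
      using calculation(1) pos by (intro mult_left_mono; simp)+
    ultimately have le: "X^2 \<le> \<alpha> * (4 * e p)" "N^2 \<le> 2 / \<beta> * (4 * e p)" "Y^2 \<le> 6 / \<alpha> * e p"
      using b(3) by linarith+
    show ?thesis
      using pos by (intro mult_left_mono add_mono divide_right_mono le) auto
  qed
  also have "\<dots> = rate * e p"
    using pos by (simp add: growth_rate_def field_simps)
  finally have source: "(grad \<eta> (u p) + (\<alpha> * \<epsilon>) *\<^sub>R ut p) \<bullet> G (u p) \<le> rate * e p" .
  have "(hess \<eta> (u p) *v ut p) \<bullet> ut p \<le> \<alpha> / 2 * (norm (ut p))^2"
    using hess_hi[of "ut p" "u p"] by (simp add: inner_commute power2_norm_eq_inner)
  moreover have "\<nu> * (norm (ux p))^2 + \<alpha> * (norm (jac F (u p) *v ux p))^2 \<le> (hess \<eta> (u p) *v ux p) \<bullet> (A *v ux p)"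
    using subchar[of "ux p" "u p"] by (simp add: inner_commute)
  \<comment> \<open>\<alpha> times the square of u_t / 2 + DF u_x.\<close>
  moreover have "0 \<le> \<alpha> / 4 * (norm (ut p))^2 + \<alpha> * (ut p \<bullet> (jac F (u p) *v ux p)) + \<alpha> * (norm (jac F (u p) *v ux p))^2"
  proof -
    have "0 \<le> \<alpha> * (((1/2) *\<^sub>R ut p + jac F (u p) *v ux p) \<bullet> ((1/2) *\<^sub>R ut p + jac F (u p) *v ux p))"
      using pos by simp
    then show ?thesis by (simp add: inner_add_left inner_add_right inner_commute power2_norm_eq_inner algebra_simps)
  qed
  ultimately have "diss p \<le> \<alpha> * (norm (ut p))^2 + \<alpha> * (ut p \<bullet> (jac F (u p) *v ux p))
        - (hess \<eta> (u p) *v ut p) \<bullet> ut p + (hess \<eta> (u p) *v ux p) \<bullet> (A *v ux p)"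
    unfolding diss_def by (simp add: algebra_simps)
  then have "\<epsilon> * diss p \<le> \<epsilon> * (\<alpha> * (norm (ut p))^2 + \<alpha> * (ut p \<bullet> (jac F (u p) *v ux p))
        - (hess \<eta> (u p) *v ut p) \<bullet> ut p + (hess \<eta> (u p) *v ux p) \<bullet> (A *v ux p))"
    using pos(2) by (intro mult_left_mono) auto
  with source show ?thesis unfolding energy_identity[OF assms] by linarith
qed

end

section \<open>From the intervals [-R, R] to the whole line\<close>

lemma le_by_small_add:
  fixes x y z :: real
  assumes "\<And>\<delta>. 0 < \<delta> \<Longrightarrow> x \<le> y + \<delta> * z" "0 \<le> z"
  shows "x \<le> y"
proof (rule field_le_epsilon)
  fix r :: real assume "0 < r"
  \<comment> \<open>The choice \<delta> = r / (z + 1), where the 1 takes care of z = 0.\<close>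
  then have "x \<le> y + r / (z + 1) * z" using assms by (intro assms(1)) (simp add: divide_pos_pos)
  also have "r / (z + 1) * z \<le> r"
    using \<open>0 < r\<close> assms(2) by (simp add: field_simps)
  finally show "x \<le> y + r" by simp
qed

lemma integral_inverse_one_plus_square_le:
  "integral {-R..R} (\<lambda>x::real. inverse (1 + x^2)) \<le> pi"
proof (cases "0 \<le> R")
  case True
  have "((\<lambda>x. inverse (1 + x^2)) has_integral (arctan R - arctan (-R))) {-R..R}"
    using True
    by (intro fundamental_theorem_of_calculus)
      (auto simp flip: has_real_derivative_iff_has_vector_derivative intro!: derivative_eq_intros)
  then have "integral {-R..R} (\<lambda>x::real. inverse (1 + x^2)) = arctan R - arctan (-R)"
    by (rule integral_unique)
  also have "\<dots> \<le> pi" using arctan_ubound[of R] by (simp add: arctan_minus)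
  finally show ?thesis .
qed simp

context relaxation
begin

lemma growth_rate_nonneg: "0 \<le> rate"
  using pos by (simp add: growth_rate_def)

lemma energy_lower_pos: "0 < lower"
  using pos by (simp add: energy_lower_def)

lemmas energy_upper_pos = energy_upper_positive[OF pos(3), of A]

lemma dens_nonneg: "0 \<le> dens p"
  by (simp add: dens_def)

lemma diss_nonneg: "0 \<le> diss p"
  using pos by (simp add: diss_def)

lemma e_nonneg: "p \<in> UNIV \<times> {0..T} \<Longrightarrow> 0 \<le> e p"
  using energy_pointwise(2)[of p] energy_lower_pos dens_nonneg[of p]
  by (meson less_imp_le mult_nonneg_nonneg order_trans)

text \<open>\<open>flux\<close> is a continuous function \<open>\<Phi>\<close> of (u, u_x, u_t), and
  these tend to 0 uniformly in t. The flux itself tends to -q(0), which need not vanish, but this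
  constant cancels between R and -R.\<close>

lemma flux_small:
  assumes "0 < \<delta>"
  obtains R0 where "\<And>R t. R0 \<le> R \<Longrightarrow> t \<in> {0..T} \<Longrightarrow> flux (R, t) - flux (-R, t) \<le> \<delta>"
proof -
  define \<Phi> where "\<Phi> w = - q (fst w) + \<epsilon> * (grad \<eta> (fst w) \<bullet> (A *v fst (snd w))) + \<alpha> * \<epsilon>^2 * (snd (snd w) \<bullet> (A *v fst (snd w)))"
    for w :: "(real^'n) \<times> (real^'n) \<times> (real^'n)"
  have "continuous_on UNIV \<Phi>"
    unfolding \<Phi>_def
    by (intro continuous_intros continuous_on_compose2[OF continuous_on_C1_scalar[OF C1q, of UNIV]]
      continuous_on_compose2[OF continuous_on_grad[OF entropy_C(2), of UNIV]]) auto
  then have "\<exists>r>0. \<forall>w. dist w 0 < r \<longrightarrow> dist (\<Phi> w) (\<Phi> 0) < \<delta> / 2"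
    using assms unfolding continuous_on_iff by (metis UNIV_I half_gt_zero)
  then obtain r where r: "0 < r" "\<And>w. norm w < r \<Longrightarrow> \<bar>\<Phi> w - \<Phi> 0\<bar> < \<delta> / 2"
    by (auto simp: dist_real_def)
  obtain K where K: "\<And>p. p \<in> UNIV \<times> {0..T} \<Longrightarrow> (1 + \<bar>fst p\<bar>) * (norm (u p) + norm (ux p) + norm (ut p)) \<le> K"
    using decay by blast
  \<comment> \<open>From |x| = |K| / r on, the decay bound gives (1 + |x|) times the norm <= |K| <=
    |x| r, which is less than (1 + |x|) r.\<close>
  have small: "\<bar>flux (x, t) - \<Phi> 0\<bar> < \<delta> / 2" if "\<bar>K\<bar> / r \<le> \<bar>x\<bar>" "t \<in> {0..T}" for x t
  proof -
    let ?w = "(u (x, t), ux (x, t), ut (x, t))"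
    have "norm ?w \<le> norm (u (x, t)) + norm (ux (x, t)) + norm (ut (x, t))"
      using norm_Pair_le[of "u (x, t)" "(ux (x, t), ut (x, t))"] norm_Pair_le[of "ux (x, t)" "ut (x, t)"] by linarith
    then have "(1 + \<bar>x\<bar>) * norm ?w \<le> (1 + \<bar>x\<bar>) * (norm (u (x, t)) + norm (ux (x, t)) + norm (ut (x, t)))"
      by (intro mult_left_mono) auto
    also have "\<dots> \<le> \<bar>K\<bar>" using K[of "(x, t)"] that by simp
    also have "\<dots> \<le> \<bar>x\<bar> * r" using that r(1) by (simp add: field_simps)
    also have "\<dots> < (1 + \<bar>x\<bar>) * r" using r(1) by (simp add: algebra_simps)
    finally have "norm ?w < r" by (simp add: mult_less_cancel_left)
    from r(2)[OF this] show ?thesis by (simp add: \<Phi>_def flux_def)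
  qed
  show thesis
  proof (rule that[of "\<bar>K\<bar> / r"])
    fix R t assume "\<bar>K\<bar> / r \<le> R" "t \<in> {0..T}"
    then have "\<bar>K\<bar> / r \<le> \<bar>R\<bar>" "\<bar>K\<bar> / r \<le> \<bar>-R\<bar>" by auto
    from small[OF this(1) \<open>t \<in> {0..T}\<close>] small[OF this(2) \<open>t \<in> {0..T}\<close>]
    show "flux (R, t) - flux (-R, t) \<le> \<delta>" by linarith
  qed
qed

lemma cont_slice:
  "t \<in> {0..T} \<Longrightarrow> continuous_on (UNIV \<times> {0..T}) f \<Longrightarrow> continuous_on X (\<lambda>x. f (x, t))"
  using continuous_on_slice_x continuous_on_subset by blast

lemma cont_rect: "continuous_on (UNIV \<times> {0..T}) f \<Longrightarrow> continuous_on (X \<times> {0..T}) f"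
  by (erule continuous_on_subset) auto

lemma local_energy_derivative:
  assumes "t \<in> {0..T}"
  shows "((\<lambda>t. integral {-R..R} (\<lambda>x. e (x, t))) has_vector_derivative
    integral {-R..R} (\<lambda>x. et (x, t))) (at t within {0..T})"
  using assms continuous_on_swap_args[OF cont_rect[OF cont_energy(2), of "{-R..R}"]]
  by (intro leibniz_rule_vector_derivative[where fx="\<lambda>t x. et (x, t)", unfolded cbox_interval])
    (auto intro!: integrable_continuous_interval cont_slice cont_energy energy_dt)

lemma local_energy_rate:
  assumes t: "t \<in> {0..T}" and "0 \<le> R" and \<delta>: "flux (R, t) - flux (-R, t) \<le> \<delta>"
  shows "integral {-R..R} (\<lambda>x. et (x, t)) \<le> rate * integral {-R..R} (\<lambda>x. e (x, t)) + \<delta>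
    - \<epsilon> * integral {-R..R} (\<lambda>x. diss (x, t))"
proof -
  note int = integrable_continuous_interval[OF cont_slice[OF t]]
  have fl: "((\<lambda>x. fluxx (x, t)) has_integral (flux (R, t) - flux (-R, t))) {-R..R}"
    using \<open>0 \<le> R\<close> by (intro fundamental_theorem_of_calculus flux_dx t) auto
  have "((\<lambda>x. et (x, t)) has_integral integral {-R..R} (\<lambda>x. et (x, t))) {-R..R}"
    by (intro integrable_integral int cont_energy)
  moreover have "((\<lambda>x. rate * e (x, t) + fluxx (x, t) - \<epsilon> * diss (x, t)) has_integral
      (rate * integral {-R..R} (\<lambda>x. e (x, t)) + (flux (R, t) - flux (-R, t))
        - \<epsilon> * integral {-R..R} (\<lambda>x. diss (x, t)))) {-R..R}"
    by (intro has_integral_add has_integral_diff has_integral_mult_right fl integrable_integral int cont_energy)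
  ultimately have "integral {-R..R} (\<lambda>x. et (x, t)) \<le> rate * integral {-R..R} (\<lambda>x. e (x, t))
      + (flux (R, t) - flux (-R, t)) - \<epsilon> * integral {-R..R} (\<lambda>x. diss (x, t))"
  proof (rule has_integral_le)
    fix x
    show "et (x, t) \<le> rate * e (x, t) + fluxx (x, t) - \<epsilon> * diss (x, t)"
      using dissipation_le[of "(x, t)"] t by simp
  qed
  with \<delta> show ?thesis by simp
qed

text \<open>For the first bound the dissipation is dropped and Gronwall applies. For the second the
  same rate inequality is integrated over {0..T} with the dissipation kept and the first bound
  inserted; the energy at time T is nonnegative and is dropped.\<close>

lemma local_energy_estimate:
  assumes R: "0 \<le> R" and fl: "\<And>t. t \<in> {0..T} \<Longrightarrow> flux (R, t) - flux (-R, t) \<le> \<delta>" and "0 \<le> \<delta>"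
    and init: "integral {-R..R} (\<lambda>x. e (x, 0)) \<le> M"
  shows "t \<in> {0..T} \<Longrightarrow> integral {-R..R} (\<lambda>x. e (x, t)) \<le> exp (rate * T) * (M + \<delta> * T)"
    and "\<epsilon> * integral (slab R T) diss
      \<le> M + rate * T * exp (rate * T) * (M + \<delta> * T) + \<delta> * T"
proof -
  define g where "g t = integral {-R..R} (\<lambda>x. e (x, t))" for t
  define d where "d t = integral {-R..R} (\<lambda>x. diss (x, t))" for t
  have gn: "0 \<le> g t" if "t \<in> {0..T}" for t
    unfolding g_def using that
    by (intro integral_nonneg integrable_continuous_interval cont_slice cont_energy e_nonneg) auto
  have dn: "0 \<le> d t" if "t \<in> {0..T}" for t
    unfolding d_def using that
    by (intro integral_nonneg integrable_continuous_interval cont_slice cont_energy diss_nonneg) auto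
  have dg: "(g has_vector_derivative integral {-R..R} (\<lambda>x. et (x, t))) (at t within {0..T})" if "t \<in> {0..T}" for t
    unfolding g_def by (rule local_energy_derivative[OF that])
  have rate: "integral {-R..R} (\<lambda>x. et (x, t)) \<le> rate * g t + \<delta> - \<epsilon> * d t" if "t \<in> {0..T}" for t
    unfolding g_def d_def by (rule local_energy_rate[OF that R fl[OF that]])
  have 0: "0 \<in> {0..T}" "T \<in> {0..T}" using pos by auto
  have rate': "integral {-R..R} (\<lambda>x. et (x, t)) \<le> rate * g t + \<delta>" if "t \<in> {0..T}" for t
    using rate[OF that] dn[OF that] pos(2) mult_nonneg_nonneg[of \<epsilon> "d t"] by linarith
  have gle: "g t \<le> exp (rate * T) * (M + \<delta> * T)" if t: "t \<in> {0..T}" for t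
  proof -
    have "g t \<le> exp (rate * T) * (g 0 + \<delta> * T)"
      by (rule gronwall_interval[OF dg rate' growth_rate_nonneg \<open>0 \<le> \<delta>\<close> gn[OF 0(1)] t])
    also have "\<dots> \<le> exp (rate * T) * (M + \<delta> * T)"
      using init by (intro mult_left_mono) (auto simp: g_def)
    finally show ?thesis .
  qed
  show "t \<in> {0..T} \<Longrightarrow> integral {-R..R} (\<lambda>x. e (x, t)) \<le> exp (rate * T) * (M + \<delta> * T)"
    using gle[of t] unfolding g_def .
  have cont: "continuous_on {0..T} d" "continuous_on {0..T} g"
    unfolding d_def g_def
    by (rule continuous_on_integral_x[OF cont_rect[OF cont_energy(5)]],
      rule continuous_on_integral_x[OF cont_rect[OF cont_energy(1)]])
  have "((\<lambda>t. integral {-R..R} (\<lambda>x. et (x, t))) has_integral (g T - g 0)) {0..T}"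
    using pos(1) by (intro fundamental_theorem_of_calculus dg) auto
  moreover have "((\<lambda>t. (rate * (exp (rate * T) * (M + \<delta> * T)) + \<delta>) - \<epsilon> * d t) has_integral
      (T * (rate * (exp (rate * T) * (M + \<delta> * T)) + \<delta>) - \<epsilon> * integral {0..T} d)) {0..T}"
    using has_integral_const_real[of "rate * (exp (rate * T) * (M + \<delta> * T)) + \<delta>" 0 T] pos(1) cont
    by (intro has_integral_diff has_integral_mult_right integrable_integral integrable_continuous_interval) auto
  ultimately have "g T - g 0 \<le> T * (rate * (exp (rate * T) * (M + \<delta> * T)) + \<delta>) - \<epsilon> * integral {0..T} d"
  proof (rule has_integral_le)
    fix t assume t: "t \<in> {0..T}"
    have "rate * g t \<le> rate * (exp (rate * T) * (M + \<delta> * T))"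
      by (intro mult_left_mono gle t growth_rate_nonneg)
    then show "integral {-R..R} (\<lambda>x. et (x, t)) \<le> (rate * (exp (rate * T) * (M + \<delta> * T)) + \<delta>) - \<epsilon> * d t"
      using rate[OF t] by linarith
  qed
  moreover have "integral (slab R T) diss = integral {0..T} d"
    unfolding d_def by (rule integral_rect_tx[OF cont_rect[OF cont_energy(5)]])
  moreover have "g 0 \<le> M" using init by (simp add: g_def)
  ultimately show "\<epsilon> * integral (slab R T) diss
      \<le> M + rate * T * exp (rate * T) * (M + \<delta> * T) + \<delta> * T"
    using gn[OF 0(2)] by (simp add: algebra_simps)
qed

text \<open>A qualitative bound that may depend on the solution and on \<epsilon>: decay makes the
  density O(1 / (1 + x^2)). It secures integrability, so that the Lebesgue integral of the density
  dominates the integrals over intervals.\<close>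

lemma dens_integrals_bounded:
  assumes t: "t \<in> {0..T}"
  obtains M where "\<And>R. integral {-R..R} (\<lambda>x. dens (x, t)) \<le> M"
proof -
  obtain K where K: "\<And>p. p \<in> UNIV \<times> {0..T} \<Longrightarrow> (1 + \<bar>fst p\<bar>) * (norm (u p) + norm (ux p) + norm (ut p)) \<le> K"
    using decay by blast
  let ?M = "(1 + 2 * \<epsilon>^2) * K^2"
  have le: "dens (x, t) \<le> ?M * inverse (1 + x^2)" for x
  proof -
    let ?p = "(x, t)"
    have sq: "(1 + x^2) * z^2 \<le> K^2" if "0 \<le> z" "z \<le> norm (u ?p) + norm (ux ?p) + norm (ut ?p)" for z
    proof -
      have "(1 + x^2) * z^2 \<le> (1 + \<bar>x\<bar>)^2 * z^2"
        by (intro mult_right_mono) (auto simp: power2_sum)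
      also have "\<dots> = ((1 + \<bar>x\<bar>) * z)^2" by (simp add: power_mult_distrib)
      also have "\<dots> \<le> K^2"
      proof (rule power_mono)
        have "(1 + \<bar>x\<bar>) * z \<le> (1 + \<bar>x\<bar>) * (norm (u ?p) + norm (ux ?p) + norm (ut ?p))"
          using that by (intro mult_left_mono) auto
        also have "\<dots> \<le> K" using K[of ?p] t by simp
        finally show "(1 + \<bar>x\<bar>) * z \<le> K" .
      qed (use that in auto)
      finally show ?thesis .
    qed
    have "(1 + x^2) * dens ?p = (1 + x^2) * (norm (u ?p))^2 + \<epsilon>^2 * ((1 + x^2) * (norm (ux ?p))^2)
        + \<epsilon>^2 * ((1 + x^2) * (norm (ut ?p))^2)"
      by (simp add: dens_def algebra_simps)
    also have "\<dots> \<le> K^2 + \<epsilon>^2 * K^2 + \<epsilon>^2 * K^2"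
      by (intro add_mono mult_left_mono sq) auto
    also have "\<dots> = ?M" by (simp add: algebra_simps)
    finally show ?thesis
      by (simp add: field_simps add_pos_nonneg)
  qed
  show thesis
  proof (rule that)
    fix R :: real
    have "continuous_on {-R..R} (\<lambda>x. inverse (1 + x^2))"
      by (intro continuous_intros) (auto simp: add_nonneg_eq_0_iff)
    then have "integral {-R..R} (\<lambda>x. dens (x, t)) \<le> integral {-R..R} (\<lambda>x. ?M * inverse (1 + x^2))"
      by (intro integral_le integrable_continuous_interval cont_slice[OF t] cont_energy continuous_on_mult_left le)
    also have "\<dots> \<le> ?M * pi"
      using integral_inverse_one_plus_square_le[of R] by (simp add: mult_left_mono)
    finally show "integral {-R..R} (\<lambda>x. dens (x, t)) \<le> ?M * pi" .
  qed
qed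

lemma integral_dens_le:
  assumes t: "t \<in> {0..T}"
  shows "integral {-R..R} (\<lambda>x. dens (x, t)) \<le> (LINT x|lborel. dens (x, t))"
proof -
  obtain M where "\<And>R. integral {-R..R} (\<lambda>x. dens (x, t)) \<le> M" using dens_integrals_bounded[OF t] by blast
  then show ?thesis
    by (intro real_line_integral(3)[OF cont_slice[OF t cont_energy(4)] dens_nonneg])
qed

lemma initial_energy_le:
  "integral {-R..R} (\<lambda>x. e (x, 0)) \<le> upper * E0"
proof -
  have 0: "0 \<in> {0..T}" using pos by simp
  have "integral {-R..R} (\<lambda>x. e (x, 0)) \<le> integral {-R..R} (\<lambda>x. upper * dens (x, 0))"
    using energy_pointwise(3) 0
    by (intro integral_le integrable_continuous_interval continuous_on_mult_left cont_slice[OF 0] cont_energy) auto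
  also have "\<dots> \<le> upper * E0"
    using integral_dens_le[OF 0] energy_upper_pos by simp
  finally show ?thesis .
qed

text \<open>The local estimate holds with error \<delta> on every interval so long that the boundary
  flux is at most \<delta>. A given interval may be enlarged to such a one because the density is
  nonnegative, and \<delta> is arbitrary.\<close>

lemma stability:
  assumes t: "t \<in> {0..T}"
  shows "lower * (LINT x|lborel. dens (x, t))
    \<le> exp (rate * T) * upper * E0"
proof -
  let ?e0 = "upper * E0"
  have main: "lower * integral {-R..R} (\<lambda>x. dens (x, t)) \<le> exp (rate * T) * ?e0" for R
  proof (rule le_by_small_add)
    fix \<delta> :: real assume \<delta>: "0 < \<delta>"
    obtain R0 where R0: "\<And>R t. R0 \<le> R \<Longrightarrow> t \<in> {0..T} \<Longrightarrow> flux (R, t) - flux (-R, t) \<le> \<delta>"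
      using flux_small[OF \<delta>] by blast
    define R' where "R' = max 0 (max R R0)"
    have R': "0 \<le> R'" "R \<le> R'" "R0 \<le> R'" by (auto simp: R'_def)
    have "lower * integral {-R..R} (\<lambda>x. dens (x, t))
        \<le> lower * integral {-R'..R'} (\<lambda>x. dens (x, t))"
      using energy_lower_pos R'(2)
      by (intro mult_left_mono integral_subset_le integrable_continuous_interval cont_slice[OF t] cont_energy)
        (auto simp: dens_nonneg)
    also have "\<dots> = integral {-R'..R'} (\<lambda>x. lower * dens (x, t))" by simp
    also have "\<dots> \<le> integral {-R'..R'} (\<lambda>x. e (x, t))"
      using energy_pointwise(2) t
      by (intro integral_le integrable_continuous_interval continuous_on_mult_left cont_slice[OF t] cont_energy) auto
    also have "\<dots> \<le> exp (rate * T) * (?e0 + \<delta> * T)"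
      using R0[OF R'(3)] \<delta> by (intro local_energy_estimate(1) R'(1) initial_energy_le t) auto
    finally show "lower * integral {-R..R} (\<lambda>x. dens (x, t))
        \<le> exp (rate * T) * ?e0 + \<delta> * (T * exp (rate * T))"
      by (simp add: algebra_simps)
  qed (use pos in simp)
  have "(LINT x|lborel. dens (x, t)) \<le> exp (rate * T) * ?e0 / lower"
  proof (rule real_line_integral(2)[OF cont_slice[OF t cont_energy(4)] dens_nonneg])
    show "integral {-R..R} (\<lambda>x. dens (x, t)) \<le> exp (rate * T) * ?e0 / lower" for R
      using main[of R] energy_lower_pos by (simp add: field_simps)
  qed
  then show ?thesis
    using energy_lower_pos by (simp add: field_simps)
qed

lemma total_dissipation:
  "\<epsilon> * integral (slab R T) diss
    \<le> upper * E0 * (1 + rate * T * exp (rate * T))"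
proof -
  let ?e0 = "upper * E0"
  show ?thesis
  proof (rule le_by_small_add)
    fix \<delta> :: real assume \<delta>: "0 < \<delta>"
    obtain R0 where R0: "\<And>R t. R0 \<le> R \<Longrightarrow> t \<in> {0..T} \<Longrightarrow> flux (R, t) - flux (-R, t) \<le> \<delta>"
      using flux_small[OF \<delta>] by blast
    define R' where "R' = max 0 (max R R0)"
    have R': "0 \<le> R'" "R \<le> R'" "R0 \<le> R'" by (auto simp: R'_def)
    have "\<epsilon> * integral (slab R T) diss \<le> \<epsilon> * integral ({-R'..R'} \<times> {0..T}) diss"
      using R'(2) pos(2)
      by (intro mult_left_mono integral_subset_le rect_integrable cont_rect[OF cont_energy(5)])
        (auto simp: diss_nonneg)
    also have "\<dots> \<le> ?e0 + rate * T * exp (rate * T) * (?e0 + \<delta> * T) + \<delta> * T"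
      using R0[OF R'(3)] \<delta> by (intro local_energy_estimate(2) R'(1) initial_energy_le) auto
    finally show "\<epsilon> * integral (slab R T) diss
        \<le> ?e0 * (1 + rate * T * exp (rate * T)) + \<delta> * (T + T * (rate * T * exp (rate * T)))"
      by (simp add: algebra_simps)
  qed (use pos growth_rate_nonneg in simp)
qed

lemma total_energy:
  assumes "0 \<le> R"
  shows "lower * integral (slab R T) dens
    \<le> T * (exp (rate * T) * upper * E0)"
proof -
  let ?M = "exp (rate * T) * upper * E0"
  have "lower * integral (slab R T) dens
      = integral {0..T} (\<lambda>t. lower * integral {-R..R} (\<lambda>x. dens (x, t)))"
    by (simp add: integral_rect_tx[OF cont_rect[OF cont_energy(4)]])
  also have "\<dots> \<le> integral {0..T} (\<lambda>t. ?M)"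
  proof (intro integral_le integrable_continuous_interval continuous_on_mult_left 
      continuous_on_integral_x[OF cont_rect[OF cont_energy(4)]] continuous_on_const)
    fix t assume t: "t \<in> {0..T}"
    show "lower * integral {-R..R} (\<lambda>x. dens (x, t)) \<le> ?M"
      using mult_left_mono[OF integral_dens_le[OF t, of R], of "lower"] stability[OF t] energy_lower_pos
      by linarith
  qed
  also have "\<dots> = T * ?M" using pos(1) by simp
  finally show ?thesis .
qed

end

section \<open>Entropy production\<close>

lemma integral_dx_zero:
  fixes g gx :: "real \<times> real \<Rightarrow> real"
  assumes "a \<le> b" and cont: "continuous_on (rect a b c d) gx"
    and d: "\<And>x t. x \<in> {a..b} \<Longrightarrow> t \<in> {c..d} \<Longrightarrow> ((\<lambda>y. g (y, t)) has_vector_derivative gx (x, t)) (at x within {a..b})"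
    and z: "\<And>t. t \<in> {c..d} \<Longrightarrow> g (a, t) = 0 \<and> g (b, t) = 0"
  shows "integral (rect a b c d) gx = 0"
proof -
  have "integral {a..b} (\<lambda>x. gx (x, t)) = 0" if t: "t \<in> {c..d}" for t
    using fundamental_theorem_of_calculus[OF \<open>a \<le> b\<close> d[OF _ t]] z[OF t]
    by (auto simp: integral_unique)
  then have "integral {c..d} (\<lambda>t. integral {a..b} (\<lambda>x. gx (x, t))) = integral {c..d} (\<lambda>t. 0)"
    by (rule integral_cong)
  then show ?thesis by (simp add: integral_rect_tx[OF cont])
qed

lemma integral_dt_zero:
  fixes g gt :: "real \<times> real \<Rightarrow> real"
  assumes "c \<le> d" and cont: "continuous_on (rect a b c d) gt"
    and d: "\<And>x t. x \<in> {a..b} \<Longrightarrow> t \<in> {c..d} \<Longrightarrow> ((\<lambda>s. g (x, s)) has_vector_derivative gt (x, t)) (at t within {c..d})"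
    and z: "\<And>x. x \<in> {a..b} \<Longrightarrow> g (x, c) = 0 \<and> g (x, d) = 0"
  shows "integral (rect a b c d) gt = 0"
proof -
  have "integral {c..d} (\<lambda>t. gt (x, t)) = 0" if x: "x \<in> {a..b}" for x
    using fundamental_theorem_of_calculus[OF \<open>c \<le> d\<close> d[OF x]] z[OF x]
    by (auto simp: integral_unique)
  then have "integral {a..b} (\<lambda>x. integral {c..d} (\<lambda>t. gt (x, t))) = integral {a..b} (\<lambda>x. 0)"
    by (rule integral_cong)
  then show ?thesis by (simp add: integral_rect_xt[OF cont])
qed

text \<open>What integration by parts over the slab needs of a test function. The class is closed
  under \<phi> -> s arctan (\<phi>/s), with explicit derivatives, so no higher derivatives of the
  truncation have to be constructed.\<close>

definition C1_vanishing ::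
    "real \<Rightarrow> real \<Rightarrow> (real \<times> real \<Rightarrow> real) \<Rightarrow> (real \<times> real \<Rightarrow> real) \<Rightarrow> (real \<times> real \<Rightarrow> real) \<Rightarrow> bool" where
  "C1_vanishing R T \<psi> \<psi>x \<psi>t \<longleftrightarrow> has_partials {-R..R} {0..T} \<psi> \<psi>x \<psi>t \<and>
     (\<forall>t\<in>{0..T}. \<psi> (-R, t) = 0 \<and> \<psi> (R, t) = 0) \<and> (\<forall>x\<in>{-R..R}. \<psi> (x, 0) = 0 \<and> \<psi> (x, T) = 0)"

lemma C1_vanishingD:
  assumes "C1_vanishing R T \<psi> \<psi>x \<psi>t"
  shows "has_partials {-R..R} {0..T} \<psi> \<psi>x \<psi>t"
    "continuous_on (slab R T) \<psi>" "continuous_on (slab R T) \<psi>x"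
    "continuous_on (slab R T) \<psi>t"
  using assms has_partialsD(1-3) by (auto simp: C1_vanishing_def)

lemma C1_vanishing_diff:
  assumes "C1_vanishing R T f fx ft" "C1_vanishing R T g gx gt"
  shows "C1_vanishing R T (\<lambda>p. f p - g p) (\<lambda>p. fx p - gx p) (\<lambda>p. ft p - gt p)"
  using assms by (auto simp: C1_vanishing_def intro: has_partials_diff)

lemma integration_by_parts_x:
  fixes f fx :: "real \<times> real \<Rightarrow> real"
  assumes "0 \<le> R" and \<psi>: "C1_vanishing R T \<psi> \<psi>x \<psi>t"
    and f: "continuous_on (slab R T) f" "continuous_on (slab R T) fx"
    and d: "\<And>x t. x \<in> {-R..R} \<Longrightarrow> t \<in> {0..T} \<Longrightarrow> ((\<lambda>y. f (y, t)) has_vector_derivative fx (x, t)) (at x within {-R..R})"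
  shows "integral (slab R T) (\<lambda>p. fx p * \<psi> p) = - integral (slab R T) (\<lambda>p. f p * \<psi>x p)"
proof -
  note c = C1_vanishingD(2-)[OF \<psi>]
  have "integral (slab R T) (\<lambda>p. f p * \<psi>x p + fx p * \<psi> p) = 0"
  proof (rule integral_dx_zero[where g="\<lambda>p. f p * \<psi> p"])
    show "continuous_on (slab R T) (\<lambda>p. f p * \<psi>x p + fx p * \<psi> p)"
      by (intro continuous_intros c f)
    show "((\<lambda>y. f (y, t) * \<psi> (y, t)) has_vector_derivative f (x, t) * \<psi>x (x, t) + fx (x, t) * \<psi> (x, t)) (at x within {-R..R})"
      if "x \<in> {-R..R}" "t \<in> {0..T}" for x t
      by (intro has_vector_derivative_mult d that has_partialsD(4)[OF C1_vanishingD(1)[OF \<psi>]])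
  qed (use assms(1) \<psi> in \<open>auto simp: C1_vanishing_def\<close>)
  moreover have "integral (slab R T) (\<lambda>p. f p * \<psi>x p + fx p * \<psi> p)
    = integral (slab R T) (\<lambda>p. f p * \<psi>x p) + integral (slab R T) (\<lambda>p. fx p * \<psi> p)"
    by (intro integral_add rect_integrable continuous_intros c f)
  ultimately show ?thesis by simp
qed

lemma integration_by_parts_t:
  fixes f ft :: "real \<times> real \<Rightarrow> real"
  assumes "0 \<le> T" and \<psi>: "C1_vanishing R T \<psi> \<psi>x \<psi>t"
    and f: "continuous_on (slab R T) f" "continuous_on (slab R T) ft"
    and d: "\<And>x t. x \<in> {-R..R} \<Longrightarrow> t \<in> {0..T} \<Longrightarrow> ((\<lambda>s. f (x, s)) has_vector_derivative ft (x, t)) (at t within {0..T})"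
  shows "integral (slab R T) (\<lambda>p. ft p * \<psi> p) = - integral (slab R T) (\<lambda>p. f p * \<psi>t p)"
proof -
  note c = C1_vanishingD(2-)[OF \<psi>]
  have "integral (slab R T) (\<lambda>p. f p * \<psi>t p + ft p * \<psi> p) = 0"
  proof (rule integral_dt_zero[where g="\<lambda>p. f p * \<psi> p"])
    show "continuous_on (slab R T) (\<lambda>p. f p * \<psi>t p + ft p * \<psi> p)"
      by (intro continuous_intros c f)
    show "((\<lambda>s. f (x, s) * \<psi> (x, s)) has_vector_derivative f (x, t) * \<psi>t (x, t) + ft (x, t) * \<psi> (x, t)) (at t within {0..T})"
      if "x \<in> {-R..R}" "t \<in> {0..T}" for x t
      by (intro has_vector_derivative_mult d that has_partialsD(5)[OF C1_vanishingD(1)[OF \<psi>]])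
  qed (use assms(1) \<psi> in \<open>auto simp: C1_vanishing_def\<close>)
  moreover have "integral (slab R T) (\<lambda>p. f p * \<psi>t p + ft p * \<psi> p)
    = integral (slab R T) (\<lambda>p. f p * \<psi>t p) + integral (slab R T) (\<lambda>p. ft p * \<psi> p)"
    by (intro integral_add rect_integrable continuous_intros c f)
  ultimately show ?thesis by simp
qed

text \<open>\<open>w p\<close> is the derivative of r -> s arctan (r/s) at r =
  \<open>\<phi> p\<close>. The factor 2 bounds pi/2, and 1 - w = y^2 / (1 + y^2) <= y for y =
  |\<phi>|/s.\<close>

lemma arctan_truncation:
  fixes s :: real
  assumes "0 < s" and \<phi>: "C1_vanishing R T \<phi> \<phi>x \<phi>t"
  defines "w \<equiv> \<lambda>p. inverse (1 + (\<phi> p / s)^2)"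
  shows "C1_vanishing R T (\<lambda>p. s * arctan (\<phi> p / s)) (\<lambda>p. w p * \<phi>x p) (\<lambda>p. w p * \<phi>t p)"
    and "\<bar>s * arctan (\<phi> p / s)\<bar> \<le> \<bar>\<phi> p\<bar>" "\<bar>s * arctan (\<phi> p / s)\<bar> \<le> 2 * s"
    and "0 \<le> w p" "w p \<le> 1" "1 - w p \<le> \<bar>\<phi> p\<bar> / s"
proof -
  note c = C1_vanishingD(2-)[OF \<phi>]
  have nz: "1 + (\<phi> p / s)^2 \<noteq> 0" for p
    using zero_le_power2[of "\<phi> p / s"] by linarith
  have cw: "continuous_on (slab R T) w"
    unfolding w_def using nz assms(1) by (intro continuous_intros c) auto
  have "has_partials {-R..R} {0..T} (\<lambda>p. s * arctan (\<phi> p / s)) (\<lambda>p. w p * \<phi>x p) (\<lambda>p. w p * \<phi>t p)"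
    unfolding has_partials_def
  proof (intro conjI ballI)
    show "continuous_on (slab R T) (\<lambda>p. s * arctan (\<phi> p / s))"
      using assms(1) by (intro continuous_intros c) auto
    fix x t assume xt: "x \<in> {-R..R}" "t \<in> {0..T}"
    show "((\<lambda>y. s * arctan (\<phi> (y, t) / s)) has_vector_derivative w (x, t) * \<phi>x (x, t)) (at x within {-R..R})"
      using has_partialsD(4)[OF C1_vanishingD(1)[OF \<phi>] xt] assms(1)
      unfolding has_real_derivative_iff_has_vector_derivative[symmetric]
      by (auto intro!: derivative_eq_intros simp: w_def)
    show "((\<lambda>y. s * arctan (\<phi> (x, y) / s)) has_vector_derivative w (x, t) * \<phi>t (x, t)) (at t within {0..T})"
      using has_partialsD(5)[OF C1_vanishingD(1)[OF \<phi>] xt] assms(1)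
      unfolding has_real_derivative_iff_has_vector_derivative[symmetric]
      by (auto intro!: derivative_eq_intros simp: w_def)
  qed (intro continuous_intros c cw)+
  then show "C1_vanishing R T (\<lambda>p. s * arctan (\<phi> p / s)) (\<lambda>p. w p * \<phi>x p) (\<lambda>p. w p * \<phi>t p)"
    using \<phi> by (simp add: C1_vanishing_def)
  have "\<bar>arctan (\<phi> p / s)\<bar> \<le> \<bar>\<phi> p / s\<bar>" by (simp add: abs_arctan arctan_le_self)
  then show "\<bar>s * arctan (\<phi> p / s)\<bar> \<le> \<bar>\<phi> p\<bar>" using assms(1) by (simp add: abs_mult field_simps)
  have "\<bar>arctan (\<phi> p / s)\<bar> \<le> 2"
    using arctan_bounded[of "\<phi> p / s"] pi_less_4 by linarith
  then show "\<bar>s * arctan (\<phi> p / s)\<bar> \<le> 2 * s" using assms(1) by (simp add: abs_mult)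
  show "0 \<le> w p" by (simp add: w_def)
  show "w p \<le> 1" by (simp add: w_def inverse_le_1_iff)
  define y where "y = \<bar>\<phi> p\<bar> / s"
  have y: "0 \<le> y" "(\<phi> p / s)^2 = y^2" using assms(1) by (auto simp: y_def power_divide)
  have "y^2 \<le> y * (1 + y^2)"
  proof -
    have "y \<le> 1 + y^2" using zero_le_power2[of "y - 1"] y(1) by (simp add: power2_eq_square algebra_simps)
    then show ?thesis using mult_left_mono[OF _ y(1), of y "1 + y^2"] by (simp add: power2_eq_square)
  qed
  moreover have "0 < 1 + y^2" by (simp add: add_pos_nonneg)
  ultimately show "1 - w p \<le> \<bar>\<phi> p\<bar> / s"
    unfolding w_def y(2) y_def[symmetric] by (simp add: field_simps)
qed

text \<open>\<open>\<eta>'\<close>, \<open>q'\<close> is the bounded pair whose production is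
  studied, as opposed to the strictly convex entropy \<open>\<eta>\<close> behind the energy. R is
  the half-width of a slab, later chosen to contain the supports of the test functions.\<close>

locale relaxation_entropy = relaxation A F G \<eta> q \<alpha> \<beta> \<nu> L T \<epsilon> a u ux ut uxx uxt utt
  for A :: "real^'n^'n" and F G \<eta> q \<alpha> \<beta> \<nu> L T \<epsilon> a u ux ut uxx uxt utt +
  fixes \<eta>' q' :: "real^'n \<Rightarrow> real" and C R :: real
  assumes pair': "entropy_pair F \<eta>' q'" and C_nonneg: "0 \<le> C" and R_nonneg: "0 \<le> R"
    and bounds': "\<And>w. \<bar>\<eta>' w\<bar> \<le> C" "\<And>w. \<bar>q' w\<bar> \<le> C" "\<And>w. norm (grad \<eta>' w) \<le> C" "\<And>w. norm (hess \<eta>' w) \<le> C"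
begin

abbreviation "Q \<equiv> slab R T"

text \<open>The entropy production as a function of the derivatives of the test function alone. It
  can thus be evaluated on truncations and remainders without establishing their membership in
  \<open>test_functions\<close>.\<close>

definition \<Lambda> :: "(real \<times> real \<Rightarrow> real) \<Rightarrow> (real \<times> real \<Rightarrow> real) \<Rightarrow> real" where
  "\<Lambda> \<psi>x \<psi>t = - integral Q (\<lambda>p. \<eta>' (u p) * \<psi>t p + q' (u p) * \<psi>x p)"

lemma entropy_C': "C2_scalar \<eta>'" "C1_scalar \<eta>'" "C1_scalar q'"
  and flux_eq': "grad \<eta>' w \<bullet> (jac F w *v v) = grad q' w \<bullet> v"
  using pair' by (auto simp: entropy_pair_def row_times_matrix_inner[symmetric] C2_scalar_imp_C1)

lemmas cont_Q = cont_u[THEN cont_rect, of "{-R..R}"] cont_of_u[THEN cont_rect, of _ "{-R..R}"]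
  continuous_on_of_u[OF G_cont, THEN cont_rect, of "{-R..R}"]

lemma \<Lambda>_diff:
  assumes "C1_vanishing R T \<phi> \<phi>x \<phi>t" "C1_vanishing R T \<psi> \<psi>x \<psi>t"
  shows "\<Lambda> \<phi>x \<phi>t = \<Lambda> \<psi>x \<psi>t + \<Lambda> (\<lambda>p. \<phi>x p - \<psi>x p) (\<lambda>p. \<phi>t p - \<psi>t p)"
proof -
  note c = C1_vanishingD(2-)[OF assms(1)] C1_vanishingD(2-)[OF assms(2)]
  have "integral Q (\<lambda>p. \<eta>' (u p) * \<phi>t p + q' (u p) * \<phi>x p) =
      integral Q (\<lambda>p. (\<eta>' (u p) * \<psi>t p + q' (u p) * \<psi>x p)
        + (\<eta>' (u p) * (\<phi>t p - \<psi>t p) + q' (u p) * (\<phi>x p - \<psi>x p)))"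
    by (simp add: algebra_simps)
  also have "\<dots> = integral Q (\<lambda>p. \<eta>' (u p) * \<psi>t p + q' (u p) * \<psi>x p)
      + integral Q (\<lambda>p. \<eta>' (u p) * (\<phi>t p - \<psi>t p) + q' (u p) * (\<phi>x p - \<psi>x p))"
    by (intro integral_add rect_integrable continuous_intros c cont_Q entropy_C')
  finally show ?thesis by (simp add: \<Lambda>_def)
qed

lemma \<Lambda>_le_W11:
  assumes "C1_vanishing R T \<psi> \<psi>x \<psi>t"
  shows "\<bar>\<Lambda> \<psi>x \<psi>t\<bar> \<le> C * integral Q (\<lambda>p. \<bar>\<psi>t p\<bar> + \<bar>\<psi>x p\<bar>)"
proof -
  note c = C1_vanishingD(2-)[OF assms]
  have "norm (integral Q (\<lambda>p. \<eta>' (u p) * \<psi>t p + q' (u p) * \<psi>x p)) \<le> integral Q (\<lambda>p. C * (\<bar>\<psi>t p\<bar> + \<bar>\<psi>x p\<bar>))"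
  proof (rule integral_norm_bound_integral)
    show "norm (\<eta>' (u p) * \<psi>t p + q' (u p) * \<psi>x p) \<le> C * (\<bar>\<psi>t p\<bar> + \<bar>\<psi>x p\<bar>)" for p
      using mult_right_mono[OF bounds'(1)[of "u p"], of "\<bar>\<psi>t p\<bar>"] mult_right_mono[OF bounds'(2)[of "u p"], of "\<bar>\<psi>x p\<bar>"]
        abs_triangle_ineq[of "\<eta>' (u p) * \<psi>t p" "q' (u p) * \<psi>x p"]
      by (simp add: abs_mult distrib_left)
  qed (intro rect_integrable continuous_intros c cont_Q entropy_C')+
  then show ?thesis by (simp add: \<Lambda>_def)
qed

lemma \<Lambda>_strong:
  assumes "C1_vanishing R T \<psi> \<psi>x \<psi>t"
  shows "\<Lambda> \<psi>x \<psi>t = integral Q (\<lambda>p. (grad \<eta>' (u p) \<bullet> ut p + grad q' (u p) \<bullet> ux p) * \<psi> p)"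
proof -
  note c = C1_vanishingD(2-)[OF assms]
  have 1: "integral Q (\<lambda>p. (grad \<eta>' (u p) \<bullet> ut p) * \<psi> p) = - integral Q (\<lambda>p. \<eta>' (u p) * \<psi>t p)"
    using pos(1)
    by (intro integration_by_parts_t[OF _ assms] continuous_intros cont_Q entropy_C'
        has_vector_derivative_chain_at[OF grad_has_derivative[OF entropy_C'(2)]] has_partialsD(5)[OF u]) auto
  have 2: "integral Q (\<lambda>p. (grad q' (u p) \<bullet> ux p) * \<psi> p) = - integral Q (\<lambda>p. q' (u p) * \<psi>x p)"
    using R_nonneg
    by (intro integration_by_parts_x[OF _ assms] continuous_intros cont_Q entropy_C'
        has_vector_derivative_chain_at[OF grad_has_derivative[OF entropy_C'(3)]]
        has_partialsD(4)[OF u, THEN has_vector_derivative_at_within]) auto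
  have "integral Q (\<lambda>p. (grad \<eta>' (u p) \<bullet> ut p + grad q' (u p) \<bullet> ux p) * \<psi> p)
    = integral Q (\<lambda>p. (grad \<eta>' (u p) \<bullet> ut p) * \<psi> p) + integral Q (\<lambda>p. (grad q' (u p) \<bullet> ux p) * \<psi> p)"
    unfolding distrib_right
    by (intro integral_add rect_integrable continuous_intros c cont_Q entropy_C')
  moreover have "integral Q (\<lambda>p. \<eta>' (u p) * \<psi>t p + q' (u p) * \<psi>x p)
     = integral Q (\<lambda>p. \<eta>' (u p) * \<psi>t p) + integral Q (\<lambda>p. q' (u p) * \<psi>x p)"
    by (intro integral_add rect_integrable continuous_intros c cont_Q entropy_C')
  ultimately show ?thesis using 1 2 by (simp add: \<Lambda>_def)
qed

text \<open>In the strong form the equation replaces u_t + F(u)_x by G(u) + \<epsilon> (A u_xx -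
  u_tt). The second derivatives, for which no uniform bound is at hand, are integrated by parts:
  they leave first derivatives of u against \<psi>x and \<psi>t, and the quadratic terms with D^2
  \<eta>'.\<close>

lemma \<Lambda>_dissipative:
  assumes "C1_vanishing R T \<psi> \<psi>x \<psi>t"
  shows "\<Lambda> \<psi>x \<psi>t = integral Q (\<lambda>p. (grad \<eta>' (u p) \<bullet> G (u p)) * \<psi> p
    - \<epsilon> * ((grad \<eta>' (u p) \<bullet> (A *v ux p)) * \<psi>x p - (grad \<eta>' (u p) \<bullet> ut p) * \<psi>t p)
    - \<epsilon> * (((hess \<eta>' (u p) *v ux p) \<bullet> (A *v ux p) - (hess \<eta>' (u p) *v ut p) \<bullet> ut p) * \<psi> p))"
proof -
  note c = C1_vanishingD(2-)[OF assms]
  note I = rect_integrable integrable_integral continuous_intros c cont_Q entropy_C'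
  have 1: "integral Q (\<lambda>p. (grad \<eta>' (u p) \<bullet> (A *v uxx p) + (hess \<eta>' (u p) *v ux p) \<bullet> (A *v ux p)) * \<psi> p)
      = - integral Q (\<lambda>p. (grad \<eta>' (u p) \<bullet> (A *v ux p)) * \<psi>x p)"
    using R_nonneg
    by (intro integration_by_parts_x[OF _ assms] continuous_intros cont_Q entropy_C'
        has_vector_derivative_inner has_vector_derivative_matrix
        has_vector_derivative_chain_at[OF hess_has_derivative[OF entropy_C'(1)]]
        has_partialsD(4)[OF u, THEN has_vector_derivative_at_within]
        has_partialsD(4)[OF ux, THEN has_vector_derivative_at_within]) auto
  have 2: "integral Q (\<lambda>p. (grad \<eta>' (u p) \<bullet> utt p + (hess \<eta>' (u p) *v ut p) \<bullet> ut p) * \<psi> p)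
      = - integral Q (\<lambda>p. (grad \<eta>' (u p) \<bullet> ut p) * \<psi>t p)"
    using pos(1)
    by (intro integration_by_parts_t[OF _ assms] continuous_intros cont_Q entropy_C'
        has_vector_derivative_inner
        has_vector_derivative_chain_at[OF hess_has_derivative[OF entropy_C'(1)]]
        has_partialsD(5)[OF u] has_partialsD(5)[OF ut]) auto
  have eq: "(grad \<eta>' (u p) \<bullet> ut p + grad q' (u p) \<bullet> ux p) * \<psi> p =
      (grad \<eta>' (u p) \<bullet> G (u p)) * \<psi> p
      + \<epsilon> * ((grad \<eta>' (u p) \<bullet> (A *v uxx p) + (hess \<eta>' (u p) *v ux p) \<bullet> (A *v ux p)) * \<psi> p)
      - \<epsilon> * ((grad \<eta>' (u p) \<bullet> utt p + (hess \<eta>' (u p) *v ut p) \<bullet> ut p) * \<psi> p)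
      - \<epsilon> * (((hess \<eta>' (u p) *v ux p) \<bullet> (A *v ux p) - (hess \<eta>' (u p) *v ut p) \<bullet> ut p) * \<psi> p)"
    if "p \<in> Q" for p
  proof -
    have "grad \<eta>' (u p) \<bullet> ut p + grad q' (u p) \<bullet> ux p = grad \<eta>' (u p) \<bullet> (ut p + jac F (u p) *v ux p)"
      by (simp add: inner_add_right flux_eq')
    also have "\<dots> = grad \<eta>' (u p) \<bullet> G (u p) + \<epsilon> * (grad \<eta>' (u p) \<bullet> (A *v uxx p) - grad \<eta>' (u p) \<bullet> utt p)"
    proof -
      have "p \<in> UNIV \<times> {0..T}" using that by auto
      then show ?thesis by (simp only: eqn) (simp add: inner_add_right inner_diff_right)
    qed
    finally have eq: "grad \<eta>' (u p) \<bullet> ut p + grad q' (u p) \<bullet> ux p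
      = grad \<eta>' (u p) \<bullet> G (u p) + \<epsilon> * (grad \<eta>' (u p) \<bullet> (A *v uxx p) - grad \<eta>' (u p) \<bullet> utt p)" .
    show ?thesis unfolding eq by (simp add: algebra_simps)
  qed
  let ?a = "\<lambda>p. (grad \<eta>' (u p) \<bullet> G (u p)) * \<psi> p"
    and ?b = "\<lambda>p. (grad \<eta>' (u p) \<bullet> (A *v ux p)) * \<psi>x p"
    and ?c = "\<lambda>p. (grad \<eta>' (u p) \<bullet> ut p) * \<psi>t p"
    and ?d = "\<lambda>p. ((hess \<eta>' (u p) *v ux p) \<bullet> (A *v ux p) - (hess \<eta>' (u p) *v ut p) \<bullet> ut p) * \<psi> p"
  have "\<Lambda> \<psi>x \<psi>t = integral Q (\<lambda>p. ?a p
      + \<epsilon> * ((grad \<eta>' (u p) \<bullet> (A *v uxx p) + (hess \<eta>' (u p) *v ux p) \<bullet> (A *v ux p)) * \<psi> p)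
      - \<epsilon> * ((grad \<eta>' (u p) \<bullet> utt p + (hess \<eta>' (u p) *v ut p) \<bullet> ut p) * \<psi> p)
      - \<epsilon> * ?d p)"
    unfolding \<Lambda>_strong[OF assms] by (intro integral_cong eq)
  also have "\<dots> = integral Q ?a + \<epsilon> * (- integral Q ?b) - \<epsilon> * (- integral Q ?c) - \<epsilon> * integral Q ?d"
    unfolding 1[symmetric] 2[symmetric]
    by (intro integral_unique has_integral_add has_integral_diff has_integral_mult_right I)
  also have "\<dots> = integral Q ?a - \<epsilon> * (integral Q ?b - integral Q ?c) - \<epsilon> * integral Q ?d"
    by (simp add: algebra_simps)
  also have "\<dots> = integral Q (\<lambda>p. ?a p - \<epsilon> * (?b p - ?c p) - \<epsilon> * ?d p)"
    by (intro integral_unique[symmetric] has_integral_diff has_integral_mult_right I)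
  finally show ?thesis .
qed

end

section \<open>Bounds of the entropy production by norms of the test function\<close>

lemma rect_integral_mult_le_bounds:
  fixes f g :: "real \<times> real \<Rightarrow> real"
  assumes "continuous_on (rect a b c d) f" "continuous_on (rect a b c d) g"
    and "integral (rect a b c d) (\<lambda>p. (f p)^2) \<le> x^2" "integral (rect a b c d) (\<lambda>p. (g p)^2) \<le> y^2"
    and "0 \<le> x" "0 \<le> y"
  shows "integral (rect a b c d) (\<lambda>p. f p * g p) \<le> x * y"
proof -
  have "sqrt (integral (rect a b c d) (\<lambda>p. (f p)^2)) \<le> x" "sqrt (integral (rect a b c d) (\<lambda>p. (g p)^2)) \<le> y"
    by (intro real_le_lsqrt assms)+
  moreover have "0 \<le> integral (rect a b c d) (\<lambda>p. (g p)^2)"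
    by (intro integral_nonneg rect_integrable continuous_intros assms) simp
  ultimately have "sqrt (integral (rect a b c d) (\<lambda>p. (f p)^2)) * sqrt (integral (rect a b c d) (\<lambda>p. (g p)^2)) \<le> x * y"
    using assms(5) by (intro mult_mono) auto
  with rect_integral_mult_le[OF assms(1,2)] show ?thesis by linarith
qed

lemma rect_integral_abs_le_bound:
  fixes f :: "real \<times> real \<Rightarrow> real"
  assumes "continuous_on (rect a b c d) f" "a \<le> b" "c \<le> d"
    and "integral (rect a b c d) (\<lambda>p. (f p)^2) \<le> x^2" "0 \<le> x"
  shows "integral (rect a b c d) (\<lambda>p. \<bar>f p\<bar>) \<le> sqrt ((b - a) * (d - c)) * x"
proof -
  have "integral (rect a b c d) (\<lambda>p. \<bar>f p\<bar>)
      \<le> sqrt ((b - a) * (d - c)) * sqrt (integral (rect a b c d) (\<lambda>p. (f p)^2))"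
    using rect_integral_abs_le[of a b c d "\<lambda>p. \<bar>f p\<bar>"] assms(1-3)
    by (simp add: continuous_intros)
  also have "\<dots> \<le> sqrt ((b - a) * (d - c)) * x"
    using assms by (intro mult_left_mono real_le_lsqrt) auto
  finally show ?thesis .
qed

context relaxation
begin

text \<open>Polarisation of the positive semidefinite form of \<open>hess \<eta> w\<close> at \<open>A v - v\<close>.\<close>

lemma jac_bound: "norm (jac F w *v v) \<le> (norm A + 1) * norm v"
proof -
  let ?H = "hess \<eta> w"
  have "0 \<le> \<beta> * ((A *v v - v) \<bullet> (A *v v - v))" using pos by simp
  also have "\<dots> \<le> (A *v v - v) \<bullet> (?H *v (A *v v - v))" by (rule hess_lo)
  also have "\<dots> = (A *v v) \<bullet> (?H *v (A *v v)) + v \<bullet> (?H *v v) - 2 * ((A *v v) \<bullet> (?H *v v))"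
    using hess_symmetric[OF C2, of w "A *v v" v]
    by (simp add: matrix_vector_mult_diff_distrib inner_diff_left inner_diff_right inner_commute)
  also have "\<dots> \<le> \<alpha> / 2 * ((A *v v) \<bullet> (A *v v)) + \<alpha> / 2 * (v \<bullet> v) - 2 * ((A *v v) \<bullet> (?H *v v))"
    using hess_hi[of "A *v v" w] hess_hi[of v w] by linarith
  finally have "4 * ((A *v v) \<bullet> (?H *v v)) \<le> \<alpha> * ((norm (A *v v))^2 + (norm v)^2)"
    by (simp add: power2_norm_eq_inner algebra_simps)
  \<comment> \<open>Here the bound for DF enters: the subcharacteristic condition controls |DF v|^2
    by the form that polarisation has just estimated.\<close>
  moreover have "\<alpha> * (norm (jac F w *v v))^2 \<le> (A *v v) \<bullet> (?H *v v)"
  proof -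
    have "0 \<le> \<nu> * (norm v)^2" using pos by simp
    then show ?thesis using subchar[of v w] by linarith
  qed
  ultimately have "\<alpha> * (norm (jac F w *v v))^2 \<le> \<alpha> * ((norm (A *v v))^2 + (norm v)^2)"
    using mult_nonneg_nonneg[OF less_imp_le[OF pos(3)], of "(norm (A *v v))^2 + (norm v)^2"] by simp
  then have "(norm (jac F w *v v))^2 \<le> (norm (A *v v))^2 + (norm v)^2" using pos(3) by simp
  also have "\<dots> \<le> (norm (A *v v) + norm v)^2" by (simp add: power2_sum)
  finally have "norm (jac F w *v v) \<le> norm (A *v v) + norm v"
    by (rule power2_le_imp_le) simp
  also have "\<dots> \<le> (norm A + 1) * norm v"
    using norm_matrix_vector_le[of A v] by (simp add: algebra_simps)
  finally show ?thesis .
qed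

end

context relaxation_entropy
begin

text \<open>The H^-1 bound: the pair is bounded by C, the slab has area 2 R T, and nothing depends
  on \<epsilon>.\<close>

lemma \<Lambda>_le_H1:
  assumes \<psi>: "C1_vanishing R T \<psi> \<psi>x \<psi>t"
    and x: "integral Q (\<lambda>p. (\<psi>x p)^2) \<le> x^2" and t: "integral Q (\<lambda>p. (\<psi>t p)^2) \<le> x^2" and "0 \<le> x"
  shows "\<bar>\<Lambda> \<psi>x \<psi>t\<bar> \<le> 2 * C * sqrt (2 * R * T) * x"
proof -
  note c = C1_vanishingD(2-)[OF \<psi>]
  have "integral Q (\<lambda>p. \<bar>\<psi>t p\<bar> + \<bar>\<psi>x p\<bar>) = integral Q (\<lambda>p. \<bar>\<psi>t p\<bar>) + integral Q (\<lambda>p. \<bar>\<psi>x p\<bar>)"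
    by (intro integral_add rect_integrable continuous_intros c)
  also have "\<dots> \<le> sqrt ((R - - R) * (T - 0)) * x + sqrt ((R - - R) * (T - 0)) * x"
    using R_nonneg pos(1) assms c by (intro add_mono rect_integral_abs_le_bound) auto
  finally have "integral Q (\<lambda>p. \<bar>\<psi>t p\<bar> + \<bar>\<psi>x p\<bar>) \<le> 2 * sqrt (2 * R * T) * x" by (simp add: mult_ac)
  then have "C * integral Q (\<lambda>p. \<bar>\<psi>t p\<bar> + \<bar>\<psi>x p\<bar>) \<le> C * (2 * sqrt (2 * R * T) * x)"
    using C_nonneg by (intro mult_left_mono)
  with \<Lambda>_le_W11[OF \<psi>] show ?thesis by (simp add: mult_ac)
qed

lemma inner_grad_le: "\<bar>grad \<eta>' w \<bullet> v\<bar> \<le> C * norm v"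
  using Cauchy_Schwarz_ineq2[of "grad \<eta>' w" v] bounds'(3)[of w]
  by (meson mult_right_mono norm_ge_zero order_trans)

lemma inner_hess_le: "\<bar>(hess \<eta>' w *v v) \<bullet> z\<bar> \<le> C * (norm v * norm z)"
proof -
  have "\<bar>(hess \<eta>' w *v v) \<bullet> z\<bar> \<le> norm (hess \<eta>' w *v v) * norm z" by (rule Cauchy_Schwarz_ineq2)
  also have "\<dots> \<le> (C * norm v) * norm z"
    using norm_matrix_vector_le[of "hess \<eta>' w" v] bounds'(4)[of w]
    by (intro mult_right_mono) (meson mult_right_mono norm_ge_zero order_trans)+
  finally show ?thesis by (simp add: mult_ac)
qed

text \<open>Meant for \<epsilon> bounded away from 0, where u_x and u_t are bounded in L^2. In the
  strong form no derivative falls on \<psi>, so smallness in L^2 suffices.\<close>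

lemma \<Lambda>_le_L2:
  assumes \<psi>: "C1_vanishing R T \<psi> \<psi>x \<psi>t"
    and ux: "integral Q (\<lambda>p. (norm (ux p))^2) \<le> m^2" and ut: "integral Q (\<lambda>p. (norm (ut p))^2) \<le> m^2"
    and L2: "integral Q (\<lambda>p. (\<psi> p)^2) \<le> \<tau>^2" and "0 \<le> m" "0 \<le> \<tau>"
  shows "\<bar>\<Lambda> \<psi>x \<psi>t\<bar> \<le> C * (norm A + 2) * (m * \<tau>)"
proof -
  note c = C1_vanishingD(2-)[OF \<psi>]
  note I = rect_integrable continuous_intros c cont_Q entropy_C'
  have "norm (integral Q (\<lambda>p. (grad \<eta>' (u p) \<bullet> ut p + grad q' (u p) \<bullet> ux p) * \<psi> p))
    \<le> integral Q (\<lambda>p. C * (norm (ut p) * \<bar>\<psi> p\<bar>) + C * (norm A + 1) * (norm (ux p) * \<bar>\<psi> p\<bar>))"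
  proof (rule integral_norm_bound_integral)
    fix p assume "p \<in> Q"
    have "\<bar>grad q' (u p) \<bullet> ux p\<bar> \<le> C * norm (jac F (u p) *v ux p)"
      using inner_grad_le[of "u p" "jac F (u p) *v ux p"] by (simp add: flux_eq')
    also have "\<dots> \<le> C * ((norm A + 1) * norm (ux p))"
      using C_nonneg by (intro mult_left_mono jac_bound)
    finally have "\<bar>grad \<eta>' (u p) \<bullet> ut p + grad q' (u p) \<bullet> ux p\<bar> \<le> C * norm (ut p) + C * ((norm A + 1) * norm (ux p))"
      using inner_grad_le[of "u p" "ut p"] by linarith
    then have "\<bar>grad \<eta>' (u p) \<bullet> ut p + grad q' (u p) \<bullet> ux p\<bar> * \<bar>\<psi> p\<bar>
        \<le> (C * norm (ut p) + C * ((norm A + 1) * norm (ux p))) * \<bar>\<psi> p\<bar>"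
      by (intro mult_right_mono) auto
    then show "norm ((grad \<eta>' (u p) \<bullet> ut p + grad q' (u p) \<bullet> ux p) * \<psi> p)
        \<le> C * (norm (ut p) * \<bar>\<psi> p\<bar>) + C * (norm A + 1) * (norm (ux p) * \<bar>\<psi> p\<bar>)"
      unfolding real_norm_def abs_mult by (simp add: algebra_simps)
  qed (intro I)+
  also have "\<dots> = C * integral Q (\<lambda>p. norm (ut p) * \<bar>\<psi> p\<bar>) + C * (norm A + 1) * integral Q (\<lambda>p. norm (ux p) * \<bar>\<psi> p\<bar>)"
    by (intro integral_unique has_integral_add has_integral_mult_right integrable_integral I)
  also have "\<dots> \<le> C * (m * \<tau>) + C * (norm A + 1) * (m * \<tau>)"
    using assms C_nonneg
    by (intro add_mono mult_left_mono rect_integral_mult_le_bounds continuous_intros c cont_Q) auto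
  finally show ?thesis by (simp add: \<Lambda>_strong[OF \<psi>] algebra_simps)
qed

text \<open>Meant for small \<epsilon>, with \<psi> a truncation of \<phi>. The source costs the L^2
  norm of \<phi>; the first-order terms cost sqrt \<epsilon>, as \<epsilon> |Du|^2 has bounded
  integral; the quadratic terms are bounded in L^1 only and cost sup |\<psi>| <= k. The bounds
  \<open>2^2\<close> anticipate differences of two elements of the H^1 unit ball.\<close>

lemma \<Lambda>_le_dissipative:
  assumes \<psi>: "C1_vanishing R T \<psi> \<psi>x \<psi>t" and \<phi>: "C1_vanishing R T \<phi> \<phi>x \<phi>t"
    and le: "\<And>p. \<bar>\<psi> p\<bar> \<le> \<bar>\<phi> p\<bar>" "\<And>p. \<bar>\<psi> p\<bar> \<le> k" "\<And>p. \<bar>\<psi>x p\<bar> \<le> \<bar>\<phi>x p\<bar>" "\<And>p. \<bar>\<psi>t p\<bar> \<le> \<bar>\<phi>t p\<bar>"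
    and u2: "integral Q (\<lambda>p. (norm (u p))^2) \<le> m^2"
    and d2: "\<epsilon> * integral Q (\<lambda>p. (norm (ux p))^2 + (norm (ut p))^2) \<le> m^2"
    and \<phi>2: "integral Q (\<lambda>p. (\<phi> p)^2) \<le> \<tau>^2" "integral Q (\<lambda>p. (\<phi>x p)^2) \<le> 2^2" "integral Q (\<lambda>p. (\<phi>t p)^2) \<le> 2^2"
    and "0 \<le> m" "0 \<le> \<tau>"
  shows "\<bar>\<Lambda> \<psi>x \<psi>t\<bar> \<le> C * L * (m * \<tau>) + C * (norm A + 1) * (4 * m * sqrt \<epsilon> + k * m^2)"
proof -
  note c = C1_vanishingD(2-)[OF \<psi>] C1_vanishingD(2-)[OF \<phi>]
  note I = rect_integrable continuous_intros c cont_Q entropy_C'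
  have k0: "0 \<le> k" using le(2) abs_ge_zero order_trans by blast
  have "norm (integral Q (\<lambda>p. (grad \<eta>' (u p) \<bullet> G (u p)) * \<psi> p
    - \<epsilon> * ((grad \<eta>' (u p) \<bullet> (A *v ux p)) * \<psi>x p - (grad \<eta>' (u p) \<bullet> ut p) * \<psi>t p)
    - \<epsilon> * (((hess \<eta>' (u p) *v ux p) \<bullet> (A *v ux p) - (hess \<eta>' (u p) *v ut p) \<bullet> ut p) * \<psi> p)))
    \<le> integral Q (\<lambda>p. C * L * (norm (u p) * \<bar>\<phi> p\<bar>)
      + C * (norm A + 1) * (\<epsilon> * (norm (ux p) * \<bar>\<phi>x p\<bar>) + \<epsilon> * (norm (ut p) * \<bar>\<phi>t p\<bar>)
        + k * (\<epsilon> * ((norm (ux p))^2 + (norm (ut p))^2))))"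
  proof (rule integral_norm_bound_integral)
    fix p assume "p \<in> Q"
    define B where "B = C * (norm A + 1)"
    have B: "C * norm A \<le> B" "C \<le> B" "0 \<le> B" "0 \<le> C"
      using C_nonneg mult_nonneg_nonneg[of C "norm A"] by (auto simp: B_def algebra_simps)
    have "\<bar>grad \<eta>' (u p) \<bullet> G (u p)\<bar> \<le> C * norm (G (u p))" by (rule inner_grad_le)
    also have "\<dots> \<le> C * (L * norm (u p))" using C_nonneg by (intro mult_left_mono G_le)
    finally have "\<bar>grad \<eta>' (u p) \<bullet> G (u p)\<bar> * \<bar>\<psi> p\<bar> \<le> (C * (L * norm (u p))) * \<bar>\<phi> p\<bar>"
      using B pos(7) by (intro mult_mono le) auto
    then have 1: "\<bar>(grad \<eta>' (u p) \<bullet> G (u p)) * \<psi> p\<bar> \<le> C * L * (norm (u p) * \<bar>\<phi> p\<bar>)"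
      by (simp add: abs_mult mult_ac)
    have "\<bar>grad \<eta>' (u p) \<bullet> (A *v ux p)\<bar> \<le> C * norm (A *v ux p)" by (rule inner_grad_le)
    also have "\<dots> \<le> C * (norm A * norm (ux p))" using C_nonneg by (intro mult_left_mono norm_matrix_vector_le)
    also have "\<dots> \<le> B * norm (ux p)" using mult_right_mono[OF B(1), of "norm (ux p)"] by (simp add: mult.assoc)
    finally have 2: "\<bar>(grad \<eta>' (u p) \<bullet> (A *v ux p)) * \<psi>x p\<bar> \<le> B * norm (ux p) * \<bar>\<phi>x p\<bar>"
      unfolding abs_mult using B by (intro mult_mono le) auto
    have "\<bar>grad \<eta>' (u p) \<bullet> ut p\<bar> \<le> B * norm (ut p)"
      using inner_grad_le[of "u p" "ut p"] mult_right_mono[OF B(2), of "norm (ut p)"] by simp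
    then have 3: "\<bar>(grad \<eta>' (u p) \<bullet> ut p) * \<psi>t p\<bar> \<le> B * norm (ut p) * \<bar>\<phi>t p\<bar>"
      unfolding abs_mult using B by (intro mult_mono le) auto
    have "\<bar>(hess \<eta>' (u p) *v ux p) \<bullet> (A *v ux p)\<bar> \<le> C * (norm (ux p) * norm (A *v ux p))" by (rule inner_hess_le)
    also have "\<dots> \<le> C * (norm (ux p) * (norm A * norm (ux p)))"
      using C_nonneg by (intro mult_left_mono norm_matrix_vector_le) auto
    also have "\<dots> \<le> B * (norm (ux p))^2"
      using mult_right_mono[OF B(1), of "(norm (ux p))^2"] by (simp add: power2_eq_square mult_ac)
    finally have "\<bar>(hess \<eta>' (u p) *v ux p) \<bullet> (A *v ux p) - (hess \<eta>' (u p) *v ut p) \<bullet> ut p\<bar>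
        \<le> B * ((norm (ux p))^2 + (norm (ut p))^2)"
      using inner_hess_le[of "u p" "ut p" "ut p"] mult_right_mono[OF B(2), of "(norm (ut p))^2"]
      by (simp add: power2_eq_square distrib_left)
    then have 4: "\<bar>((hess \<eta>' (u p) *v ux p) \<bullet> (A *v ux p) - (hess \<eta>' (u p) *v ut p) \<bullet> ut p) * \<psi> p\<bar>
        \<le> B * ((norm (ux p))^2 + (norm (ut p))^2) * k"
      unfolding abs_mult using B by (intro mult_mono le) auto
    have 5: "\<bar>a - \<epsilon> * (b - c) - \<epsilon> * d\<bar> \<le> a' + \<epsilon> * (b' + c' + d')" 
      if "\<bar>a\<bar> \<le> a'" "\<bar>b\<bar> \<le> b'" "\<bar>c\<bar> \<le> c'" "\<bar>d\<bar> \<le> d'" for a b c d a' b' c' d'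
    proof -
      have "\<bar>\<epsilon> * (b - c + d)\<bar> \<le> \<epsilon> * (b' + c' + d')"
        unfolding abs_mult using pos(2) that by (intro mult_mono) auto
      then show ?thesis using that(1) by (simp add: algebra_simps)
    qed
    show "norm ((grad \<eta>' (u p) \<bullet> G (u p)) * \<psi> p
        - \<epsilon> * ((grad \<eta>' (u p) \<bullet> (A *v ux p)) * \<psi>x p - (grad \<eta>' (u p) \<bullet> ut p) * \<psi>t p)
        - \<epsilon> * (((hess \<eta>' (u p) *v ux p) \<bullet> (A *v ux p) - (hess \<eta>' (u p) *v ut p) \<bullet> ut p) * \<psi> p))
      \<le> C * L * (norm (u p) * \<bar>\<phi> p\<bar>)
        + C * (norm A + 1) * (\<epsilon> * (norm (ux p) * \<bar>\<phi>x p\<bar>) + \<epsilon> * (norm (ut p) * \<bar>\<phi>t p\<bar>)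
        + k * (\<epsilon> * ((norm (ux p))^2 + (norm (ut p))^2)))"
      using 5[OF 1 2 3 4] unfolding B_def[symmetric] real_norm_def by (simp add: algebra_simps)
  qed (intro I)+
  also have "\<dots> = C * L * integral Q (\<lambda>p. norm (u p) * \<bar>\<phi> p\<bar>)
      + C * (norm A + 1) * (\<epsilon> * integral Q (\<lambda>p. norm (ux p) * \<bar>\<phi>x p\<bar>) + \<epsilon> * integral Q (\<lambda>p. norm (ut p) * \<bar>\<phi>t p\<bar>)
        + k * (\<epsilon> * integral Q (\<lambda>p. (norm (ux p))^2 + (norm (ut p))^2)))"
    by (intro integral_unique has_integral_add has_integral_mult_right integrable_integral I)
  also have "\<dots> \<le> C * L * (m * \<tau>) + C * (norm A + 1) * (\<epsilon> * (m / sqrt \<epsilon> * 2) + \<epsilon> * (m / sqrt \<epsilon> * 2) + k * m^2)"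
  proof -
    \<comment> \<open>The L^2 norms of u_x and u_t are at most m / sqrt \<epsilon>. Multiplied by
      \<epsilon> and by the bound 2 for the derivatives of \<phi>, each contributes 2 m sqrt
      \<epsilon>.\<close>
    have D: "integral Q (\<lambda>p. (norm (ux p))^2 + (norm (ut p))^2) \<le> (m / sqrt \<epsilon>)^2"
      using d2 pos(2) by (simp add: power_divide field_simps)
    have "integral Q (\<lambda>p. (norm (ux p))^2) \<le> integral Q (\<lambda>p. (norm (ux p))^2 + (norm (ut p))^2)"
      "integral Q (\<lambda>p. (norm (ut p))^2) \<le> integral Q (\<lambda>p. (norm (ux p))^2 + (norm (ut p))^2)"
      by (intro integral_le I; simp)+
    note D' = order_trans[OF this(1) D] order_trans[OF this(2) D]
    have i1: "integral Q (\<lambda>p. norm (u p) * \<bar>\<phi> p\<bar>) \<le> m * \<tau>"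
      using assms by (intro rect_integral_mult_le_bounds I) auto
    have ms: "0 \<le> m / sqrt \<epsilon>" "0 \<le> (2::real)" using assms(12) pos(2) by simp_all
    have \<phi>2': "integral Q (\<lambda>p. \<bar>\<phi>x p\<bar>^2) \<le> 2^2" "integral Q (\<lambda>p. \<bar>\<phi>t p\<bar>^2) \<le> 2^2"
      using \<phi>2(2,3) by simp_all
    have i2: "integral Q (\<lambda>p. norm (ux p) * \<bar>\<phi>x p\<bar>) \<le> m / sqrt \<epsilon> * 2"
      "integral Q (\<lambda>p. norm (ut p) * \<bar>\<phi>t p\<bar>) \<le> m / sqrt \<epsilon> * 2"
      by (rule rect_integral_mult_le_bounds[OF _ _ D'(1) \<phi>2'(1) ms(1,2)]; intro I)
        (rule rect_integral_mult_le_bounds[OF _ _ D'(2) \<phi>2'(2) ms(1,2)]; intro I)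
    have nn: "0 \<le> C * L" "0 \<le> C * (norm A + 1)" "0 \<le> \<epsilon>" using C_nonneg pos by simp_all
    show ?thesis
      by (rule add_mono[OF mult_left_mono[OF i1 nn(1)] mult_left_mono[OF add_mono[OF add_mono[OF
        mult_left_mono[OF i2(1) nn(3)] mult_left_mono[OF i2(2) nn(3)]] mult_left_mono[OF d2 k0]] nn(2)]])
  qed
  also have "\<epsilon> * (m / sqrt \<epsilon> * 2) + \<epsilon> * (m / sqrt \<epsilon> * 2) = 4 * m * sqrt \<epsilon>"
    using real_div_sqrt[of \<epsilon>] pos(2) by (simp add: field_simps)
  finally show ?thesis by (simp add: \<Lambda>_dissipative[OF \<psi>])
qed

text \<open>The truncation is handled by \<open>\<Lambda>_le_dissipative\<close> with k = 2 s. The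
  gradient of the remainder is (1 - w) D\<phi>, at most |\<phi>| |D\<phi>| / s, so the W^{1,1} bound
  and Cauchy-Schwarz give 2 C \<tau> / s for each of the two derivatives.\<close>

lemma \<Lambda>_le_truncated:
  assumes \<phi>: "C1_vanishing R T \<phi> \<phi>x \<phi>t" and s: "0 < s"
    and u2: "integral Q (\<lambda>p. (norm (u p))^2) \<le> m^2"
    and d2: "\<epsilon> * integral Q (\<lambda>p. (norm (ux p))^2 + (norm (ut p))^2) \<le> m^2"
    and \<phi>2: "integral Q (\<lambda>p. (\<phi> p)^2) \<le> \<tau>^2" "integral Q (\<lambda>p. (\<phi>x p)^2) \<le> 2^2" "integral Q (\<lambda>p. (\<phi>t p)^2) \<le> 2^2"
    and m: "0 \<le> m" "0 \<le> \<tau>"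
  shows "\<bar>\<Lambda> \<phi>x \<phi>t\<bar> \<le> C * L * (m * \<tau>) + C * (norm A + 1) * (4 * m * sqrt \<epsilon> + 2 * s * m^2) + 4 * C * \<tau> / s"
proof -
  define w where "w p = inverse (1 + (\<phi> p / s)^2)" for p
  note tr = arctan_truncation[OF s \<phi>, folded w_def]
  have "\<bar>\<Lambda> (\<lambda>p. w p * \<phi>x p) (\<lambda>p. w p * \<phi>t p)\<bar>
      \<le> C * L * (m * \<tau>) + C * (norm A + 1) * (4 * m * sqrt \<epsilon> + 2 * s * m^2)"
    by (rule \<Lambda>_le_dissipative[OF tr(1) \<phi> tr(2) tr(3) _ _ u2 d2 \<phi>2 m])
      (use tr(4,5) in \<open>auto simp: abs_mult mult_left_le_one_le\<close>)
  moreover have "\<bar>\<Lambda> (\<lambda>p. \<phi>x p - w p * \<phi>x p) (\<lambda>p. \<phi>t p - w p * \<phi>t p)\<bar> \<le> 4 * C * \<tau> / s"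
  proof -
    note v = C1_vanishing_diff[OF \<phi> tr(1)]
    note c = C1_vanishingD(2-)[OF v] C1_vanishingD(2-)[OF \<phi>]
    have pt: "\<bar>z - w p * z\<bar> \<le> 1 / s * (\<bar>\<phi> p\<bar> * \<bar>z\<bar>)" for p z
    proof -
      have "\<bar>z - w p * z\<bar> = (1 - w p) * \<bar>z\<bar>"
        using tr(5)[of p] by (metis abs_mult abs_of_nonneg diff_ge_0_iff_ge left_diff_distrib mult_1)
      also have "\<dots> \<le> \<bar>\<phi> p\<bar> / s * \<bar>z\<bar>" using tr(6) by (intro mult_right_mono) auto
      finally show ?thesis by simp
    qed
    have "integral Q (\<lambda>p. \<bar>\<phi>t p - w p * \<phi>t p\<bar> + \<bar>\<phi>x p - w p * \<phi>x p\<bar>)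
      \<le> integral Q (\<lambda>p. 1 / s * (\<bar>\<phi> p\<bar> * \<bar>\<phi>t p\<bar>) + 1 / s * (\<bar>\<phi> p\<bar> * \<bar>\<phi>x p\<bar>))"
      by (intro integral_le rect_integrable continuous_intros c add_mono pt)
    also have "\<dots> = 1 / s * integral Q (\<lambda>p. \<bar>\<phi> p\<bar> * \<bar>\<phi>t p\<bar>) + 1 / s * integral Q (\<lambda>p. \<bar>\<phi> p\<bar> * \<bar>\<phi>x p\<bar>)"
      by (intro integral_unique has_integral_add has_integral_mult_right integrable_integral rect_integrable continuous_intros c)
    also have "\<dots> \<le> 1 / s * (\<tau> * 2) + 1 / s * (\<tau> * 2)"
      using s \<phi>2 m by (intro add_mono mult_left_mono rect_integral_mult_le_bounds continuous_intros c) auto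
    finally have "C * integral Q (\<lambda>p. \<bar>\<phi>t p - w p * \<phi>t p\<bar> + \<bar>\<phi>x p - w p * \<phi>x p\<bar>) \<le> C * (1 / s * (\<tau> * 2) + 1 / s * (\<tau> * 2))"
      using C_nonneg by (intro mult_left_mono)
    with \<Lambda>_le_W11[OF v] show ?thesis by (simp add: mult_ac)
  qed
  ultimately show ?thesis using \<Lambda>_diff[OF \<phi> tr(1)] by linarith
qed

end

section \<open>Test functions\<close>

lemma test_function_partials:
  assumes "\<phi> \<in> test_functions \<Omega>"
  shows "has_partials UNIV UNIV \<phi> (pdx \<phi>) (pdt UNIV \<phi>)"
proof -
  obtain D where D: "\<And>p. p \<in> UNIV \<times> UNIV \<Longrightarrow> D 0 0 p = \<phi> p"
    "\<And>i j p. p \<in> UNIV \<times> UNIV \<Longrightarrow> (D i j has_derivative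
            (\<lambda>h. fst h *\<^sub>R D (Suc i) j p + snd h *\<^sub>R D i (Suc j) p)) (at p within UNIV \<times> UNIV)"
    using assms unfolding test_functions_def smooth_xt_def by auto
  have P: "has_partials UNIV UNIV \<phi> (D (Suc 0) 0) (D 0 (Suc 0))"
    by (rule has_partials_cong[OF has_partials_of_derivatives[of UNIV UNIV D 0 0, OF D(2)]]) (use D(1) in auto)
  show ?thesis
    by (rule has_partials_cong[OF P]) (use pdx_eq[OF P] pdt_UNIV_eq[OF P] in auto)
qed

text \<open>The support is closed, so a point outside \<Omega> has a whole neighbourhood on which
  \<phi> vanishes.\<close>

lemma test_function_zero:
  assumes "\<phi> \<in> test_functions \<Omega>" "p \<notin> \<Omega>"
  shows "\<phi> p = 0" "pdx \<phi> p = 0" "pdt UNIV \<phi> p = 0"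
proof -
  obtain x t where p: "p = (x, t)" by fastforce
  define V where "V = - closure {p. \<phi> p \<noteq> 0}"
  have V: "open V" "(x, t) \<in> V" "\<And>p. p \<in> V \<Longrightarrow> \<phi> p = 0"
    using assms closure_subset[of "{p. \<phi> p \<noteq> 0}"] by (auto simp: V_def p test_functions_def)
  show "\<phi> p = 0" using V p by simp
  have op: "open ((\<lambda>y. (y, t)) -` V)" "open ((\<lambda>s. (x, s)) -` V)"
    by (intro open_vimage V(1) continuous_intros)+
  have "((\<lambda>y. \<phi> (y, t)) has_vector_derivative 0) (at x)"
    by (rule has_vector_derivative_transform_within_open[OF has_vector_derivative_const op(1)]) (use V(2,3) in auto)
  moreover have "((\<lambda>s. \<phi> (x, s)) has_vector_derivative 0) (at t)"
    by (rule has_vector_derivative_transform_within_open[OF has_vector_derivative_const op(2)]) (use V(2,3) in auto)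
  ultimately show "pdx \<phi> p = 0" "pdt UNIV \<phi> p = 0"
    by (auto simp: p pdx_def pdt_def vector_derivative_at)
qed

text \<open>The box is open, so that a test function on \<Omega> vanishes on all four sides of the
  closed slab.\<close>

definition inside_box :: "real \<Rightarrow> real \<Rightarrow> (real \<times> real) set \<Rightarrow> bool" where
  "inside_box R T \<Omega> \<longleftrightarrow> 0 < R \<and> \<Omega> \<subseteq> {-R<..<R} \<times> {0<..<T}"

lemma local_domain_inside_box:
  assumes "local_domain T \<Omega>"
  obtains R where "inside_box R T \<Omega>"
proof -
  obtain r where r: "\<And>p. p \<in> \<Omega> \<Longrightarrow> norm p \<le> r"
    using assms unfolding local_domain_def bounded_iff by blast
  have "\<Omega> \<subseteq> {-(\<bar>r\<bar> + 1)<..<\<bar>r\<bar> + 1} \<times> {0<..<T}"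
  proof
    fix p assume p: "p \<in> \<Omega>"
    have "\<bar>fst p\<bar> \<le> r" using r[OF p] norm_fst_le[of "fst p" "snd p"] by simp
    moreover have "p \<in> open_strip T" using p assms by (auto simp: local_domain_def)
    ultimately show "p \<in> {-(\<bar>r\<bar> + 1)<..<\<bar>r\<bar> + 1} \<times> {0<..<T}"
      by (auto simp: open_strip_def mem_Times_iff)
  qed
  then show thesis by (intro that[of "\<bar>r\<bar> + 1"]) (auto simp: inside_box_def)
qed

lemma test_function_vanishing:
  assumes "\<phi> \<in> test_functions \<Omega>" "inside_box R T \<Omega>"
  shows "C1_vanishing R T \<phi> (pdx \<phi>) (pdt UNIV \<phi>)"
  unfolding C1_vanishing_def
  using has_partials_subset[OF test_function_partials[OF assms(1)], of "{-R..R}" "{0..T}"]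
    test_function_zero(1)[OF assms(1)] assms(2)
  by (auto simp: inside_box_def subset_iff)

text \<open>Passage from Lebesgue integrals over the plane or the open strip to the gauge integral
  over a compact slab. The integrands agree because h vanishes off \<Omega>, which lies in both
  sets.\<close>

lemma set_integral_box:
  fixes h :: "real \<times> real \<Rightarrow> real"
  assumes cont: "continuous_on (slab R T) h" and box: "inside_box R T \<Omega>" and "\<Omega> \<subseteq> S"
    and zero: "\<And>p. p \<notin> \<Omega> \<Longrightarrow> h p = 0"
  shows "set_integrable lborel S h" "(LINT p:S|lborel. h p) = integral (slab R T) h"
proof -
  let ?Q = "slab R T"
  have Q: "set_integrable lborel ?Q h"
    unfolding set_integrable_def by (intro borel_integrable_compact cont compact_Times) auto
  have "\<Omega> \<subseteq> ?Q" using box by (auto simp: inside_box_def)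
  have eq: "(\<lambda>p. indicator S p *\<^sub>R h p) = (\<lambda>p. indicator ?Q p *\<^sub>R h p)"
  proof
    fix p
    show "indicator S p *\<^sub>R h p = indicator ?Q p *\<^sub>R h p"
    proof (cases "p \<in> \<Omega>")
      case True
      then have "p \<in> S" "p \<in> ?Q" using \<open>\<Omega> \<subseteq> S\<close> \<open>\<Omega> \<subseteq> ?Q\<close> by blast+
      then show ?thesis by (simp only: indicator_simps)
    qed (simp add: zero)
  qed
  show "set_integrable lborel S h" using Q unfolding set_integrable_def eq .
  show "(LINT p:S|lborel. h p) = integral ?Q h"
    using set_borel_integral_eq_integral(2)[OF Q] unfolding set_lebesgue_integral_def eq .
qed

lemma H1_norm_box:
  assumes \<phi>: "\<phi> \<in> test_functions \<Omega>" and box: "inside_box R T \<Omega>"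
  shows "integral (slab R T) (\<lambda>p. (\<phi> p)^2) \<le> (H1_norm \<phi>)^2"
    "integral (slab R T) (\<lambda>p. (pdx \<phi> p)^2) \<le> (H1_norm \<phi>)^2"
    "integral (slab R T) (\<lambda>p. (pdt UNIV \<phi> p)^2) \<le> (H1_norm \<phi>)^2"
proof -
  let ?Q = "slab R T"
  let ?h = "\<lambda>p. (\<phi> p)^2 + (pdx \<phi> p)^2 + (pdt UNIV \<phi> p)^2"
  note c = C1_vanishingD(2-)[OF test_function_vanishing[OF assms]]
  have ch: "continuous_on ?Q ?h" by (intro continuous_intros c)
  have "(LINT p:UNIV|lborel. ?h p) = integral ?Q ?h"
    using test_function_zero[OF \<phi>] by (intro set_integral_box(2)[OF ch box]) auto
  moreover have "0 \<le> (LINT p|lborel. ?h p)" by (intro integral_nonneg_AE) auto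
  ultimately have eq: "(H1_norm \<phi>)^2 = integral ?Q ?h"
    by (simp add: H1_norm_def set_lebesgue_integral_def)
  show "integral ?Q (\<lambda>p. (\<phi> p)^2) \<le> (H1_norm \<phi>)^2"
    "integral ?Q (\<lambda>p. (pdx \<phi> p)^2) \<le> (H1_norm \<phi>)^2"
    "integral ?Q (\<lambda>p. (pdt UNIV \<phi> p)^2) \<le> (H1_norm \<phi>)^2"
    unfolding eq by (intro integral_le rect_integrable continuous_intros c; simp)+
qed

lemma dist_dt_dx_box:
  assumes f: "continuous_on (UNIV \<times> {0..T}) f" and g: "continuous_on (UNIV \<times> {0..T}) g"
    and \<phi>: "\<phi> \<in> test_functions \<Omega>" and box: "inside_box R T \<Omega>"
  shows "set_integrable lborel (open_strip T) (\<lambda>p. f p * pdt UNIV \<phi> p + g p * pdx \<phi> p)"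
    and "dist_dt_dx T f g \<phi> = - integral (slab R T) (\<lambda>p. f p * pdt UNIV \<phi> p + g p * pdx \<phi> p)"
proof -
  let ?Q = "slab R T"
  let ?h = "\<lambda>p. f p * pdt UNIV \<phi> p + g p * pdx \<phi> p"
  note c = C1_vanishingD(2-)[OF test_function_vanishing[OF \<phi> box]]
  have "?Q \<subseteq> UNIV \<times> {0..T}" by auto
  then have ch: "continuous_on ?Q ?h"
    by (intro continuous_intros c continuous_on_subset[OF f] continuous_on_subset[OF g])
  have sub: "\<Omega> \<subseteq> open_strip T" using box by (auto simp: inside_box_def open_strip_def)
  have z: "?h p = 0" if "p \<notin> \<Omega>" for p
    using test_function_zero[OF \<phi> that] by simp
  show "set_integrable lborel (open_strip T) ?h"
    by (rule set_integral_box(1)[OF ch box sub z])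
  have "(LINT p:open_strip T|lborel. ?h p) = integral ?Q ?h"
    by (rule set_integral_box(2)[OF ch box sub z])
  moreover have "\<phi> \<in> test_functions (open_strip T)"
    using \<phi> test_functions_mono[OF sub] by blast
  ultimately show "dist_dt_dx T f g \<phi> = - integral ?Q ?h"
    by (simp add: dist_dt_dx_def)
qed

lemma test_function_lincomb_partials:
  assumes "\<phi> \<in> test_functions \<Omega>" "\<psi> \<in> test_functions \<Omega>"
  shows "pdx (\<lambda>p. a * \<phi> p + b * \<psi> p) = (\<lambda>p. a * pdx \<phi> p + b * pdx \<psi> p)"
    "pdt UNIV (\<lambda>p. a * \<phi> p + b * \<psi> p) = (\<lambda>p. a * pdt UNIV \<phi> p + b * pdt UNIV \<psi> p)"
proof -
  note P = test_function_partials[OF assms(1)] test_function_partials[OF assms(2)]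
  have "has_partials UNIV UNIV (\<lambda>p. a * \<phi> p + b * \<psi> p) (\<lambda>p. a * pdx \<phi> p + b * pdx \<psi> p)
      (\<lambda>p. a * pdt UNIV \<phi> p + b * pdt UNIV \<psi> p)"
    using P unfolding has_partials_def
    by (auto intro!: continuous_intros has_vector_derivative_add has_vector_derivative_mult_right)
  from pdx_eq[OF this] pdt_UNIV_eq[OF this]
  show "pdx (\<lambda>p. a * \<phi> p + b * \<psi> p) = (\<lambda>p. a * pdx \<phi> p + b * pdx \<psi> p)"
    "pdt UNIV (\<lambda>p. a * \<phi> p + b * \<psi> p) = (\<lambda>p. a * pdt UNIV \<phi> p + b * pdt UNIV \<psi> p)"
    by auto
qed

text \<open>Additivity of the Lebesgue integral needs integrability over the unbounded strip; a test
  function supplies it through its support in some box.\<close>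

lemma dist_dt_dx_linear:
  assumes f: "continuous_on (UNIV \<times> {0..T}) f" and g: "continuous_on (UNIV \<times> {0..T}) g"
  shows "linear_on_tests T (dist_dt_dx T f g)"
proof -
  let ?S = "test_functions (open_strip T)"
  have lin: "dist_dt_dx T f g (\<lambda>p. a * \<phi> p + b * \<psi> p) = a * dist_dt_dx T f g \<phi> + b * dist_dt_dx T f g \<psi>"
    if "\<phi> \<in> ?S" "\<psi> \<in> ?S" for \<phi> \<psi> a b
  proof -
    have int: "set_integrable lborel (open_strip T) (\<lambda>p. f p * pdt UNIV \<xi> p + g p * pdx \<xi> p)" if \<xi>: "\<xi> \<in> ?S" for \<xi>
    proof -
      obtain \<Omega> where \<Omega>: "local_domain T \<Omega>" "\<xi> \<in> test_functions \<Omega>"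
        using test_functions_local_domain[OF \<xi>] .
      obtain R where "inside_box R T \<Omega>" using local_domain_inside_box[OF \<Omega>(1)] .
      then show ?thesis by (rule dist_dt_dx_box(1)[OF f g \<Omega>(2)])
    qed
    have "set_lebesgue_integral lborel (open_strip T) (\<lambda>p. f p * (a * pdt UNIV \<phi> p + b * pdt UNIV \<psi> p) + g p * (a * pdx \<phi> p + b * pdx \<psi> p))
      = set_lebesgue_integral lborel (open_strip T) (\<lambda>p. a * (f p * pdt UNIV \<phi> p + g p * pdx \<phi> p) + b * (f p * pdt UNIV \<psi> p + g p * pdx \<psi> p))"
      by (simp add: algebra_simps)
    also have "\<dots> = set_lebesgue_integral lborel (open_strip T) (\<lambda>p. a * (f p * pdt UNIV \<phi> p + g p * pdx \<phi> p))
        + set_lebesgue_integral lborel (open_strip T) (\<lambda>p. b * (f p * pdt UNIV \<psi> p + g p * pdx \<psi> p))"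
      by (rule set_integral_add(2)) (intro set_integrable_mult_right int that)+
    also have "\<dots> = a * set_lebesgue_integral lborel (open_strip T) (\<lambda>p. f p * pdt UNIV \<phi> p + g p * pdx \<phi> p)
        + b * set_lebesgue_integral lborel (open_strip T) (\<lambda>p. f p * pdt UNIV \<psi> p + g p * pdx \<psi> p)"
      by simp
    finally show ?thesis
      using that test_functions_lincomb[OF that, of a b]
      by (simp add: dist_dt_dx_def test_function_lincomb_partials[OF that])
  qed
  show ?thesis
    unfolding linear_on_tests_def
  proof (intro ballI allI conjI)
    fix \<phi> \<psi> c assume "\<phi> \<in> ?S" "\<psi> \<in> ?S"
    from lin[OF this, of 1 1] lin[OF this, of c 0]
    show "dist_dt_dx T f g (\<lambda>p. \<phi> p + \<psi> p) = dist_dt_dx T f g \<phi> + dist_dt_dx T f g \<psi>"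
      "dist_dt_dx T f g (\<lambda>p. c * \<phi> p) = c * dist_dt_dx T f g \<phi>" by simp_all
  qed
qed

section \<open>Bounds on a slab in terms of the initial energy\<close>

context relaxation
begin

text \<open>\<open>K1\<close> comes from the stability estimate integrated over {0..T},
  \<open>K2\<close> from the total dissipation. The latter weights the derivatives with \<epsilon>
  instead of \<epsilon>^2, which is the gain for small \<epsilon>; for \<epsilon> bounded below the
  former suffices.\<close>

lemma rect_integral_bounds:
  assumes "0 \<le> R" and E: "E0 \<le> E"
  defines "K1 \<equiv> T * (exp (rate * T) * upper) / lower"
    and "K2 \<equiv> upper * (1 + rate * T * exp (rate * T)) / min (\<alpha> / 4) \<nu>"
  shows "integral (slab R T) (\<lambda>p. (norm (u p))^2) \<le> K1 * E"
    "\<epsilon>^2 * integral (slab R T) (\<lambda>p. (norm (ux p))^2) \<le> K1 * E"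
    "\<epsilon>^2 * integral (slab R T) (\<lambda>p. (norm (ut p))^2) \<le> K1 * E"
    "\<epsilon> * integral (slab R T) (\<lambda>p. (norm (ux p))^2 + (norm (ut p))^2) \<le> K2 * E"
proof -
  let ?Q = "slab R T"
  let ?k = "exp (rate * T) * upper"
  note c = cont_u[THEN cont_rect, of "{-R..R}"] cont_rect[OF cont_energy(4)] cont_rect[OF cont_energy(5)]
  have k: "0 \<le> T * ?k" using pos energy_upper_pos by simp
  have "lower * integral ?Q dens \<le> T * ?k * E0"
    using total_energy[OF assms(1)] by (simp add: mult.assoc)
  also have "\<dots> \<le> T * ?k * E" using E k by (rule mult_left_mono)
  finally have K1: "integral ?Q dens \<le> K1 * E"
    using energy_lower_pos by (simp add: K1_def field_simps)
  have le: "(norm (u p))^2 \<le> dens p" "\<epsilon>^2 * (norm (ux p))^2 \<le> dens p" "\<epsilon>^2 * (norm (ut p))^2 \<le> dens p" for p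
    by (simp_all add: dens_def)
  have "integral ?Q (\<lambda>p. (norm (u p))^2) \<le> integral ?Q dens"
    "integral ?Q (\<lambda>p. \<epsilon>^2 * (norm (ux p))^2) \<le> integral ?Q dens"
    "integral ?Q (\<lambda>p. \<epsilon>^2 * (norm (ut p))^2) \<le> integral ?Q dens"
    by (intro integral_le rect_integrable continuous_intros c le)+
  then show "integral ?Q (\<lambda>p. (norm (u p))^2) \<le> K1 * E"
    "\<epsilon>^2 * integral ?Q (\<lambda>p. (norm (ux p))^2) \<le> K1 * E"
    "\<epsilon>^2 * integral ?Q (\<lambda>p. (norm (ut p))^2) \<le> K1 * E"
    using K1 by simp_all
  let ?m = "min (\<alpha> / 4) \<nu>" and ?g = "1 + rate * T * exp (rate * T)"
  have m: "0 < ?m" using pos by simp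
  have "integral ?Q (\<lambda>p. ?m * ((norm (ux p))^2 + (norm (ut p))^2)) \<le> integral ?Q diss"
  proof (intro integral_le rect_integrable continuous_intros c)
    show "?m * ((norm (ux p))^2 + (norm (ut p))^2) \<le> diss p" for p
      using mult_right_mono[OF min.cobounded2, of "(norm (ux p))^2" "\<alpha> / 4" \<nu>]
        mult_right_mono[OF min.cobounded1, of "(norm (ut p))^2" "\<alpha> / 4" \<nu>]
      unfolding diss_def distrib_left by simp
  qed
  then have "\<epsilon> * (?m * integral ?Q (\<lambda>p. (norm (ux p))^2 + (norm (ut p))^2)) \<le> \<epsilon> * integral ?Q diss"
    using pos(2) by (intro mult_left_mono) auto
  also have "\<dots> \<le> upper * E0 * ?g" by (rule total_dissipation)
  also have "\<dots> \<le> upper * E * ?g"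
    using E energy_upper_pos growth_rate_nonneg pos(1) by (intro mult_right_mono mult_left_mono) auto
  finally show "\<epsilon> * integral ?Q (\<lambda>p. (norm (ux p))^2 + (norm (ut p))^2) \<le> K2 * E"
    using m by (simp add: K2_def field_simps)
qed

lemma initial_energy_nonneg: "0 \<le> E0"
  by (intro integral_nonneg_AE) (simp add: dens_nonneg)

end

section \<open>Compactness of the entropy production\<close>

context relaxation_entropy
begin

lemma cont_entropy: "continuous_on (UNIV \<times> {0..T}) (\<lambda>p. \<eta>' (u p))" "continuous_on (UNIV \<times> {0..T}) (\<lambda>p. q' (u p))"
  by (intro cont_of_u(1) entropy_C')+

lemma dist_eq_\<Lambda>:
  assumes "\<phi> \<in> test_functions \<Omega>" "inside_box R T \<Omega>"
  shows "dist_dt_dx T (\<lambda>p. \<eta>' (u p)) (\<lambda>p. q' (u p)) \<phi> = \<Lambda> (pdx \<phi>) (pdt UNIV \<phi>)"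
  using dist_dt_dx_box(2)[OF cont_entropy assms] by (simp add: \<Lambda>_def)

lemma dist_le_H1:
  assumes "\<phi> \<in> test_functions \<Omega>" "inside_box R T \<Omega>"
  shows "\<bar>dist_dt_dx T (\<lambda>p. \<eta>' (u p)) (\<lambda>p. q' (u p)) \<phi>\<bar> \<le> 2 * C * sqrt (2 * R * T) * H1_norm \<phi>"
  unfolding dist_eq_\<Lambda>[OF assms]
  by (rule \<Lambda>_le_H1[OF test_function_vanishing[OF assms] H1_norm_box(2,3)[OF assms]]) (simp add: H1_norm_def)

end

text \<open>Two regimes, separated by a threshold \<open>\<epsilon>0\<close>. Below it the
  truncation estimate applies; its term in sqrt \<epsilon> does not become small with \<phi> and has
  to be small by itself. Above it u_x and u_t are bounded in L^2.\<close>

lemma entropy_production_small: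
  fixes A :: "real^'n^'n" and U :: "real \<Rightarrow> real \<times> real \<Rightarrow> real^'n"
  assumes rel: "\<And>\<epsilon>. 0 < \<epsilon> \<Longrightarrow> relaxation_entropy A F G \<eta> q \<alpha> \<beta> \<nu> L T \<epsilon> a
      (U \<epsilon>) (Ux \<epsilon>) (Ut \<epsilon>) (Uxx \<epsilon>) (Uxt \<epsilon>) (Utt \<epsilon>) \<eta>' q' C R"
    and E: "\<And>\<epsilon>. 0 < \<epsilon> \<Longrightarrow> (LINT x|lborel. relaxation.dens \<epsilon> (U \<epsilon>) (Ux \<epsilon>) (Ut \<epsilon>) (x, 0)) \<le> M * (1 + \<epsilon>^2)"
    and box: "inside_box R T \<Omega>" and \<delta>: "0 < \<delta>"
  defines "Q \<equiv> slab R T"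
  obtains \<tau> where "0 < \<tau>" "\<And>\<epsilon> \<phi>. 0 < \<epsilon> \<Longrightarrow> \<phi> \<in> test_functions \<Omega> \<Longrightarrow> integral Q (\<lambda>p. (\<phi> p)^2) \<le> \<tau>^2 \<Longrightarrow>
    integral Q (\<lambda>p. (pdx \<phi> p)^2) \<le> 4 \<Longrightarrow> integral Q (\<lambda>p. (pdt UNIV \<phi> p)^2) \<le> 4 \<Longrightarrow>
    \<bar>dist_dt_dx T (\<lambda>p. \<eta>' (U \<epsilon> p)) (\<lambda>p. q' (U \<epsilon> p)) \<phi>\<bar> \<le> \<delta>"
proof -
  \<comment> \<open>The member \<epsilon> = 1 of the family, used to read off the signs of the
    constants and of M.\<close>
  interpret one: relaxation_entropy A F G \<eta> q \<alpha> \<beta> \<nu> L T 1 a "U 1" "Ux 1" "Ut 1" "Uxx 1" "Uxt 1" "Utt 1" \<eta>' q' C R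
    using rel[of 1] by simp
  note pos = one.pos and C0 = one.C_nonneg
  have relax: "relaxation A F G \<eta> q \<alpha> \<beta> \<nu> L T \<epsilon> a (U \<epsilon>) (Ux \<epsilon>) (Ut \<epsilon>) (Uxx \<epsilon>) (Uxt \<epsilon>) (Utt \<epsilon>)" if "0 < \<epsilon>" for \<epsilon>
    using rel[OF that] by (simp add: relaxation_entropy_def)
  have M: "0 \<le> M" using E[of 1] one.initial_energy_nonneg by simp
  have R: "0 \<le> R" using box by (simp add: inside_box_def)
  define K1 where "K1 = T * (exp (growth_rate \<alpha> \<beta> L * T) * energy_upper \<alpha> A) / energy_lower \<alpha> \<beta> a"
  define K2 where "K2 = energy_upper \<alpha> A * (1 + growth_rate \<alpha> \<beta> L * T * exp (growth_rate \<alpha> \<beta> L * T)) / min (\<alpha> / 4) \<nu>"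
  have K: "0 \<le> K1" "0 \<le> K2"
    using pos one.growth_rate_nonneg one.energy_upper_pos one.energy_lower_pos
    by (auto simp: K1_def K2_def intro!: divide_nonneg_nonneg mult_nonneg_nonneg add_nonneg_nonneg)
  note bounds = relaxation.rect_integral_bounds[OF relax R, folded K1_def K2_def Q_def]
  \<comment> \<open>For \<epsilon> <= 1 the initial energy is at most 2 M; adding the two bounds
    gives one m for u and for its derivatives.\<close>
  define m where "m = sqrt (2 * M * (K1 + K2))"
  have m: "0 \<le> m" "m^2 = K1 * (2 * M) + K2 * (2 * M)"
    using M K by (auto simp: m_def algebra_simps)
  have le2M: "M * (1 + \<epsilon>^2) \<le> 2 * M" if "0 < \<epsilon>" "\<epsilon> \<le> 1" for \<epsilon> :: real
    using that M mult_left_mono[of "1 + \<epsilon>^2" 2 M] by (simp add: power_le_one mult.commute)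
  have small: "integral Q (\<lambda>p. (norm (U \<epsilon> p))^2) \<le> m^2 \<and>
      \<epsilon> * integral Q (\<lambda>p. (norm (Ux \<epsilon> p))^2 + (norm (Ut \<epsilon> p))^2) \<le> m^2" if \<epsilon>: "0 < \<epsilon>" "\<epsilon> \<le> 1" for \<epsilon>
  proof -
    have "0 \<le> K1 * (2 * M)" "0 \<le> K2 * (2 * M)" using K M by simp_all
    with bounds(1,4)[OF \<epsilon>(1) order_trans[OF E[OF \<epsilon>(1)] le2M[OF \<epsilon>]]] show ?thesis
      unfolding m(2) by linarith
  qed
  define k1 where "k1 = C * (norm A + 1) * (4 * m)"
  have k1: "0 \<le> k1" using C0 m(1) by (simp add: k1_def)
  \<comment> \<open>Chosen so that k1 sqrt \<open>\<epsilon>0\<close> <= \<delta>/2. The denominator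
    k1 + 1 is positive even for k1 = 0, and \<open>\<epsilon>0 \<le> 1\<close> keeps the initial
    energy below 2 M.\<close>
  define \<epsilon>0 where "\<epsilon>0 = min 1 ((\<delta> / (2 * (k1 + 1)))^2)"
  have \<epsilon>0: "0 < \<epsilon>0" "\<epsilon>0 \<le> 1" using \<delta> k1 by (auto simp: \<epsilon>0_def)
  have "sqrt \<epsilon>0 \<le> \<delta> / (2 * (k1 + 1))"
    using \<delta> k1 by (intro real_le_lsqrt) (auto simp: \<epsilon>0_def)
  then have "k1 * sqrt \<epsilon>0 \<le> k1 * (\<delta> / (2 * (k1 + 1)))" using k1 by (rule mult_left_mono)
  also have "\<dots> \<le> \<delta> / 2" using k1 \<delta> by (simp add: field_simps)
  finally have k1\<epsilon>0: "k1 * sqrt \<epsilon>0 \<le> \<delta> / 2" .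
  \<comment> \<open>For \<epsilon> >= \<open>\<epsilon>0\<close> the growth 1 + \<epsilon>^2 of the
    data, divided by the weight \<epsilon>^2, is at most
    \<open>1 + 1 / \<epsilon>0^2\<close>.\<close>
  define m1 where "m1 = sqrt (K1 * M * (1 + 1 / \<epsilon>0^2))"
  have m1: "0 \<le> m1" "m1^2 = K1 * M * (1 + 1 / \<epsilon>0^2)"
    using M K by (auto simp: m1_def)
  have large: "integral Q (\<lambda>p. (norm (Ux \<epsilon> p))^2) \<le> m1^2 \<and> integral Q (\<lambda>p. (norm (Ut \<epsilon> p))^2) \<le> m1^2"
    if \<epsilon>: "\<epsilon>0 \<le> \<epsilon>" for \<epsilon>
  proof -
    have \<epsilon>_pos: "0 < \<epsilon>" using \<epsilon> \<epsilon>0 by simp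
    have "K1 * (M * (1 + \<epsilon>^2)) = \<epsilon>^2 * (K1 * M * (1 + 1 / \<epsilon>^2))"
      using \<epsilon>_pos by (simp add: field_simps)
    also have "\<dots> \<le> \<epsilon>^2 * m1^2"
      unfolding m1(2) using K M \<epsilon> \<epsilon>0
      by (intro mult_left_mono add_left_mono divide_left_mono power_mono mult_nonneg_nonneg) auto
    finally have "K1 * (M * (1 + \<epsilon>^2)) \<le> \<epsilon>^2 * m1^2" .
    with bounds(2,3)[OF \<epsilon>_pos E[OF \<epsilon>_pos]] 
    have "\<epsilon>^2 * integral Q (\<lambda>p. (norm (Ux \<epsilon> p))^2) \<le> \<epsilon>^2 * m1^2" "\<epsilon>^2 * integral Q (\<lambda>p. (norm (Ut \<epsilon> p))^2) \<le> \<epsilon>^2 * m1^2"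
      by linarith+
    then show ?thesis using \<epsilon>_pos by simp
  qed
  define k2 where "k2 = C * L * m + C * (norm A + 1) * (2 * m^2) + 4 * C"
  define k3 where "k3 = C * (norm A + 2) * m1"
  have k23: "0 \<le> k2" "0 \<le> k3" using C0 m(1) m1(1) pos by (auto simp: k2_def k3_def)
  \<comment> \<open>The truncation level; its square is the bound for the L^2 norm of \<phi>. The
    remainder then costs \<sigma>^2 / \<sigma> = \<sigma>, and \<sigma> <= 1 makes the terms in
    \<sigma>^2 at most linear in \<sigma>.\<close>
  define \<sigma> where "\<sigma> = min 1 (\<delta> / (2 * (k2 + k3 + 1)))"
  have \<sigma>: "0 < \<sigma>" "\<sigma> \<le> 1" using \<delta> k23 by (auto simp: \<sigma>_def)
  have "(k2 + k3 + 1) * \<sigma> \<le> (k2 + k3 + 1) * (\<delta> / (2 * (k2 + k3 + 1)))"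
    using k23 by (intro mult_left_mono) (auto simp: \<sigma>_def)
  also have "\<dots> = \<delta> / 2" using k23 by (simp add: field_simps)
  finally have "(k2 + k3 + 1) * \<sigma> \<le> \<delta> / 2" .
  moreover have "0 \<le> k2 * \<sigma>" "0 \<le> k3 * \<sigma>" using k23 \<sigma> by auto
  ultimately have k\<sigma>: "k2 * \<sigma> \<le> \<delta> / 2" "k3 * \<sigma> \<le> \<delta>" using \<sigma> \<delta> by (auto simp: algebra_simps)
  show thesis
  proof (rule that[of "\<sigma>^2"])
    show "0 < \<sigma>^2" using \<sigma> by simp
    fix \<epsilon> :: real and \<phi>
    assume \<epsilon>: "0 < \<epsilon>" and \<phi>: "\<phi> \<in> test_functions \<Omega>" and L2: "integral Q (\<lambda>p. (\<phi> p)^2) \<le> (\<sigma>^2)^2"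
      and x: "integral Q (\<lambda>p. (pdx \<phi> p)^2) \<le> 4" and t: "integral Q (\<lambda>p. (pdt UNIV \<phi> p)^2) \<le> 4"
    interpret relaxation_entropy A F G \<eta> q \<alpha> \<beta> \<nu> L T \<epsilon> a "U \<epsilon>" "Ux \<epsilon>" "Ut \<epsilon>" "Uxx \<epsilon>" "Uxt \<epsilon>" "Utt \<epsilon>" \<eta>' q' C R
      by (rule rel[OF \<epsilon>])
    note v = test_function_vanishing[OF \<phi> box]
    have s2: "\<sigma>^2 \<le> \<sigma>" using \<sigma> by (simp add: power2_eq_square mult_left_le)
    have "\<bar>\<Lambda> (pdx \<phi>) (pdt UNIV \<phi>)\<bar> \<le> \<delta>"
    proof (cases "\<epsilon>0 \<le> \<epsilon>")
      case True
      have "\<bar>\<Lambda> (pdx \<phi>) (pdt UNIV \<phi>)\<bar> \<le> C * (norm A + 2) * (m1 * \<sigma>^2)"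
        using large[OF True] L2 m1(1) by (intro \<Lambda>_le_L2[OF v]) (auto simp: Q_def)
      also have "\<dots> = k3 * \<sigma>^2" by (simp add: k3_def)
      also have "\<dots> \<le> k3 * \<sigma>" using s2 k23 by (intro mult_left_mono)
      also have "\<dots> \<le> \<delta>" by (rule k\<sigma>)
      finally show ?thesis .
    next
      case False
      then have \<epsilon>1: "\<epsilon> \<le> 1" "\<epsilon> \<le> \<epsilon>0" using \<epsilon>0 by auto
      have "\<bar>\<Lambda> (pdx \<phi>) (pdt UNIV \<phi>)\<bar> \<le> C * L * (m * \<sigma>^2)
          + C * (norm A + 1) * (4 * m * sqrt \<epsilon> + 2 * \<sigma> * m^2) + 4 * C * \<sigma>^2 / \<sigma>"
        using small[OF \<epsilon> \<epsilon>1(1)] L2 x t m(1) \<sigma>(1) by (intro \<Lambda>_le_truncated[OF v]) (auto simp: Q_def)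
      also have "\<dots> = (C * L * m) * \<sigma>^2 + k1 * sqrt \<epsilon> + (C * (norm A + 1) * (2 * m^2) + 4 * C) * \<sigma>"
        using \<sigma>(1) by (simp add: k1_def power2_eq_square algebra_simps)
      also have "\<dots> \<le> (C * L * m) * \<sigma> + k1 * sqrt \<epsilon>0 + (C * (norm A + 1) * (2 * m^2) + 4 * C) * \<sigma>"
        using s2 k1 \<epsilon>1 C0 m(1) pos(7) by (intro add_mono mult_left_mono order_refl) auto
      also have "\<dots> = k2 * \<sigma> + k1 * sqrt \<epsilon>0" by (simp add: k2_def algebra_simps)
      also have "\<dots> \<le> \<delta>" using k\<sigma>(1) k1\<epsilon>0 by linarith
      finally show ?thesis .
    qed
    then show "\<bar>dist_dt_dx T (\<lambda>p. \<eta>' (U \<epsilon> p)) (\<lambda>p. q' (U \<epsilon> p)) \<phi>\<bar> \<le> \<delta>"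
      by (simp add: dist_eq_\<Lambda>[OF \<phi> box])
  qed
qed

text \<open>Of the three hypotheses of \<open>compactin_Hm1_loc\<close>, the net is the substantial
  one: Rellich provides it for the L^2 distance, and the production is uniformly small on
  differences that are small in L^2.\<close>

lemma entropy_production_compact:
  fixes A :: "real^'n^'n" and U :: "real \<Rightarrow> real \<times> real \<Rightarrow> real^'n"
  assumes rel: "\<And>\<epsilon>. 0 < \<epsilon> \<Longrightarrow> relaxation A F G \<eta> q \<alpha> \<beta> \<nu> L T \<epsilon> a
      (U \<epsilon>) (Ux \<epsilon>) (Ut \<epsilon>) (Uxx \<epsilon>) (Uxt \<epsilon>) (Utt \<epsilon>)"
    and E: "\<And>\<epsilon>. 0 < \<epsilon> \<Longrightarrow> (LINT x|lborel. relaxation.dens \<epsilon> (U \<epsilon>) (Ux \<epsilon>) (Ut \<epsilon>) (x, 0)) \<le> M * (1 + \<epsilon>^2)"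
    and pair': "entropy_pair F \<eta>' q'"
    and bounds': "\<And>w. \<bar>\<eta>' w\<bar> \<le> C" "\<And>w. \<bar>q' w\<bar> \<le> C" "\<And>w. norm (grad \<eta>' w) \<le> C" "\<And>w. norm (hess \<eta>' w) \<le> C"
  shows "\<exists>K. compactin (Hm1_loc_topology T) K \<and> (\<forall>\<epsilon>>0. dist_dt_dx T (\<lambda>p. \<eta>' (U \<epsilon> p)) (\<lambda>p. q' (U \<epsilon> p)) \<in> K)"
proof -
  define D where "D \<epsilon> = dist_dt_dx T (\<lambda>p. \<eta>' (U \<epsilon> p)) (\<lambda>p. q' (U \<epsilon> p))" for \<epsilon>
  have C0: "0 \<le> C" using bounds'(1) abs_ge_zero order_trans by blast
  have loc: "relaxation_entropy A F G \<eta> q \<alpha> \<beta> \<nu> L T \<epsilon> a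
      (U \<epsilon>) (Ux \<epsilon>) (Ut \<epsilon>) (Uxx \<epsilon>) (Uxt \<epsilon>) (Utt \<epsilon>) \<eta>' q' C R" if "0 < \<epsilon>" "0 \<le> R" for \<epsilon> R
    using rel[OF that(1)] pair' bounds' C0 that(2)
    by (simp add: relaxation_entropy_def relaxation_entropy_axioms_def)
  have T: "0 < T" using rel[of 1] by (simp add: relaxation_def)
  have lin: "D \<epsilon> \<in> extensional (test_functions (open_strip T)) \<and> linear_on_tests T (D \<epsilon>)" if "0 < \<epsilon>" for \<epsilon>
  proof -
    \<comment> \<open>Linearity concerns the whole strip, so the half-width 0 serves.\<close>
    interpret relaxation_entropy A F G \<eta> q \<alpha> \<beta> \<nu> L T \<epsilon> a "U \<epsilon>" "Ux \<epsilon>" "Ut \<epsilon>" "Uxx \<epsilon>" "Uxt \<epsilon>" "Utt \<epsilon>" \<eta>' q' C 0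
      by (rule loc[OF that order_refl])
    show ?thesis
      unfolding D_def using dist_dt_dx_linear[OF cont_entropy] by (simp add: dist_dt_dx_def)
  qed
  have "\<exists>K. compactin (Hm1_loc_topology T) K \<and> D ` {0<..} \<subseteq> K"
  proof (rule compactin_Hm1_loc)
    fix \<Lambda> assume "\<Lambda> \<in> D ` {0<..}"
    then show "\<Lambda> \<in> extensional (test_functions (open_strip T)) \<and> linear_on_tests T \<Lambda>" using lin by auto
  next
    fix \<Omega> assume "local_domain T \<Omega>"
    then obtain R where box: "inside_box R T \<Omega>" by (rule local_domain_inside_box)
    then have R: "0 \<le> R" by (simp add: inside_box_def)
    have "\<bar>D \<epsilon> \<phi>\<bar> \<le> 2 * C * sqrt (2 * R * T) * H1_norm \<phi>" if "0 < \<epsilon>" "\<phi> \<in> test_functions \<Omega>" for \<epsilon> \<phi>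
      unfolding D_def by (rule relaxation_entropy.dist_le_H1[OF loc[OF that(1) R] that(2) box])
    then show "\<exists>c. \<forall>\<Lambda>\<in>D ` {0<..}. \<forall>\<phi>\<in>test_functions \<Omega>. \<bar>\<Lambda> \<phi>\<bar> \<le> c * H1_norm \<phi>" by auto
  next
    fix \<Omega> and \<delta> :: real assume \<Omega>: "local_domain T \<Omega>" and \<delta>: "0 < \<delta>"
    obtain R where box: "inside_box R T \<Omega>" using local_domain_inside_box[OF \<Omega>] .
    then have R: "0 \<le> R" "-R < R" by (auto simp: inside_box_def)
    let ?Q = "slab R T"
    obtain \<tau> where \<tau>: "0 < \<tau>" "\<And>\<epsilon> \<phi>. 0 < \<epsilon> \<Longrightarrow> \<phi> \<in> test_functions \<Omega> \<Longrightarrow> integral ?Q (\<lambda>p. (\<phi> p)^2) \<le> \<tau>^2 \<Longrightarrow>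
      integral ?Q (\<lambda>p. (pdx \<phi> p)^2) \<le> 4 \<Longrightarrow> integral ?Q (\<lambda>p. (pdt UNIV \<phi> p)^2) \<le> 4 \<Longrightarrow> \<bar>D \<epsilon> \<phi>\<bar> \<le> \<delta>"
      unfolding D_def using entropy_production_small[OF loc[OF _ R(1)] E box \<delta>] by blast
    define B where "B = {\<phi> \<in> test_functions \<Omega>. H1_norm \<phi> \<le> 1}"
    have B: "has_partials {-R..R} {0..T} \<phi> (pdx \<phi>) (pdt UNIV \<phi>) \<and> integral ?Q (\<lambda>p. (\<phi> p)^2) \<le> 1 \<and>
      integral ?Q (\<lambda>p. (pdx \<phi> p)^2) \<le> 1 \<and> integral ?Q (\<lambda>p. (pdt UNIV \<phi> p)^2) \<le> 1" if "\<phi> \<in> B" for \<phi>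
    proof -
      have \<phi>: "\<phi> \<in> test_functions \<Omega>" "H1_norm \<phi> \<le> 1" using that by (auto simp: B_def)
      have "(H1_norm \<phi>)^2 \<le> 1" using \<phi>(2) by (intro power_le_one) (auto simp: H1_norm_def)
      then show ?thesis
        using H1_norm_box[OF \<phi>(1) box] C1_vanishingD(1)[OF test_function_vanishing[OF \<phi>(1) box]] by auto
    qed
    \<comment> \<open>The net is fine for the squared L^2 distance. Differences of members of B have
      squared derivative norms at most 4, as the choice of \<tau> requires.\<close>
    obtain B0 where B0: "finite B0" "B0 \<subseteq> B" "\<And>\<phi>. \<phi> \<in> B \<Longrightarrow> \<exists>\<psi>\<in>B0. integral ?Q (\<lambda>p. (\<phi> p - \<psi> p)^2) \<le> \<tau>^2"
      using rellich_net[OF R(2) T _ B, of "\<tau>^2"] \<tau>(1) by auto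
    have "\<exists>\<psi>\<in>B0. \<forall>\<Lambda>\<in>D ` {0<..}. \<bar>\<Lambda> (\<lambda>p. \<phi> p - \<psi> p)\<bar> \<le> \<delta>" if \<phi>: "\<phi> \<in> B" for \<phi>
    proof -
      obtain \<psi> where \<psi>: "\<psi> \<in> B0" "integral ?Q (\<lambda>p. (\<phi> p - \<psi> p)^2) \<le> \<tau>^2" using B0(3)[OF \<phi>] by blast
      then have "\<psi> \<in> B" using B0(2) by blast
      have test: "\<phi> \<in> test_functions \<Omega>" "\<psi> \<in> test_functions \<Omega>" using \<open>\<phi> \<in> B\<close> \<open>\<psi> \<in> B\<close> by (auto simp: B_def)
      have d: "pdx (\<lambda>p. \<phi> p - \<psi> p) = (\<lambda>p. pdx \<phi> p - pdx \<psi> p)"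
        "pdt UNIV (\<lambda>p. \<phi> p - \<psi> p) = (\<lambda>p. pdt UNIV \<phi> p - pdt UNIV \<psi> p)"
        using test_function_lincomb_partials[OF test, of 1 "-1"] by simp_all
      have "\<bar>D \<epsilon> (\<lambda>p. \<phi> p - \<psi> p)\<bar> \<le> \<delta>" if "0 < \<epsilon>" for \<epsilon>
      proof (rule \<tau>(2)[OF that test_functions_diff[OF test] \<psi>(2)])
        show "integral ?Q (\<lambda>p. (pdx (\<lambda>p. \<phi> p - \<psi> p) p)^2) \<le> 4"
          "integral ?Q (\<lambda>p. (pdt UNIV (\<lambda>p. \<phi> p - \<psi> p) p)^2) \<le> 4"
          unfolding d using B[OF \<open>\<phi> \<in> B\<close>] B[OF \<open>\<psi> \<in> B\<close>]
          by (auto intro: rect_integral_diff_sq_le dest: has_partialsD(2,3))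
      qed
      with \<psi>(1) show ?thesis by auto
    qed
    moreover have "B0 \<subseteq> test_functions \<Omega>" using B0(2) by (auto simp: B_def)
    ultimately show "\<exists>B0. finite B0 \<and> B0 \<subseteq> test_functions \<Omega> \<and> (\<forall>\<phi>\<in>test_functions \<Omega>. H1_norm \<phi> \<le> 1 \<longrightarrow>
        (\<exists>\<psi>\<in>B0. \<forall>\<Lambda>\<in>D ` {0<..}. \<bar>\<Lambda> (\<lambda>p. \<phi> p - \<psi> p)\<bar> \<le> \<delta>))"
      using B0(1) by (intro exI[of _ B0]) (auto simp: B_def)
  qed
  then show ?thesis by (auto simp: D_def)
qed

text \<open>Bridge from the assumptions of the theorem to the locale. The sign of L is left open
  here, so |L| enters the locale as the growth constant of G.\<close>

lemma relaxation_of_solution: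
  fixes A :: "real^'n^'n"
  assumes A: "transpose A = A" "0 < a" "\<And>v. a * (norm v)^2 \<le> v \<bullet> (A *v v)"
    and pos: "0 < \<alpha>" "0 < \<beta>" "0 < T" "0 < \<epsilon>" "0 < \<nu>"
    and FG: "C1_map F" "continuous_on UNIV G" "\<And>w. norm (G w) \<le> L * norm w"
    and sol: "relaxation_solution A F G T \<epsilon> u" "decaying T u"
    and pair: "entropy_pair F \<eta> q"
    and hess: "\<And>w. quad_le (\<beta> *\<^sub>R mat 1) (hess \<eta> w)" "\<And>w. quad_le (hess \<eta> w) ((\<alpha> / 2) *\<^sub>R mat 1)"
    and min: "\<And>w. \<eta> w \<ge> \<eta> 0" "\<eta> 0 = 0" "grad \<eta> 0 = 0"
    and subchar: "\<And>w. quad_le (\<nu> *\<^sub>R mat 1)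
        ((1 / 2) *\<^sub>R (A ** hess \<eta> w + hess \<eta> w ** A) - \<alpha> *\<^sub>R (transpose (jac F w) ** jac F w))"
  obtains uxt where "relaxation A F G \<eta> q \<alpha> \<beta> \<nu> \<bar>L\<bar> T \<epsilon> a u (pdx u) (pdt {0..T} u)
    (pdx (pdx u)) uxt (pdt {0..T} (pdt {0..T} u))"
proof -
  have "smooth_xt (strip T) u" using sol(1) by (simp add: relaxation_solution_def)
  then obtain uxt where P: "has_partials UNIV {0..T} u (pdx u) (pdt {0..T} u)"
    "has_partials UNIV {0..T} (pdx u) (pdx (pdx u)) uxt"
    "has_partials UNIV {0..T} (pdt {0..T} u) uxt (pdt {0..T} (pdt {0..T} u))"
    using smooth_strip_partials pos(3) by blast
  have C2: "C2_scalar \<eta>" using pair by (simp add: entropy_pair_def)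
  note A_sym = symmetric_matrix_inner[OF A(1)]
  have "relaxation A F G \<eta> q \<alpha> \<beta> \<nu> \<bar>L\<bar> T \<epsilon> a u (pdx u) (pdt {0..T} u)
    (pdx (pdx u)) uxt (pdt {0..T} (pdt {0..T} u))"
  proof
    show "norm (G w) \<le> \<bar>L\<bar> * norm w" for w
      using FG(3)[of w] mult_right_mono[OF abs_ge_self norm_ge_zero, of L w] by linarith
    show "\<beta> * (v \<bullet> v) \<le> v \<bullet> (hess \<eta> w *v v)" "v \<bullet> (hess \<eta> w *v v) \<le> \<alpha> / 2 * (v \<bullet> v)" for v w
      using hess by (simp_all only: quad_le_scalar_left quad_le_scalar_right)
    show "\<nu> * (norm v)^2 + \<alpha> * (norm (jac F w *v v))^2 \<le> (A *v v) \<bullet> (hess \<eta> w *v v)" for v w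
    proof -
      \<comment> \<open>A and H = \<open>hess \<eta> w\<close> are symmetric, so A H and H A have
        the same quadratic form, and half their sum takes the value (A v) . (H v).\<close>
      have 1: "v \<bullet> ((A ** hess \<eta> w) *v v) = (A *v v) \<bullet> (hess \<eta> w *v v)"
        by (simp add: A_sym flip: matrix_vector_mul_assoc)
      have 2: "v \<bullet> ((hess \<eta> w ** A) *v v) = (A *v v) \<bullet> (hess \<eta> w *v v)"
        using hess_symmetric[OF C2, of w "A *v v" v]
        by (simp add: inner_commute flip: matrix_vector_mul_assoc)
      have 3: "v \<bullet> ((transpose (jac F w) ** jac F w) *v v) = (norm (jac F w *v v))^2"
        using dot_lmul_matrix[of "jac F w *v v" "jac F w" v]
        by (simp add: power2_norm_eq_inner inner_commute flip: matrix_vector_mul_assoc transpose_matrix_vector)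
      have "\<nu> * (v \<bullet> v) \<le> v \<bullet> (((1 / 2) *\<^sub>R (A ** hess \<eta> w + hess \<eta> w ** A) - \<alpha> *\<^sub>R (transpose (jac F w) ** jac F w)) *v v)"
        using subchar by (simp only: quad_le_scalar_left)
      also have "\<dots> = 1 / 2 * (v \<bullet> ((A ** hess \<eta> w) *v v) + v \<bullet> ((hess \<eta> w ** A) *v v))
          - \<alpha> * (v \<bullet> ((transpose (jac F w) ** jac F w) *v v))"
        by (simp add: matrix_vector_mult_diff_rdistrib matrix_vector_mult_add_rdistrib inner_diff_right inner_add_right
          flip: scaleR_matrix_vector_assoc)
      finally show ?thesis unfolding 1 2 3 by (simp add: power2_norm_eq_inner)
    qed
    show "pdt {0..T} u p + jac F (u p) *v pdx u p
        = G (u p) + \<epsilon> *\<^sub>R (A *v pdx (pdx u) p - pdt {0..T} (pdt {0..T} u) p)" if p: "p \<in> UNIV \<times> {0..T}" for p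
    proof -
      obtain x t where xt: "p = (x, t)" "t \<in> {0..T}" using p by auto
      have "((\<lambda>y. F (u (y, t))) has_vector_derivative jac F (u (x, t)) *v pdx u (x, t)) (at x)"
        by (rule has_vector_derivative_chain_at[OF jac_has_derivative[OF FG(1)] has_partialsD(4)[OF P(1) UNIV_I xt(2)]])
      then have "pdx (\<lambda>p. F (u p)) p = jac F (u p) *v pdx u p"
        by (simp add: pdx_def xt(1) vector_derivative_at)
      moreover have "p \<in> strip T" using p by (simp add: strip_def)
      then have "pdt {0..T} u p + pdx (\<lambda>p. F (u p)) p
          = G (u p) + \<epsilon> *\<^sub>R (A *v pdx (pdx u) p - pdt {0..T} (pdt {0..T} u) p)"
        using sol(1) unfolding relaxation_solution_def by blast
      ultimately show ?thesis by (simp only:)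
    qed
    show "\<exists>K. \<forall>p\<in>UNIV \<times> {0..T}. (1 + \<bar>fst p\<bar>) * (norm (u p) + norm (pdx u p) + norm (pdt {0..T} u p)) \<le> K"
    proof -
      have dec: "\<exists>K. \<forall>p\<in>strip T. (1 + \<bar>fst p\<bar>) * norm (f p) \<le> K"
        if "rapidly_decaying T f" for f :: "real \<times> real \<Rightarrow> real^'n"
        using that unfolding rapidly_decaying_def by (metis power_one_right)
      obtain K1 K2 K3 where "\<forall>p\<in>strip T. (1 + \<bar>fst p\<bar>) * norm (u p) \<le> K1"
        "\<forall>p\<in>strip T. (1 + \<bar>fst p\<bar>) * norm (pdx u p) \<le> K2" "\<forall>p\<in>strip T. (1 + \<bar>fst p\<bar>) * norm (pdt {0..T} u p) \<le> K3"
        using sol(2) dec unfolding decaying_def by meson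
      then show ?thesis
        by (intro exI[of _ "K1 + K2 + K3"]) (simp add: strip_def distrib_left add_mono)
    qed
    show "0 \<le> \<eta> w" for w using min(1)[of w] min(2) by simp
  qed (use A A_sym pos FG pair min P in \<open>auto\<close>)
  then show thesis by (rule that)
qed

theorem theorem4p1p3:
  fixes A :: "real^'n^'n" and \<alpha> \<beta> T L :: real
  assumes "transpose A = A" and "\<forall>v. v \<noteq> 0 \<longrightarrow> 0 < v \<bullet> (A *v v)"
    and "0 < \<alpha>" and "0 < \<beta>" and "0 < T"
  shows "\<exists>C1>0. \<forall>(F :: real^'n \<Rightarrow> real^'n) (G :: real^'n \<Rightarrow> real^'n) \<eta> q
      (U :: real \<Rightarrow> real \<times> real \<Rightarrow> real^'n).
    C1_map F \<and> continuous_on UNIV G \<and> G 0 = 0 \<and>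
    (\<forall>\<epsilon>>0. relaxation_solution A F G T \<epsilon> (U \<epsilon>) \<and> decaying T (U \<epsilon>)) \<and>
    strictly_convex \<eta> \<and> entropy_pair F \<eta> q \<and>
    (\<forall>u. quad_le (\<beta> *\<^sub>R mat 1) (hess \<eta> u) \<and> quad_le (hess \<eta> u) ((\<alpha> / 2) *\<^sub>R mat 1)) \<and>
    (\<forall>u. \<eta> u \<ge> \<eta> 0) \<and> \<eta> 0 = 0 \<and> grad \<eta> 0 = 0 \<and>
    (\<exists>\<nu>>0. \<forall>u. quad_le (\<nu> *\<^sub>R mat 1)
        ((1 / 2) *\<^sub>R (A ** hess \<eta> u + hess \<eta> u ** A)
          - \<alpha> *\<^sub>R (transpose (jac F u) ** jac F u))) \<and>
    (\<forall>K. compact K \<longrightarrow> (\<exists>LK>0. \<forall>u. \<forall>v\<in>K. norm (G u - G v) \<le> LK * norm (u - v))) \<and>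
    (\<forall>u. norm (G u) \<le> L * norm u)
    \<longrightarrow>
    (\<forall>\<epsilon>>0. \<forall>t\<in>{0..T}. energy T \<epsilon> (U \<epsilon>) t \<le> C1 * energy T \<epsilon> (U \<epsilon>) 0) \<and>
    (bounded_data T U \<longrightarrow>
      (\<forall>\<eta>' q'. entropy_pair F \<eta>' q' \<and>
         (\<exists>C. \<forall>u. \<bar>\<eta>' u\<bar> \<le> C \<and> \<bar>q' u\<bar> \<le> C \<and> norm (grad \<eta>' u) \<le> C \<and> norm (hess \<eta>' u) \<le> C)
         \<longrightarrow>
         (\<exists>K. compactin (Hm1_loc_topology T) K \<and>
            (\<forall>\<epsilon>>0. dist_dt_dx T (\<lambda>p. \<eta>' (U \<epsilon> p)) (\<lambda>p. q' (U \<epsilon> p)) \<in> K))))"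
proof -
  obtain a where a: "0 < a" "\<And>v. a * (norm v)\<^sup>2 \<le> v \<bullet> (A *v v)"
    using positive_definite_lower_bound[OF assms(2)] by blast
  have lo: "0 < energy_lower \<alpha> \<beta> a" using assms a(1) by (simp add: energy_lower_def)
  have up: "0 < energy_upper \<alpha> A"
    by (rule energy_upper_positive[OF assms(3)])
  \<comment> \<open>Built from A (through a and norm A), \<alpha>, \<beta>, T and |L|, so it is
    fixed before F, G, the entropy and the solutions. It is free of \<nu>, since the stability
    estimate discards the dissipation.\<close>
  define C1 where "C1 = exp (growth_rate \<alpha> \<beta> \<bar>L\<bar> * T) * energy_upper \<alpha> A / energy_lower \<alpha> \<beta> a"
  have "0 < C1" unfolding C1_def by (intro divide_pos_pos mult_pos_pos lo up exp_gt_zero)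
  show ?thesis
  proof (rule exI[of _ C1], rule conjI[OF \<open>0 < C1\<close>], intro allI impI, elim conjE exE)
    fix F G :: "real^'n \<Rightarrow> real^'n" and \<eta> q :: "real^'n \<Rightarrow> real" and U :: "real \<Rightarrow> real \<times> real \<Rightarrow> real^'n"
      and \<nu> :: real
    assume F: "C1_map F" and G: "continuous_on UNIV G" "\<forall>u. norm (G u) \<le> L * norm u"
      and sol: "\<forall>\<epsilon>>0. relaxation_solution A F G T \<epsilon> (U \<epsilon>) \<and> decaying T (U \<epsilon>)"
      and pair: "entropy_pair F \<eta> q"
      and hess: "\<forall>u. quad_le (\<beta> *\<^sub>R mat 1) (hess \<eta> u) \<and> quad_le (hess \<eta> u) ((\<alpha> / 2) *\<^sub>R mat 1)"
      and min: "\<forall>u. \<eta> u \<ge> \<eta> 0" "\<eta> 0 = 0" "grad \<eta> 0 = 0"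
      and \<nu>: "0 < \<nu>" "\<forall>u. quad_le (\<nu> *\<^sub>R mat 1)
        ((1 / 2) *\<^sub>R (A ** hess \<eta> u + hess \<eta> u ** A) - \<alpha> *\<^sub>R (transpose (jac F u) ** jac F u))"
    define Ux Ut where "Ux \<epsilon> = pdx (U \<epsilon>)" and "Ut \<epsilon> = pdt {0..T} (U \<epsilon>)" for \<epsilon>
    have "\<exists>uxt. relaxation A F G \<eta> q \<alpha> \<beta> \<nu> \<bar>L\<bar> T \<epsilon> a (U \<epsilon>) (Ux \<epsilon>) (Ut \<epsilon>)
        (pdx (Ux \<epsilon>)) uxt (pdt {0..T} (Ut \<epsilon>))" if \<epsilon>: "0 < \<epsilon>" for \<epsilon>
    proof -
      obtain uxt where "relaxation A F G \<eta> q \<alpha> \<beta> \<nu> \<bar>L\<bar> T \<epsilon> a (U \<epsilon>) (pdx (U \<epsilon>)) (pdt {0..T} (U \<epsilon>))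
          (pdx (pdx (U \<epsilon>))) uxt (pdt {0..T} (pdt {0..T} (U \<epsilon>)))"
        by (rule relaxation_of_solution[OF assms(1) a assms(3-5) \<epsilon> \<nu>(1) F G(1) spec[OF G(2)]
            sol[rule_format, OF \<epsilon>, THEN conjunct1] sol[rule_format, OF \<epsilon>, THEN conjunct2] pair
            spec[OF hess, THEN conjunct1] spec[OF hess, THEN conjunct2] spec[OF min(1)] min(2,3) spec[OF \<nu>(2)]])
      then show ?thesis unfolding Ux_def Ut_def by blast
    qed
    then obtain Uxt where rel: "\<And>\<epsilon>. 0 < \<epsilon> \<Longrightarrow> relaxation A F G \<eta> q \<alpha> \<beta> \<nu> \<bar>L\<bar> T \<epsilon> a (U \<epsilon>) (Ux \<epsilon>) (Ut \<epsilon>)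
        (pdx (Ux \<epsilon>)) (Uxt \<epsilon>) (pdt {0..T} (Ut \<epsilon>))" by metis
    have energy: "energy T \<epsilon> (U \<epsilon>) t = (LINT x|lborel. relaxation.dens \<epsilon> (U \<epsilon>) (Ux \<epsilon>) (Ut \<epsilon>) (x, t))"
      if "0 < \<epsilon>" for \<epsilon> t
      unfolding energy_def relaxation.dens_def[OF rel[OF that]] unfolding Ux_def Ut_def ..
    have stable: "energy T \<epsilon> (U \<epsilon>) t \<le> C1 * energy T \<epsilon> (U \<epsilon>) 0" if "0 < \<epsilon>" "t \<in> {0..T}" for \<epsilon> t
      using relaxation.stability[OF rel[OF that(1)] that(2)] lo
      by (simp add: energy[OF that(1)] C1_def field_simps)
    have compact: "\<exists>K. compactin (Hm1_loc_topology T) K \<and> (\<forall>\<epsilon>>0. dist_dt_dx T (\<lambda>p. \<eta>' (U \<epsilon> p)) (\<lambda>p. q' (U \<epsilon> p)) \<in> K)"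
      if "bounded_data T U" and H': "entropy_pair F \<eta>' q' \<and>
         (\<exists>C. \<forall>u. \<bar>\<eta>' u\<bar> \<le> C \<and> \<bar>q' u\<bar> \<le> C \<and> norm (grad \<eta>' u) \<le> C \<and> norm (hess \<eta>' u) \<le> C)" for \<eta>' q'
    proof -
      obtain M where M: "\<And>\<epsilon>. 0 < \<epsilon> \<Longrightarrow> energy T \<epsilon> (U \<epsilon>) 0 \<le> M * (1 + \<epsilon>\<^sup>2)"
        using \<open>bounded_data T U\<close> unfolding bounded_data_def by blast
      obtain C where C: "\<And>w. \<bar>\<eta>' w\<bar> \<le> C" "\<And>w. \<bar>q' w\<bar> \<le> C" "\<And>w. norm (grad \<eta>' w) \<le> C" "\<And>w. norm (hess \<eta>' w) \<le> C"
        using H' by blast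
      show ?thesis
      proof (rule entropy_production_compact[OF rel])
        show "(LINT x|lborel. relaxation.dens \<epsilon> (U \<epsilon>) (Ux \<epsilon>) (Ut \<epsilon>) (x, 0)) \<le> M * (1 + \<epsilon>\<^sup>2)" if "0 < \<epsilon>" for \<epsilon>
          using M[OF that] by (simp add: energy[OF that])
        show "entropy_pair F \<eta>' q'" using H' by blast
      qed (use C in auto)
    qed
    show "(\<forall>\<epsilon>>0. \<forall>t\<in>{0..T}. energy T \<epsilon> (U \<epsilon>) t \<le> C1 * energy T \<epsilon> (U \<epsilon>) 0) \<and>
      (bounded_data T U \<longrightarrow>
      (\<forall>\<eta>' q'. entropy_pair F \<eta>' q' \<and>
         (\<exists>C. \<forall>u. \<bar>\<eta>' u\<bar> \<le> C \<and> \<bar>q' u\<bar> \<le> C \<and> norm (grad \<eta>' u) \<le> C \<and> norm (hess \<eta>' u) \<le> C)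
         \<longrightarrow>
         (\<exists>K. compactin (Hm1_loc_topology T) K \<and>
            (\<forall>\<epsilon>>0. dist_dt_dx T (\<lambda>p. \<eta>' (U \<epsilon> p)) (\<lambda>p. q' (U \<epsilon> p)) \<in> K))))"
      by (intro conjI allI ballI impI stable; (rule compact)?; assumption)
  qed
qed

end
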